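(* Let $n,l\in\mathbb N$, $1<p_1,\dots,p_l<\infty$, $\frac1p=\frac1{p_1}+\cdots+\frac1{p_l}$, $1<u<\infty$ with $\frac1u+\frac1{u'}=1$, and $0<s<\infty$. Suppose that $$\|T_m(f_1,\dots,f_l)\|_{L^p(\mathbb R^n)}\lesssim\mathcal A^u_s[m]\prod_{i=1}^l\|f_i\|_{L^{p_i}(\mathbb R^n)}$$ for all $m$ with $\mathcal A^u_s[m]<\infty$ and all Schwartz $f_i$ on $\mathbb R^n$. Then necessarily $$\frac sn\ge\max\Big\{\frac lu,\ \max_I\Big(\frac1p-\frac12-\sum_{i\in I}\big(\tfrac1{p_i}-\tfrac12\big)\Big),\ \max_I\Big(\frac1p-\frac1{u'}-\sum_{i\in I}\big(\tfrac1{p_i}-\tfrac1u\big)\Big)\Big\},$$ where the maxima run over all subsets $I\subseteq\{1,\dots,l\}$.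
   Context: For bounded $m$ on $\mathbb R^{ln}$ and Schwartz $f_i$ on $\mathbb R^n$: $T_m(f_1,\dots,f_l)(x)=\int_{(\mathbb R^n)^l}\widehat{f_1}(\xi_1)\cdots\widehat{f_l}(\xi_l)m(\xi_1,\dots,\xi_l)e^{2\pi i\langle x,\xi_1+\cdots+\xi_l\rangle}d\xi$, with $\widehat f(\xi)=\int f(x)e^{-2\pi i\langle x,\xi\rangle}dx$. $\Theta$ is a fixed Schwartz function on $\mathbb R^{ln}$ with $\widehat\Theta$ supported in $\{1/2\le|\vec\xi|\le2\}$; $L^u_s(\mathbb R^{ln})$ is the Sobolev space with norm $\|[(1+4\pi^2|\cdot|^2)^{s/2}\widehat F]^\vee\|_{L^u}$; $\mathcal A^u_s[m]=\sup_{k\in\mathbb Z}\|m(2^k\cdot)\widehat\Theta\|_{L^u_s(\mathbb R^{ln})}$. *)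

theory Defs
  imports "HOL-Analysis.Analysis"
begin

definition FT :: "('a::euclidean_space \<Rightarrow> complex) \<Rightarrow> 'a \<Rightarrow> complex" where
  "FT f \<xi> = (LINT x|lborel. f x * cis (- 2 * pi * (x \<bullet> \<xi>)))"

definition schwartz :: "('a::euclidean_space \<Rightarrow> complex) \<Rightarrow> bool" where
  "schwartz f \<longleftrightarrow>
     (\<exists>D :: 'a list \<Rightarrow> 'a \<Rightarrow> complex.
        D [] = f \<and>
        (\<forall>ds \<in> lists Basis. continuous_on UNIV (D ds)) \<and>
        (\<forall>ds \<in> lists Basis. \<forall>b \<in> Basis. \<forall>x.
            ((\<lambda>t::real. D ds (x + t *\<^sub>R b)) has_vector_derivative D (b # ds) x) (at 0)) \<and>
        (\<forall>ds \<in> lists Basis. \<forall>N::nat. \<exists>C. \<forall>x. (1 + norm x) ^ N * norm (D ds x) \<le> C))"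

definition enn_root :: "real \<Rightarrow> ennreal \<Rightarrow> ennreal" where
  "enn_root p I = (if I = top then top else ennreal (enn2real I powr (1 / p)))"

definition Lp_norm :: "real \<Rightarrow> ('a::euclidean_space \<Rightarrow> complex) \<Rightarrow> ennreal" where
  "Lp_norm p f = enn_root p (\<integral>\<^sup>+ x. ennreal (norm (f x) powr p) \<partial>lborel)"

text \<open>The Sobolev norm of F is the L^u norm of G, where G is the (a.e. unique) L^u function
  whose distributional Fourier transform is (1 + 4 pi^2 |xi|^2)^(s/2) F^; it is \<infinity>
  if no such G exists.  The Fourier identity is tested against Schwartz functions:
  <G^, phi> = <G, phi^>.\<close>

definition sobolev_norm :: "real \<Rightarrow> real \<Rightarrow> ('a::euclidean_space \<Rightarrow> complex) \<Rightarrow> ennreal" where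
  "sobolev_norm u s F =
     (INF G \<in> {G. G \<in> borel_measurable lborel \<and> Lp_norm u G < top \<and>
                (\<forall>\<phi>. schwartz \<phi> \<longrightarrow>
                   (LINT x|lborel. G x * FT \<phi> x) =
                   (LINT \<xi>|lborel. complex_of_real ((1 + 4 * pi\<^sup>2 * (norm \<xi>)\<^sup>2) powr (s / 2))
                                     * FT F \<xi> * \<phi> \<xi>))}.
        Lp_norm u G)"

definition T_mult :: "(real^'n^'l \<Rightarrow> complex) \<Rightarrow> ('l \<Rightarrow> real^'n \<Rightarrow> complex) \<Rightarrow> real^'n \<Rightarrow> complex"
  where
  "T_mult m f x = (LINT \<xi>|lborel. (\<Prod>i\<in>UNIV. FT (f i) (\<xi> $ i)) * m \<xi>
                                   * cis (2 * pi * (x \<bullet> (\<Sum>i\<in>UNIV. \<xi> $ i))))"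

definition A_norm :: "(real^'n^'l \<Rightarrow> complex) \<Rightarrow> real \<Rightarrow> real \<Rightarrow> (real^'n^'l \<Rightarrow> complex) \<Rightarrow> ennreal"
  where
  "A_norm \<Theta> u s m = (SUP k::int. sobolev_norm u s (\<lambda>\<xi>. m ((2 powr real_of_int k) *\<^sub>R \<xi>) * FT \<Theta> \<xi>))"

end

theory Submission
  imports Defs "HOL-Probability.Probability"
begin

text \<open>
  Every condition is obtained by testing the inequality on one explicit Gaussian family. With complex
  weights \<open>w\<^sub>i\<close>, \<open>v\<close> of positive real part put
  \<open>m(\<xi>) = exp (- \<pi> (\<Sum>\<^sub>i w\<^sub>i |\<xi>\<^sub>i - a\<^sub>i|\<^sup>2 + v |\<Sum>\<^sub>i (\<xi>\<^sub>i - a\<^sub>i)|\<^sup>2))\<close> and let the Fourier transform of \<open>f\<^sub>i\<close> be a multiple of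
  \<open>exp (- \<pi> cnj w\<^sub>i |\<xi>\<^sub>i - a\<^sub>i|\<^sup>2)\<close>, so that the phases of \<open>f\<^sub>i\<close> and \<open>m\<close> cancel and
  \<open>T\<^sub>m f\<close> is, up to a modulation, a Gaussian that can be computed exactly. Taking \<open>w\<^sub>i = W\<^sup>2\<close> for
  \<open>i \<in> I\<close>, \<open>w\<^sub>i = 1\<close> otherwise, and \<open>v = W\<^sup>2\<close>, concentrates \<open>m\<close> at scale \<open>1/W\<close>; letting \<open>W\<close> tend to infinity
  gives the conditions that involve \<open>u\<close> (\<open>I\<close> the full index set gives \<open>s \<ge> l n / u\<close>). Taking
  \<open>w\<^sub>i = 1 + \<i> W\<close> for \<open>i \<in> I\<close> and \<open>v = 1 + \<i> W\<close> produces quadratic chirps, which give the conditions with \<open>1/2\<close>.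

  On the other side only an upper bound for the Sobolev norms is needed: if the derivatives of \<open>F\<close> of
  order \<open>i\<close> are bounded by \<open>W\<^sup>i A\<close>, then the norm of \<open>F\<close> of smoothness \<open>s\<close> is at most a constant times \<open>W\<^sup>s\<close> times the
  \<open>L\<^sup>u\<close> norm of \<open>A\<close>. For fractional \<open>s\<close> this follows by writing \<open>(1 - \<Delta>)\<^bsup>s/2\<^esup>\<close> as an
  integral over the heat semigroup, split at time \<open>W\<^sup>-\<^sup>2\<close>.
\<close>

section \<open>Rapidly decreasing functions and complex Gaussians\<close>

text \<open>Two obstacles shape the proof. The seminorm is a supremum over all dyadic dilates, so
  every estimate must be uniform in the dilation factor \<open>c\<close>. For the bumps this forces
  the centre \<open>a\<close> away from the origin: centred at 0, the dilates with small
  \<open>c\<close> would see the full height of \<open>m\<close> on the whole annulus. With all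
  \<open>a $ i\<close> equal to one unit vector, the weight \<open>v\<close> makes \<open>m\<close>
  exponentially small near 0. The chirps gain nothing from concentration and are centred at 0. For
  large \<open>c\<close>, each derivative of a dilate brings powers of \<open>c\<close>; on the
  annulus \<open>c\<close> is controlled by the exponent of \<open>m\<close>, so these powers are
  absorbed by giving up at most half of the Gaussian decay. The other obstacle is the branch of
  square roots of complex weights; it is avoided by passing to squares and moduli. The coupling
  weight \<open>v\<close> explains the constants in the claim: for the chirps it costs the output
  \<open>W powr (- n / 2)\<close>, whence the 1/2. For the bumps it costs
  \<open>W powr (- n)\<close> and gains \<open>W powr (- n / u)\<close> in the seminorm, which
  together make up 1/u'.\<close>

definition rapid :: "('a::euclidean_space \<Rightarrow> complex) \<Rightarrow> bool" where
  "rapid f \<longleftrightarrow> f \<in> borel_measurable borel \<and> (\<forall>N::nat. \<exists>C. \<forall>x. (1 + norm x) ^ N * norm (f x) \<le> C)"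

text \<open>A tensor product of one-dimensional integrable functions, so Tonelli gives integrability
  in every dimension at once; it is the majorant from which polynomial decay in the norm inherits
  integrability.\<close>

lemma integrable_inverse_prod_square:
  "integrable lborel (\<lambda>x::'a::euclidean_space. \<Prod>b\<in>Basis. inverse (1 + (x \<bullet> b)\<^sup>2))"
proof (rule integrableI_nonneg)
  have 1: "integrable lborel (\<lambda>x::real. inverse (1 + x\<^sup>2))"
    using integrable_inverse_1_plus_square by (simp add: set_integrable_def)
  have "(\<integral>\<^sup>+x. ennreal (\<Prod>b\<in>Basis. inverse (1 + (x \<bullet> b)\<^sup>2)) \<partial>(lborel::'a measure))
      = (\<integral>\<^sup>+x. (\<Prod>b\<in>Basis. ennreal (inverse (1 + (x \<bullet> b)\<^sup>2))) \<partial>(lborel::'a measure))"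
    by (subst prod_ennreal) auto
  also have "\<dots> = (\<Prod>b\<in>(Basis::'a set). (\<integral>\<^sup>+x. ennreal (inverse (1 + x\<^sup>2)) \<partial>lborel))"
    by (intro nn_integral_lborel_prod) auto
  also have "\<dots> < \<infinity>"
    using 1 by (simp add: real_integrable_def power_less_top_ennreal less_top)
  finally show "(\<integral>\<^sup>+x. ennreal (\<Prod>b\<in>Basis. inverse (1 + (x \<bullet> b)\<^sup>2)) \<partial>(lborel::'a measure)) < \<infinity>" .
qed (auto intro!: prod_nonneg AE_I2)

lemma prod_square_le_power_norm:
  "(\<Prod>b\<in>Basis. (1 + (x \<bullet> b)\<^sup>2)) \<le> (1 + norm (x::'a::euclidean_space)) ^ (2 * DIM('a))"
proof -
  have "(\<Prod>b\<in>Basis. (1 + (x \<bullet> b)\<^sup>2)) \<le> (\<Prod>b\<in>(Basis::'a set). (1 + norm x)\<^sup>2)"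
  proof (rule prod_mono, intro conjI)
    fix b :: 'a assume b: "b \<in> Basis"
    have "\<bar>x \<bullet> b\<bar> \<le> norm x" using b by (rule Basis_le_norm)
    then have "(x \<bullet> b)\<^sup>2 \<le> (norm x)\<^sup>2" using abs_le_square_iff by fastforce
    then show "1 + (x \<bullet> b)\<^sup>2 \<le> (1 + norm x)\<^sup>2"
      unfolding power2_sum by (simp add: add_increasing2)
    show "0 \<le> 1 + (x \<bullet> b)\<^sup>2" by simp
  qed
  also have "\<dots> = (1 + norm x) ^ (2 * DIM('a))"
    by (simp add: power_mult)
  finally show ?thesis .
qed

text \<open>Each coordinate of the product majorant costs two powers of \<open>1 + norm x\<close>,
  whence the exponent \<open>2 * DIM('a)\<close>.\<close>

lemma integrable_decay:
  "integrable lborel (\<lambda>x::'a::euclidean_space. inverse ((1 + norm x) ^ (2 * DIM('a))))"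
proof (rule Bochner_Integration.integrable_bound[OF integrable_inverse_prod_square])
  show "AE x::'a in lborel. norm (inverse ((1 + norm x) ^ (2 * DIM('a)))) \<le> norm (\<Prod>b\<in>Basis. inverse (1 + (x \<bullet> b)\<^sup>2))"
  proof (rule AE_I2)
    fix x :: 'a
    have "inverse ((1 + norm x) ^ (2 * DIM('a))) \<le> inverse (\<Prod>b\<in>Basis. (1 + (x \<bullet> b)\<^sup>2))"
      by (intro le_imp_inverse_le prod_square_le_power_norm prod_pos) (auto intro: add_pos_nonneg)
    then show "norm (inverse ((1 + norm x) ^ (2 * DIM('a)))) \<le> norm (\<Prod>b\<in>Basis. inverse (1 + (x \<bullet> b)\<^sup>2))"
      by (simp add: prod_inversef[symmetric] comp_def prod_nonneg)
  qed
qed auto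

lemma rapid_measurable [measurable_dest]: "rapid f \<Longrightarrow> f \<in> borel_measurable borel"
  by (simp add: rapid_def)

lemma rapid_bound:
  assumes "rapid f"
  obtains C where "C \<ge> 0" "\<And>x. norm (f x) \<le> C * inverse ((1 + norm x) ^ N)"
proof -
  obtain C where C: "\<And>x. (1 + norm x) ^ N * norm (f x) \<le> C"
    using assms by (auto simp: rapid_def)
  have "0 \<le> C" using C[of 0] by (meson norm_ge_zero order_trans mult_nonneg_nonneg zero_le_power add_nonneg_nonneg zero_le_one)
  moreover have "norm (f x) \<le> C * inverse ((1 + norm x) ^ N)" for x
  proof -
    have "(1 + norm x) ^ N > 0" by (simp add: add_pos_nonneg)
    then show ?thesis using C[of x] by (simp add: field_simps)
  qed
  ultimately show ?thesis using that by blast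
qed

lemma rapid_integrable:
  fixes f :: "'a::euclidean_space \<Rightarrow> complex"
  assumes "rapid f" shows "integrable lborel f"
proof -
  obtain C where C: "C \<ge> 0" "\<And>x. norm (f x) \<le> C * inverse ((1 + norm x) ^ (2 * DIM('a)))"
    using rapid_bound[OF assms] by blast
  show ?thesis
  proof (rule Bochner_Integration.integrable_bound)
    show "integrable lborel (\<lambda>x::'a. C * inverse ((1 + norm x) ^ (2 * DIM('a))))"
      by (intro integrable_mult_right integrable_decay)
    show "f \<in> borel_measurable lborel" using assms by (simp add: rapid_def)
    show "AE x in lborel. norm (f x) \<le> norm (C * inverse ((1 + norm x) ^ (2 * DIM('a))))"
      using C by (intro AE_I2) (simp add: abs_mult)
  qed
qed

lemma rapid_polynomial_mult:
  assumes f: "rapid f" and [measurable]: "g \<in> borel_measurable borel"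
    and g: "\<And>x. norm (g x) \<le> K * (1 + norm x) ^ M"
  shows "rapid (\<lambda>x. g x * f x)"
  unfolding rapid_def
proof (intro conjI allI)
  note [measurable] = rapid_measurable[OF f]
  show "(\<lambda>x. g x * f x) \<in> borel_measurable borel" by measurable
  fix N
  have K: "K \<ge> 0" using g[of 0] by simp (meson norm_ge_zero order_trans)
  obtain C where C: "\<And>x. (1 + norm x) ^ (N + M) * norm (f x) \<le> C"
    using f by (auto simp: rapid_def)
  have "(1 + norm x) ^ N * norm (g x * f x) \<le> K * C" for x
  proof -
    have "(1 + norm x) ^ N * norm (g x * f x) \<le> (1 + norm x) ^ N * ((K * (1 + norm x) ^ M) * norm (f x))"
      unfolding norm_mult by (intro mult_left_mono mult_right_mono g) auto
    also have "\<dots> = K * ((1 + norm x) ^ (N + M) * norm (f x))" by (simp add: power_add)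
    also have "\<dots> \<le> K * C" by (intro mult_left_mono C K)
    finally show ?thesis .
  qed
  then show "\<exists>C. \<forall>x. (1 + norm x) ^ N * norm (g x * f x) \<le> C" by blast
qed

lemma rapid_inner_mult: "rapid f \<Longrightarrow> rapid (\<lambda>x. complex_of_real (x \<bullet> b) * f x)"
proof (rule rapid_polynomial_mult[where K="norm b" and M=1])
  fix x
  have "\<bar>x \<bullet> b\<bar> \<le> norm b * norm x" using Cauchy_Schwarz_ineq2[of x b] by (simp add: mult.commute)
  also have "\<dots> \<le> norm b * (1 + norm x)" by (intro mult_left_mono) auto
  finally show "norm (complex_of_real (x \<bullet> b)) \<le> norm b * (1 + norm x) ^ 1" by simp
qed auto

lemma rapid_const_mult: "rapid f \<Longrightarrow> rapid (\<lambda>x. c * f x)"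
  by (rule rapid_polynomial_mult[where K="norm c" and M=0]) auto

lemma rapid_cis_mult: "rapid f \<Longrightarrow> h \<in> borel_measurable borel \<Longrightarrow> rapid (\<lambda>x. cis (h x) * f x)"
proof (rule rapid_polynomial_mult[where K=1 and M=0])
  assume [measurable]: "h \<in> borel_measurable borel"
  show "(\<lambda>x. cis (h x)) \<in> borel_measurable borel"
    by (simp add: cis_conv_exp)
qed auto

lemma rapid_add: "rapid f \<Longrightarrow> rapid g \<Longrightarrow> rapid (\<lambda>x. f x + g x)"
  unfolding rapid_def
proof (intro conjI allI)
  assume f: "f \<in> borel_measurable borel \<and> (\<forall>N::nat. \<exists>C. \<forall>x. (1 + norm x) ^ N * norm (f x) \<le> C)"
  assume g: "g \<in> borel_measurable borel \<and> (\<forall>N::nat. \<exists>C. \<forall>x. (1 + norm x) ^ N * norm (g x) \<le> C)"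
  show "(\<lambda>x. f x + g x) \<in> borel_measurable borel" using f g by auto
  fix N :: nat
  obtain C D where *: "\<And>x. (1 + norm x) ^ N * norm (f x) \<le> C" "\<And>x. (1 + norm x) ^ N * norm (g x) \<le> D"
    using f g by blast
  have "(1 + norm x) ^ N * norm (f x + g x) \<le> C + D" for x
  proof -
    have "(1 + norm x) ^ N * norm (f x + g x) \<le> (1 + norm x) ^ N * (norm (f x) + norm (g x))"
      by (intro mult_left_mono norm_triangle_ineq) auto
    also have "\<dots> \<le> C + D" using *[of x] by (simp add: distrib_left)
    finally show ?thesis .
  qed
  then show "\<exists>C. \<forall>x. (1 + norm x) ^ N * norm (f x + g x) \<le> C" by blast
qed

text \<open>Derivatives of the localised multipliers enter the Fourier calculus through this lemma:
  \<open>rapid\<close> asks for no smoothness, so boundedness and bounded support suffice.\<close>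

lemma rapid_compact_support:
  assumes "f \<in> borel_measurable borel" "\<And>x. norm (f x) \<le> C" "\<And>x. norm x > R \<Longrightarrow> f x = 0"
  shows "rapid f"
  unfolding rapid_def
proof (intro conjI allI)
  fix N :: nat
  have C: "C \<ge> 0" using assms(2) norm_ge_zero order_trans by blast
  have "(1 + norm x) ^ N * norm (f x) \<le> (1 + \<bar>R\<bar>) ^ N * C" for x
  proof (cases "norm x > R")
    case False
    then show ?thesis using C by (intro mult_mono power_mono assms) auto
  qed (use assms(3) C in auto)
  then show "\<exists>C. \<forall>x. (1 + norm x) ^ N * norm (f x) \<le> C" by blast
qed (use assms in auto)

section \<open>Differentiation under the integral sign and the Fourier transform\<close>

lemma has_vector_derivative_at_iff_lim:
  "(f has_vector_derivative D) (at t0) \<longleftrightarrow> ((\<lambda>h. (f (t0 + h) - f t0) /\<^sub>R h) \<longlongrightarrow> D) (at 0)"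
proof -
  have "(\<lambda>h. norm (f (t0 + h) - f t0 - h *\<^sub>R D) / norm h) \<midarrow>0\<rightarrow> 0 \<longleftrightarrow>
     (\<lambda>h. norm ((f (t0 + h) - f t0) /\<^sub>R h - D)) \<midarrow>0\<rightarrow> 0"
  proof (rule filterlim_cong[OF refl refl])
    show "\<forall>\<^sub>F h in at 0. norm (f (t0 + h) - f t0 - h *\<^sub>R D) / norm h = norm ((f (t0 + h) - f t0) /\<^sub>R h - D)"
      unfolding eventually_at_filter
    proof (rule always_eventually, intro allI impI)
      fix h :: real assume "h \<noteq> 0"
      then have "(f (t0 + h) - f t0) /\<^sub>R h - D = (f (t0 + h) - f t0 - h *\<^sub>R D) /\<^sub>R h"
        by (simp add: scaleR_diff_right)
      then show "norm (f (t0 + h) - f t0 - h *\<^sub>R D) / norm h = norm ((f (t0 + h) - f t0) /\<^sub>R h - D)"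
        by (simp only: norm_scaleR norm_inverse) (simp add: divide_inverse mult.commute)
    qed
  qed
  then show ?thesis
    unfolding has_vector_derivative_def has_derivative_at
    by (simp add: bounded_linear_scaleR_left tendsto_norm_zero_iff LIM_zero_iff)
qed

text \<open>Dominated convergence along an arbitrary sequence of increments: the mean value
  inequality bounds the difference quotients by the same \<open>g\<close> that bounds the
  derivatives.\<close>

lemma has_vector_derivative_integral:
  fixes f f' :: "real \<Rightarrow> 'a \<Rightarrow> complex"
  assumes \<delta>: "\<delta> > 0"
    and der: "\<And>t x. \<bar>t - t0\<bar> < \<delta> \<Longrightarrow> ((\<lambda>t. f t x) has_vector_derivative f' t x) (at t)"
    and int: "\<And>t. \<bar>t - t0\<bar> < \<delta> \<Longrightarrow> integrable M (f t)"
    and bnd: "\<And>t x. \<bar>t - t0\<bar> < \<delta> \<Longrightarrow> norm (f' t x) \<le> g x"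
    and g: "integrable M g"
    and [measurable]: "f' t0 \<in> borel_measurable M"
  shows "((\<lambda>t. LINT x|M. f t x) has_vector_derivative (LINT x|M. f' t0 x)) (at t0)"
  unfolding has_vector_derivative_at_iff_lim
proof -
  show "(\<lambda>h. ((LINT x|M. f (t0 + h) x) - (LINT x|M. f t0 x)) /\<^sub>R h) \<midarrow>0\<rightarrow> (LINT x|M. f' t0 x)"
    unfolding tendsto_at_iff_sequentially
  proof (intro allI impI)
    fix X :: "nat \<Rightarrow> real"
    assume X0: "\<forall>i. X i \<in> UNIV - {0}" and X: "X \<longlonglongrightarrow> 0"
    have "eventually (\<lambda>n. \<bar>X n\<bar> < \<delta>) sequentially"
      using tendstoD[OF X \<delta>] by (simp add: dist_real_def)
    then obtain N where N: "\<And>n. n \<ge> N \<Longrightarrow> \<bar>X n\<bar> < \<delta>" by (auto simp: eventually_sequentially)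
    \<comment> \<open>The sequence is shifted by \<open>N\<close> so that every increment is smaller
      than \<delta>, where alone the majorant is available; \<open>LIMSEQ_offset\<close> undoes the
      shift at the end.\<close>
    have lim: "(\<lambda>n. LINT x|M. (f (t0 + X (n + N)) x - f t0 x) /\<^sub>R X (n + N)) \<longlonglongrightarrow> (LINT x|M. f' t0 x)"
    proof (rule integral_dominated_convergence[OF _ _ g])
      show "f' t0 \<in> borel_measurable M" by fact
      fix n
      have m1: "f (t0 + X (n + N)) \<in> borel_measurable M" using int[of "t0 + X (n+N)"] N[of "n+N"] by auto
      have m2: "f t0 \<in> borel_measurable M" using int[of t0] \<delta> by auto
      show "(\<lambda>x. (f (t0 + X (n + N)) x - f t0 x) /\<^sub>R X (n + N)) \<in> borel_measurable M"
        using m1 m2 by measurable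
      show "AE x in M. norm ((f (t0 + X (n + N)) x - f t0 x) /\<^sub>R X (n + N)) \<le> g x"
      proof (rule AE_I2)
        fix x
        let ?S = "{t. \<bar>t - t0\<bar> < \<delta>}"
        have S: "?S = ball t0 \<delta>" by (auto simp: dist_real_def)
        have "norm (f (t0 + X (n+N)) x - f t0 x) \<le> g x * norm ((t0 + X (n+N)) - t0)"
        proof (rule differentiable_bound[where S="?S" and f'="\<lambda>t h. h *\<^sub>R f' t x"])
          show "convex ?S" unfolding S by simp
          fix t assume t: "t \<in> ?S"
          show "((\<lambda>t. f t x) has_derivative (\<lambda>h. h *\<^sub>R f' t x)) (at t within ?S)"
            using der[of t x] t has_derivative_at_withinI unfolding has_vector_derivative_def by blast
          have "onorm (\<lambda>h::real. h *\<^sub>R f' t x) \<le> norm (f' t x)"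
            by (rule onorm_bound) (auto simp: mult.commute)
          then show "onorm (\<lambda>h::real. h *\<^sub>R f' t x) \<le> g x"
            using bnd[of t x] t by auto
        qed (use \<delta> N[of "n+N"] in auto)
        moreover have "X (n + N) \<noteq> 0" using X0 by auto
        ultimately have "inverse \<bar>X (n+N)\<bar> * norm (f (t0 + X (n+N)) x - f t0 x) \<le> g x"
          by (simp add: field_simps)
        then show "norm ((f (t0 + X (n + N)) x - f t0 x) /\<^sub>R X (n + N)) \<le> g x"
          by simp
      qed
    next
      show "AE x in M. (\<lambda>n. (f (t0 + X (n + N)) x - f t0 x) /\<^sub>R X (n + N)) \<longlonglongrightarrow> f' t0 x"
      proof (rule AE_I2)
        fix x
        have "((\<lambda>t. f t x) has_vector_derivative f' t0 x) (at t0)" using der[of t0 x] \<delta> by auto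
        then have "(\<lambda>h. (f (t0 + h) x - f t0 x) /\<^sub>R h) \<midarrow>0\<rightarrow> f' t0 x"
          by (simp add: has_vector_derivative_at_iff_lim)
        then have "((\<lambda>h. (f (t0 + h) x - f t0 x) /\<^sub>R h) \<circ> X) \<longlonglongrightarrow> f' t0 x"
          unfolding tendsto_at_iff_sequentially using X X0 by blast
        then show "(\<lambda>n. (f (t0 + X (n + N)) x - f t0 x) /\<^sub>R X (n + N)) \<longlonglongrightarrow> f' t0 x"
          using LIMSEQ_ignore_initial_segment[of _ _ N] by (fastforce simp: comp_def)
      qed
    qed
    have "(LINT x|M. (f (t0 + X (n + N)) x - f t0 x) /\<^sub>R X (n + N)) =
       ((LINT x|M. f (t0 + X (n+N)) x) - (LINT x|M. f t0 x)) /\<^sub>R X (n+N)" for n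
      using int[of t0] int[of "t0 + X (n+N)"] N[of "n+N"] \<delta> by simp
    with lim have "(\<lambda>n. ((LINT x|M. f (t0 + X (n+N)) x) - (LINT x|M. f t0 x)) /\<^sub>R X (n+N)) \<longlonglongrightarrow> (LINT x|M. f' t0 x)"
      by (simp only:)
    then show "((\<lambda>h. ((LINT x|M. f (t0 + h) x) - (LINT x|M. f t0 x)) /\<^sub>R h) \<circ> X) \<longlonglongrightarrow> (LINT x|M. f' t0 x)"
      unfolding comp_def by (rule LIMSEQ_offset)
  qed
qed


lemma borel_measurable_cis [measurable]:
  "h \<in> borel_measurable M \<Longrightarrow> (\<lambda>x. cis (h x)) \<in> borel_measurable M"
  by (simp add: cis_conv_exp)

lemma borel_measurable_FT [measurable]:
  assumes [measurable]: "f \<in> borel_measurable borel"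
  shows "FT f \<in> borel_measurable borel"
proof -
  have "(\<lambda>\<xi>. LINT x|lborel. f x * cis (- 2 * pi * (x \<bullet> \<xi>))) \<in> borel_measurable borel"
    by (rule sigma_finite_measure.borel_measurable_lebesgue_integral) (auto intro: lborel.sigma_finite_measure_axioms)
  then show ?thesis by (simp add: FT_def[abs_def])
qed

lemma integrable_mult_cis:
  assumes "integrable M f" "h \<in> borel_measurable M"
  shows "integrable M (\<lambda>x. f x * cis (h x))"
  using assms by (intro Bochner_Integration.integrable_bound[OF assms(1)]) (auto simp: norm_mult)

lemma norm_FT_le:
  assumes "integrable lborel f" shows "norm (FT f \<xi>) \<le> (LINT x|lborel. norm (f x))"
  unfolding FT_def by (rule order_trans[OF integral_norm_bound]) (simp add: norm_mult)

lemma has_vector_derivative_cis_affine: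
  "((\<lambda>t. cis (c + t * d)) has_vector_derivative (\<i> * complex_of_real d * cis (c + t * d))) (at t)"
proof -
  have "((\<lambda>z. exp (\<i> * (of_real c + z * of_real d))) has_field_derivative
      (\<i> * of_real d * exp (\<i> * (of_real c + of_real t * of_real d)))) (at (of_real t))"
    by (auto intro!: derivative_eq_intros)
  from has_vector_derivative_real_field[OF this] show ?thesis
    by (simp add: cis_conv_exp)
qed

lemma FT_cmult: "FT (\<lambda>x. c * f x) \<xi> = c * FT f \<xi>"
  by (simp add: FT_def mult.assoc)

text \<open>Derivatives along \<open>b\<close> are recorded at \<open>t = 0\<close> for every base
  point; moving the base point along the line recovers the derivative at every
  \<open>t\<close>.\<close>

lemma has_vector_derivative_line_shift:
  fixes F :: "'a::real_normed_vector \<Rightarrow> complex"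
  assumes "\<And>y. ((\<lambda>t. F (y + t *\<^sub>R b)) has_vector_derivative F' y) (at 0)"
  shows "((\<lambda>t. F (x + t *\<^sub>R b)) has_vector_derivative F' (x + t *\<^sub>R b)) (at t)"
  using assms[of "x + t *\<^sub>R b"]
  by (simp add: has_vector_derivative_at_iff_lim scaleR_add_left add.assoc)

lemma FT_has_vector_derivative:
  assumes f: "rapid f"
  shows "((\<lambda>t. FT f (\<xi> + t *\<^sub>R b)) has_vector_derivative
     FT (\<lambda>x. (- 2 * pi * \<i>) * (complex_of_real (x \<bullet> b) * f x)) (\<xi> + t *\<^sub>R b)) (at t)"
proof -
  note [measurable] = rapid_measurable[OF f]
  have r: "rapid (\<lambda>x. (- 2 * pi * \<i>) * (complex_of_real (x \<bullet> b) * f x))"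
    by (intro rapid_const_mult rapid_inner_mult f)
  have "((\<lambda>t. LINT x|lborel. f x * cis (- 2 * pi * (x \<bullet> (\<xi> + t *\<^sub>R b)))) has_vector_derivative
     (LINT x|lborel. (- 2 * pi * \<i>) * (complex_of_real (x \<bullet> b) * f x) * cis (- 2 * pi * (x \<bullet> (\<xi> + t *\<^sub>R b))))) (at t)"
  proof (rule has_vector_derivative_integral[where \<delta>=1 and g="\<lambda>x. norm ((- 2 * pi * \<i>) * (complex_of_real (x \<bullet> b) * f x))"])
    fix t x
    have "((\<lambda>t. cis (- 2 * pi * (x \<bullet> \<xi>) + t * (- 2 * pi * (x \<bullet> b)))) has_vector_derivative
      \<i> * of_real (- 2 * pi * (x \<bullet> b)) * cis (- 2 * pi * (x \<bullet> \<xi>) + t * (- 2 * pi * (x \<bullet> b)))) (at t)"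
      by (rule has_vector_derivative_cis_affine)
    from has_vector_derivative_mult_right[OF this, of "f x"]
    show "((\<lambda>t. f x * cis (- 2 * pi * (x \<bullet> (\<xi> + t *\<^sub>R b)))) has_vector_derivative
       (- 2 * pi * \<i>) * (complex_of_real (x \<bullet> b) * f x) * cis (- 2 * pi * (x \<bullet> (\<xi> + t *\<^sub>R b)))) (at t)"
      by (simp add: algebra_simps inner_add_right)
  next
    show "integrable lborel (\<lambda>x. norm ((- 2 * pi * \<i>) * (complex_of_real (x \<bullet> b) * f x)))"
      using rapid_integrable[OF r] by (rule integrable_norm)
    show "integrable lborel (\<lambda>x. f x * cis (- 2 * pi * (x \<bullet> (\<xi> + t *\<^sub>R b))))" for t
      by (intro integrable_mult_cis rapid_integrable f) auto
  qed (auto simp: norm_mult)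
  then show ?thesis by (simp add: FT_def)
qed

lemma lborel_integral_translate:
  fixes f :: "'a::euclidean_space \<Rightarrow> 'b::{banach, second_countable_topology}"
  assumes "f \<in> borel_measurable borel"
  shows "(LINT x|lborel. f (c + x)) = (LINT x|lborel. f x)"
  using integral_distr[of "(+) c" lborel borel f] assms by (simp add: lborel_distr_plus)

lemma lborel_nn_integral_translate:
  fixes f :: "'a::euclidean_space \<Rightarrow> ennreal"
  assumes "f \<in> borel_measurable borel"
  shows "(\<integral>\<^sup>+ x. f (c + x) \<partial>lborel) = (\<integral>\<^sup>+ x. f x \<partial>lborel)"
  using nn_integral_distr[of "(+) c" lborel borel f] assms by (simp add: lborel_distr_plus)

text \<open>For \<open>\<bar>t\<bar> < 1\<close> one has \<open>1 + norm x \<le> (1 + norm b) * (1 +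
  norm (x + t *\<^sub>R b))\<close>. This gives a single integrable majorant for the whole family of
  translates, as differentiation of a translated integral requires.\<close>

lemma rapid_shift_bound:
  assumes "rapid f"
  obtains g where "integrable lborel g" "\<And>t x. \<bar>t\<bar> < 1 \<Longrightarrow> norm (f (x + t *\<^sub>R b)) \<le> g x"
proof -
  let ?N = "2 * DIM('a)"
  obtain C where C: "C \<ge> 0" "\<And>x. norm (f x) \<le> C * inverse ((1 + norm x) ^ ?N)"
    using rapid_bound[OF assms] by blast
  show thesis
  proof
    show "integrable lborel (\<lambda>x::'a. C * (1 + norm b) ^ ?N * inverse ((1 + norm x) ^ ?N))"
      by (intro integrable_mult_right integrable_decay)
    fix t :: real and x assume t: "\<bar>t\<bar> < 1"
    have "norm x \<le> norm (x + t *\<^sub>R b) + norm (t *\<^sub>R b)"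
      by (metis add_diff_cancel_right' norm_triangle_ineq4)
    also have "norm (t *\<^sub>R b) \<le> norm b" using t by (simp add: mult_left_le_one_le)
    finally have "1 + norm x \<le> 1 + norm (x + t *\<^sub>R b) + norm b + norm b * norm (x + t *\<^sub>R b)"
      by (simp add: add_increasing2)
    then have "1 + norm x \<le> (1 + norm b) * (1 + norm (x + t *\<^sub>R b))"
      by (simp add: algebra_simps)
    then have "(1 + norm x) ^ ?N \<le> (1 + norm b) ^ ?N * (1 + norm (x + t *\<^sub>R b)) ^ ?N"
      unfolding power_mult_distrib[symmetric] by (intro power_mono) auto
    moreover have "(1 + norm x) ^ ?N > 0" "(1 + norm (x + t *\<^sub>R b)) ^ ?N > 0"
      by (auto intro!: zero_less_power add_pos_nonneg)
    ultimately have "inverse ((1 + norm (x + t *\<^sub>R b)) ^ ?N) \<le> (1 + norm b) ^ ?N * inverse ((1 + norm x) ^ ?N)"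
      by (simp add: field_simps)
    then show "norm (f (x + t *\<^sub>R b)) \<le> C * (1 + norm b) ^ ?N * inverse ((1 + norm x) ^ ?N)"
      using C(2)[of "x + t *\<^sub>R b"] mult_left_mono[OF _ C(1)] by (fastforce simp: mult.assoc)
  qed
qed

text \<open>Takes the place of integration by parts: the integral of
  \<open>F (x + t *\<^sub>R b)\<close> against the character is differentiated at
  \<open>t = 0\<close> in two ways, under the integral sign and after the translation that turns it
  into a phase times \<open>FT F \<xi>\<close>.\<close>

lemma FT_derivative:
  assumes F: "rapid F" and F': "rapid F'"
    and der: "\<And>y. ((\<lambda>t. F (y + t *\<^sub>R b)) has_vector_derivative F' y) (at 0)"
  shows "FT F' \<xi> = 2 * pi * \<i> * complex_of_real (\<xi> \<bullet> b) * FT F \<xi>"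
proof -
  note [measurable] = rapid_measurable[OF F] rapid_measurable[OF F']
  obtain g where g: "integrable lborel g" "\<And>t x. \<bar>t\<bar> < 1 \<Longrightarrow> norm (F' (x + t *\<^sub>R b)) \<le> g x"
    using rapid_shift_bound[OF F'] by blast
  obtain g0 where g0: "integrable lborel g0" "\<And>t x. \<bar>t\<bar> < 1 \<Longrightarrow> norm (F (x + t *\<^sub>R b)) \<le> g0 x"
    using rapid_shift_bound[OF F] by blast
  let ?H = "\<lambda>t. LINT x|lborel. F (x + t *\<^sub>R b) * cis (- 2 * pi * (x \<bullet> \<xi>))"
  have "(?H has_vector_derivative (LINT x|lborel. F' (x + 0 *\<^sub>R b) * cis (- 2 * pi * (x \<bullet> \<xi>)))) (at 0)"
  proof (rule has_vector_derivative_integral[where \<delta>=1 and g=g])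
    show "((\<lambda>t. F (x + t *\<^sub>R b) * cis (- 2 * pi * (x \<bullet> \<xi>))) has_vector_derivative
      F' (x + t *\<^sub>R b) * cis (- 2 * pi * (x \<bullet> \<xi>))) (at t)" for t x
      by (rule has_vector_derivative_mult_left[OF has_vector_derivative_line_shift[of F b F', OF der]])
    show "integrable lborel (\<lambda>x. F (x + t *\<^sub>R b) * cis (- 2 * pi * (x \<bullet> \<xi>)))" if "\<bar>t - 0\<bar> < 1" for t
      using that g0(2) by (intro Bochner_Integration.integrable_bound[OF g0(1)])
        (auto simp: norm_mult intro: order_trans[OF _ abs_ge_self])
    show "norm (F' (x + t *\<^sub>R b) * cis (- 2 * pi * (x \<bullet> \<xi>))) \<le> g x" if "\<bar>t - 0\<bar> < 1" for t x
      using g(2)[of t x] that by (simp add: norm_mult)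
  qed (use g in auto)
  then have 1: "(?H has_vector_derivative FT F' \<xi>) (at 0)" by (simp add: FT_def)
  have eq: "?H t = FT F \<xi> * cis (0 + t * (2 * pi * (b \<bullet> \<xi>)))" for t
  proof -
    have "?H t = (LINT x|lborel. F (t *\<^sub>R b + x) * cis (- 2 * pi * ((t *\<^sub>R b + x) \<bullet> \<xi>)) * cis (t * (2 * pi * (b \<bullet> \<xi>))))"
      by (simp add: cis_mult inner_add_left algebra_simps)
    also have "\<dots> = (LINT x|lborel. F x * cis (- 2 * pi * (x \<bullet> \<xi>)) * cis (t * (2 * pi * (b \<bullet> \<xi>))))"
      by (rule lborel_integral_translate) measurable
    finally show ?thesis by (simp add: FT_def)
  qed
  have "(?H has_vector_derivative FT F \<xi> * (\<i> * complex_of_real (2 * pi * (b \<bullet> \<xi>)) * cis (0 + 0 * (2 * pi * (b \<bullet> \<xi>))))) (at 0)"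
    unfolding eq by (intro has_vector_derivative_mult_right has_vector_derivative_cis_affine)
  from vector_derivative_unique_at[OF 1 this] show ?thesis
    by (simp add: inner_commute algebra_simps)
qed

section \<open>Gaussians of complex weight, their transforms and their masses\<close>

definition gauss :: "complex \<Rightarrow> 'a::euclidean_space \<Rightarrow> complex" where
  "gauss w x = exp (- (of_real pi * w * of_real ((norm x)\<^sup>2)))"

lemma gauss_0 [simp]: "gauss w 0 = 1"
  by (simp add: gauss_def)

lemma gauss_measurable [measurable]: "gauss w \<in> borel_measurable borel"
  unfolding gauss_def[abs_def] by measurable

lemma norm_gauss: "norm (gauss w x) = exp (- (pi * Re w * (norm x)\<^sup>2))"
  by (simp add: gauss_def norm_exp_eq_Re power2_eq_square)

lemma rapid_gauss:
  assumes w: "Re w > 0" shows "rapid (gauss w)"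
  unfolding rapid_def
proof (intro conjI allI)
  fix N :: nat
  let ?c = "pi * Re w"
  have c: "?c > 0" using w by simp
  have "(1 + norm x) ^ N * norm (gauss w x) \<le> exp ((real N)\<^sup>2 / (4 * ?c))" for x :: 'a
  proof -
    have "(1 + norm x) ^ N \<le> exp (norm x) ^ N" by (intro power_mono) (auto intro: exp_ge_add_one_self)
    also have "\<dots> = exp (real N * norm x)" by (simp add: exp_of_nat_mult)
    finally have "(1 + norm x) ^ N * norm (gauss w x) \<le> exp (real N * norm x) * exp (- (?c * (norm x)\<^sup>2))"
      unfolding norm_gauss by (intro mult_right_mono) auto
    also have "\<dots> = exp (real N * norm x - ?c * (norm x)\<^sup>2)" by (simp add: exp_add[symmetric])
    also have "\<dots> \<le> exp ((real N)\<^sup>2 / (4 * ?c))"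
    proof (subst exp_le_cancel_iff)
      have "0 \<le> (2 * ?c * norm x - real N)\<^sup>2" by simp
      then have "4 * ?c * (real N * norm x - ?c * (norm x)\<^sup>2) \<le> (real N)\<^sup>2"
        by (simp add: power2_diff power_mult_distrib algebra_simps power2_eq_square)
      then show "real N * norm x - ?c * (norm x)\<^sup>2 \<le> (real N)\<^sup>2 / (4 * ?c)"
        using c by (simp add: pos_le_divide_eq mult.commute)
    qed
    finally show ?thesis .
  qed
  then show "\<exists>C. \<forall>x::'a. (1 + norm x) ^ N * norm (gauss w x) \<le> C" by blast
qed simp

lemma gauss_line_derivative:
  fixes w :: complex
  shows "((\<lambda>t. gauss w (x + t *\<^sub>R b)) has_vector_derivative
     (- 2 * pi * w) * (complex_of_real (x \<bullet> b) * gauss w x)) (at 0)"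
proof -
  have n: "(norm (x + t *\<^sub>R b))\<^sup>2 = x \<bullet> x + t * (2 * (x \<bullet> b)) + t * t * (b \<bullet> b)" for t
    by (simp add: power2_norm_eq_inner inner_add_left inner_add_right inner_commute algebra_simps)
  have "((\<lambda>z. exp (- (of_real pi * w * (of_real (x \<bullet> x) + z * (2 * of_real (x \<bullet> b)) + z * z * of_real (b \<bullet> b)))))
    has_field_derivative (- 2 * pi * w) * (complex_of_real (x \<bullet> b) * exp (- (of_real pi * w * of_real (x \<bullet> x))))) (at (of_real 0))"
    by (auto intro!: derivative_eq_intros)
  from has_vector_derivative_real_field[OF this] show ?thesis
    unfolding gauss_def n by (simp add: power2_norm_eq_inner)
qed

text \<open>Differentiating the transform along the ray \<open>t *\<^sub>R \<xi>\<close> brings down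
  the factor \<open>x \<bullet> \<xi>\<close>, and its product with the Gaussian is, up to
  constants, a derivative of the Gaussian itself; this gives a linear ODE in \<open>t\<close>. The
  value at the origin is left as it is here and is treated separately through its square.\<close>

lemma FT_gauss:
  fixes \<xi> :: "'a::euclidean_space"
  assumes w: "Re w > 0"
  shows "FT (gauss w) \<xi> = FT (gauss w) (0::'a) * gauss (1 / w) \<xi>"
proof -
  have w0: "w \<noteq> 0" using w by auto
  note r = rapid_gauss[OF w, where ?'a='a]
  let ?F' = "\<lambda>x. (- 2 * pi * w) * (complex_of_real (x \<bullet> \<xi>) * gauss w x)"
  have parts: "FT ?F' \<eta> = 2 * pi * \<i> * complex_of_real (\<eta> \<bullet> \<xi>) * FT (gauss w) \<eta>" for \<eta>
    by (rule FT_derivative[OF r _ gauss_line_derivative]) (intro rapid_const_mult rapid_inner_mult r)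
  have d: "((\<lambda>t. FT (gauss w) (t *\<^sub>R \<xi>)) has_vector_derivative
      - (2 * pi / w) * complex_of_real (t * (\<xi> \<bullet> \<xi>)) * FT (gauss w) (t *\<^sub>R \<xi>)) (at t)" for t
  proof -
    have "FT (\<lambda>x. (- 2 * pi * \<i>) * (complex_of_real (x \<bullet> \<xi>) * gauss w x)) (t *\<^sub>R \<xi>) = (\<i> / w) * FT ?F' (t *\<^sub>R \<xi>)"
      unfolding FT_cmult[symmetric] using w0 by (simp add: field_simps)
    also have "\<dots> = - (2 * pi / w) * complex_of_real (t * (\<xi> \<bullet> \<xi>)) * FT (gauss w) (t *\<^sub>R \<xi>)"
      unfolding parts by (simp add: field_simps)
    finally show ?thesis
      using FT_has_vector_derivative[OF r, of 0 \<xi> t] by simp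
  qed
  \<comment> \<open>The transform multiplied by the integrating factor of the ODE; equality of the
    values at \<open>t = 0\<close> and \<open>t = 1\<close> is the claim.\<close>
  let ?h = "\<lambda>t::real. FT (gauss w) (t *\<^sub>R \<xi>) * exp (of_real pi / w * of_real t ^ 2 * of_real (\<xi> \<bullet> \<xi>))"
  have "(?h has_vector_derivative 0) (at t within UNIV)" for t
  proof -
    have "((\<lambda>z. exp (of_real pi / w * z ^ 2 * of_real (\<xi> \<bullet> \<xi>))) has_field_derivative
       (2 * pi / w) * of_real t * of_real (\<xi> \<bullet> \<xi>) * exp (of_real pi / w * of_real t ^ 2 * of_real (\<xi> \<bullet> \<xi>))) (at (of_real t))"
      using w0 by (auto intro!: derivative_eq_intros)
    from has_vector_derivative_mult[OF d[of t] has_vector_derivative_real_field[OF this]]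
    show ?thesis using w0 by (simp add: algebra_simps)
  qed
  then obtain c where "\<And>t. ?h t = c"
    using has_vector_derivative_zero_constant[of UNIV ?h] by auto
  then have "?h 1 = ?h 0" by (simp only:)
  then have "FT (gauss w) \<xi> * exp (of_real pi / w * of_real (\<xi> \<bullet> \<xi>)) = FT (gauss w) (0::'a)" by simp
  moreover have "exp (of_real pi / w * of_real (\<xi> \<bullet> \<xi>)) * gauss (1 / w) \<xi> = 1"
    by (simp add: gauss_def exp_add[symmetric] power2_norm_eq_inner)
  ultimately show ?thesis by (metis mult.assoc mult.right_neutral)
qed


text \<open>The derivative of \<open>(x \<bullet> b) * gauss w x\<close> along \<open>b\<close> has
  integral zero, since its transform vanishes at frequency 0. This expresses the second moment
  through the mass and so turns the derivative of the mass in \<open>w\<close> into an ODE.\<close>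

lemma gauss_second_moment:
  fixes w :: complex
  assumes w: "Re w > 0"
  shows "(LINT x|lborel. of_real ((norm x)\<^sup>2) * gauss w (x::'a::euclidean_space))
    = of_nat DIM('a) / (2 * of_real pi * w) * FT (gauss w) (0::'a)"
proof -
  have w0: "w \<noteq> 0" using w by auto
  note r = rapid_gauss[OF w, where ?'a='a]
  have comp: "(LINT x|lborel. of_real ((x \<bullet> b)\<^sup>2) * gauss w x) = 1 / (2 * of_real pi * w) * FT (gauss w) (0::'a)"
    and int: "integrable lborel (\<lambda>x. of_real ((x \<bullet> b)\<^sup>2) * gauss w x)"
    if b: "b \<in> Basis" for b :: 'a
  proof -
    let ?q = "\<lambda>x. complex_of_real (x \<bullet> b) * (complex_of_real (x \<bullet> b) * gauss w x)"
    have rq: "rapid ?q" by (intro rapid_inner_mult r)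
    have bb: "b \<bullet> b = 1" using b by (simp add: inner_Basis)
    show int: "integrable lborel (\<lambda>x. of_real ((x \<bullet> b)\<^sup>2) * gauss w x)"
      using rapid_integrable[OF rq] by (simp add: power2_eq_square mult.assoc)
    let ?F' = "\<lambda>x. gauss w x + (- 2 * pi * w) * ?q x"
    have rF': "rapid ?F'" by (intro rapid_add r rapid_const_mult rq)
    have "FT ?F' 0 = 2 * pi * \<i> * complex_of_real (0 \<bullet> b) * FT (\<lambda>x. complex_of_real (x \<bullet> b) * gauss w x) 0"
    proof (rule FT_derivative[OF _ rF'])
      show "rapid (\<lambda>x. complex_of_real (x \<bullet> b) * gauss w x)" by (intro rapid_inner_mult r)
      fix y :: 'a
      have "((\<lambda>z. of_real (y \<bullet> b) + z) has_field_derivative 1) (at (of_real 0 :: complex))"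
        by (auto intro!: derivative_eq_intros)
      from has_vector_derivative_real_field[OF this]
      have "((\<lambda>t. complex_of_real ((y + t *\<^sub>R b) \<bullet> b)) has_vector_derivative 1) (at 0)"
        by (simp add: inner_add_left bb)
      from has_vector_derivative_mult[OF this gauss_line_derivative[of w y b]]
      show "((\<lambda>t. complex_of_real ((y + t *\<^sub>R b) \<bullet> b) * gauss w (y + t *\<^sub>R b)) has_vector_derivative ?F' y) (at 0)"
        by (simp add: algebra_simps)
    qed
    then have "(LINT x|lborel. ?F' x) = 0" by (simp add: FT_def)
    then have "(LINT x|lborel. gauss w (x::'a)) + (- 2 * pi * w) * (LINT x|lborel. ?q x) = 0"
      using rapid_integrable[OF r] rapid_integrable[OF rq] by simp
    then have "(2 * of_real pi * w) * (LINT x|lborel. ?q x) = FT (gauss w) (0::'a)"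
      by (simp add: FT_def algebra_simps)
    then show "(LINT x|lborel. of_real ((x \<bullet> b)\<^sup>2) * gauss w x) = 1 / (2 * of_real pi * w) * FT (gauss w) (0::'a)"
      using w0 by (simp add: power2_eq_square mult.assoc field_simps)
  qed
  have "(norm x)\<^sup>2 = (\<Sum>b\<in>Basis. (x \<bullet> b)\<^sup>2)" for x :: 'a
    by (subst power2_norm_eq_inner, subst euclidean_inner) (simp add: power2_eq_square)
  then have "of_real ((norm x)\<^sup>2) * gauss w x = (\<Sum>b\<in>(Basis::'a set). of_real ((x \<bullet> b)\<^sup>2) * gauss w x)" for x :: 'a
    by (simp only: of_real_sum sum_distrib_right)
  then have "(LINT x|lborel. of_real ((norm x)\<^sup>2) * gauss w (x::'a::euclidean_space))
     = (LINT x|lborel. (\<Sum>b\<in>(Basis::'a set). of_real ((x \<bullet> b)\<^sup>2) * gauss w x))"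
    by (simp only:)
  also have "\<dots> = (\<Sum>b\<in>(Basis::'a set). LINT x|lborel. of_real ((x \<bullet> b)\<^sup>2) * gauss w x)"
    using int by (rule Bochner_Integration.integral_sum)
  also have "\<dots> = of_nat DIM('a) / (2 * of_real pi * w) * FT (gauss w) (0::'a)"
    using comp by simp
  finally show ?thesis .
qed

lemma gauss_mass_derivative:
  fixes w v :: complex
  assumes w: "Re (w + of_real t0 * v) > 0"
  shows "((\<lambda>t. FT (gauss (w + of_real t * v)) (0::'a::euclidean_space)) has_vector_derivative
     - (v * of_nat DIM('a) / (2 * (w + of_real t0 * v))) * FT (gauss (w + of_real t0 * v)) (0::'a)) (at t0)"
proof -
  let ?w = "\<lambda>t. w + of_real t * v"
  let ?c = "Re (?w t0) / 2"
  \<comment> \<open>Keeps the real part of the weight above half of its value at \<open>t0\<close>,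
    so that the Gaussian of weight \<open>?c\<close> dominates on the whole neighbourhood.\<close>
  define \<delta> where "\<delta> = ?c / (\<bar>Re v\<bar> + 1)"
  have \<delta>: "\<delta> > 0" using w by (auto simp: \<delta>_def intro!: divide_pos_pos)
  have Re: "Re (?w t) \<ge> ?c" if "\<bar>t - t0\<bar> < \<delta>" for t
  proof -
    have "\<bar>(t - t0) * Re v\<bar> \<le> \<delta> * (\<bar>Re v\<bar> + 1)"
      unfolding abs_mult using that \<delta> by (intro mult_mono) auto
    moreover have "\<delta> * (\<bar>Re v\<bar> + 1) = ?c" unfolding \<delta>_def by (rule nonzero_eq_divide_eq[THEN iffD1, OF _ refl]) linarith
    ultimately have "\<bar>(t - t0) * Re v\<bar> \<le> ?c" by simp
    moreover have "Re (?w t) = Re (?w t0) + (t - t0) * Re v" by (simp add: algebra_simps)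
    ultimately show ?thesis by simp
  qed
  have c: "?c > 0" using w by simp
  let ?g = "\<lambda>x::'a. (- of_real pi * v) * (of_real ((norm x)\<^sup>2) * gauss (of_real ?c) x)"
  have rsq: "rapid (\<lambda>x::'a. of_real ((norm x)\<^sup>2) * gauss u x)" if "Re u > 0" for u
  proof (rule rapid_polynomial_mult[where K=1 and M=2])
    show "rapid (gauss u :: 'a \<Rightarrow> complex)" using rapid_gauss that by blast
    show "norm (complex_of_real ((norm x)\<^sup>2)) \<le> 1 * (1 + norm x) ^ 2" for x :: 'a
      by (simp add: norm_power power_mono)
  qed auto
  have "((\<lambda>t. LINT x|lborel. gauss (?w t) (x::'a)) has_vector_derivative
      (LINT x|lborel. (- of_real pi * v) * (of_real ((norm x)\<^sup>2) * gauss (?w t0) (x::'a)))) (at t0)"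
  proof (rule has_vector_derivative_integral[where \<delta>=\<delta> and g="\<lambda>x. norm (?g x)"])
    fix t and x :: 'a assume t: "\<bar>t - t0\<bar> < \<delta>"
    show "((\<lambda>t. gauss (?w t) x) has_vector_derivative (- of_real pi * v) * (of_real ((norm x)\<^sup>2) * gauss (?w t) x)) (at t)"
    proof -
      have "((\<lambda>z. exp (- (of_real pi * (w + z * v) * of_real ((norm x)\<^sup>2)))) has_field_derivative
        (- of_real pi * v) * (of_real ((norm x)\<^sup>2) * exp (- (of_real pi * (w + of_real t * v) * of_real ((norm x)\<^sup>2))))) (at (of_real t))"
        by (auto intro!: derivative_eq_intros)
      from has_vector_derivative_real_field[OF this] show ?thesis by (simp add: gauss_def)
    qed
    show "integrable lborel (gauss (?w t) :: 'a \<Rightarrow> complex)"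
      using Re[OF t] c by (intro rapid_integrable rapid_gauss) linarith
    have "norm (gauss (?w t) x) \<le> norm (gauss (of_real ?c) x)"
    proof -
      have "pi * ?c * (norm x)\<^sup>2 \<le> pi * Re (?w t) * (norm x)\<^sup>2"
        by (intro mult_right_mono mult_left_mono Re[OF t]) auto
      then show ?thesis by (simp add: norm_gauss)
    qed
    then show "norm ((- of_real pi * v) * (of_real ((norm x)\<^sup>2) * gauss (?w t) x)) \<le> norm (?g x)"
      unfolding norm_mult by (intro mult_left_mono) auto
  next
    show "integrable lborel (\<lambda>x. norm (?g x))"
      using c by (intro integrable_norm rapid_integrable rapid_const_mult rsq) simp
  qed (use \<delta> in auto)
  moreover have "(LINT x|lborel. (- of_real pi * v) * (of_real ((norm x)\<^sup>2) * gauss (?w t0) (x::'a)))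
    = (- of_real pi * v) * (of_nat DIM('a) / (2 * of_real pi * ?w t0) * FT (gauss (?w t0)) (0::'a))"
    using gauss_second_moment[OF w, where ?'a='a] by simp
  moreover have "?w t0 \<noteq> 0" using w by (metis zero_complex.sel(1) less_irrefl)
  ultimately show ?thesis by (simp add: FT_def mult.assoc)
qed

text \<open>The mass behaves like \<open>w powr (- n / 2)\<close>. Its square times
  \<open>w ^ n\<close> avoids the choice of a branch and is constant along the segment from
  \<open>1\<close> to \<open>w\<close>, which stays in the right half-plane.\<close>

lemma gauss_mass_square:
  assumes w: "Re w > 0"
  shows "(FT (gauss w) (0::'a::euclidean_space))\<^sup>2 * w ^ DIM('a) = (FT (gauss 1) (0::'a))\<^sup>2"
proof -
  let ?w = "\<lambda>t::real. 1 + of_real t * (w - 1)"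
  let ?I = "\<lambda>t. FT (gauss (?w t)) (0::'a)"
  let ?D = "\<lambda>t. ?I t * ?I t * ?w t ^ DIM('a)"
  have "(?D has_vector_derivative 0) (at t within {0..1})" if t: "t \<in> {0..1}" for t
  proof -
    have eq: "Re (?w t) = (1 - t) + t * Re w" by (simp add: algebra_simps)
    have pos: "Re (?w t) > 0"
    proof (cases "t = 0")
      case False
      then show ?thesis using t w unfolding eq by (intro add_nonneg_pos mult_pos_pos) auto
    qed simp
    then have w0: "?w t \<noteq> 0" by (metis zero_complex.sel(1) less_irrefl)
    note d = gauss_mass_derivative[OF pos, where ?'a='a]
    have "((\<lambda>z. (1 + z * (w - 1)) ^ DIM('a)) has_field_derivative of_nat DIM('a) * (w - 1) * ?w t ^ (DIM('a) - 1)) (at (of_real t))"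
      by (auto intro!: derivative_eq_intros)
    note e = has_vector_derivative_real_field[OF this]
    have alg: "J * J * (N * v * W ^ (n - 1)) + (J * (- (v * N / (2 * W)) * J) + - (v * N / (2 * W)) * J * J) * W ^ n = 0"
      if "W \<noteq> 0" "n > 0" for J N v W :: complex and n :: nat
      using that by (cases n) (simp_all add: field_simps)
    have "(?D has_vector_derivative 0) (at t)"
      using has_vector_derivative_mult[OF has_vector_derivative_mult[OF d d] e]
      unfolding alg[OF w0 DIM_positive[where ?'a='a]] .
    then show ?thesis by (rule has_vector_derivative_at_within)
  qed
  then obtain c where "\<And>t. t \<in> {0..1} \<Longrightarrow> ?D t = c"
    using has_vector_derivative_zero_constant[of "{0..1}" ?D] by auto
  then have "?D 1 = c" "?D 0 = c" by (simp_all only: atLeastAtMost_iff order_refl zero_le_one)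
  then have "?D 1 = ?D 0" by (simp only:)
  then show ?thesis by (simp add: power2_eq_square)
qed

text \<open>A positive constant kept symbolic, because in the end only powers of \<open>W\<close>
  are compared; the type argument carries the dimension.\<close>

definition gauss_mass :: "'a::euclidean_space itself \<Rightarrow> real" where
  "gauss_mass _ = norm (FT (gauss 1) (0::'a))"

lemma gauss_of_real: "gauss (of_real r) x = of_real (exp (- (pi * r * (norm x)\<^sup>2)))"
  by (simp add: gauss_def exp_of_real[symmetric])

lemma integrable_real_gauss:
  assumes "r > 0" shows "integrable lborel (\<lambda>x::'a::euclidean_space. exp (- (pi * r * (norm x)\<^sup>2)))"
  using integrable_norm[OF rapid_integrable[OF rapid_gauss[of "of_real r", where ?'a='a]]] assms
  by (simp add: norm_gauss)

lemma gauss_mass_pos: "gauss_mass TYPE('a::euclidean_space) > 0"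
proof -
  have int: "integrable lborel (\<lambda>x::'a. exp (- (pi * 1 * (norm x)\<^sup>2)))"
    by (rule integrable_real_gauss) simp
  have "FT (gauss 1) (0::'a) = of_real (LINT x|lborel. exp (- (pi * 1 * (norm (x::'a))\<^sup>2)))"
    using gauss_of_real[of 1, where ?'a='a] by (simp add: FT_def)
  moreover have "(LINT x|lborel. exp (- (pi * 1 * (norm (x::'a))\<^sup>2))) \<noteq> 0"
    using integral_nonneg_eq_0_iff_AE[OF int]
    by (simp add: eventually_False ae_filter_eq_bot_iff emeasure_lborel_UNIV)
  ultimately show ?thesis unfolding gauss_mass_def zero_less_norm_iff by (metis of_real_eq_0_iff)
qed

lemma norm_gauss_mass:
  assumes w: "Re w > 0"
  shows "norm (FT (gauss w) (0::'a::euclidean_space)) = gauss_mass TYPE('a) * norm w powr (- (real DIM('a) / 2))"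
proof -
  have w0: "norm w > 0" using w by auto
  have "(norm (FT (gauss w) (0::'a)))\<^sup>2 * norm w ^ DIM('a) = (gauss_mass TYPE('a))\<^sup>2"
    using arg_cong[OF gauss_mass_square[OF w, where ?'a='a], of norm] by (simp add: gauss_mass_def norm_mult norm_power)
  moreover have "norm w ^ DIM('a) = (norm w powr (real DIM('a) / 2))\<^sup>2"
    using w0 by (simp add: power2_eq_square powr_add[symmetric] powr_realpow)
  ultimately have "(norm (FT (gauss w) (0::'a)) * norm w powr (real DIM('a) / 2))\<^sup>2 = (gauss_mass TYPE('a))\<^sup>2"
    by (simp add: power_mult_distrib)
  then have "norm (FT (gauss w) (0::'a)) * norm w powr (real DIM('a) / 2) = gauss_mass TYPE('a)"
    using gauss_mass_pos[where ?'a='a] by (simp add: power2_eq_iff_nonneg)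
  then show ?thesis using w0 by (simp add: powr_minus field_simps)
qed

lemma nn_integral_norm_gauss_powr:
  assumes w: "Re w > 0" and p: "p > 0"
  shows "(\<integral>\<^sup>+ x. ennreal (norm (gauss w (x::'a::euclidean_space)) powr p) \<partial>lborel)
    = ennreal (gauss_mass TYPE('a) * (p * Re w) powr (- (real DIM('a) / 2)))"
proof -
  let ?r = "p * Re w"
  have r: "?r > 0" using assms by simp
  have "norm (gauss w x) powr p = exp (- (pi * ?r * (norm x)\<^sup>2))" for x :: 'a
    by (simp add: norm_gauss powr_def algebra_simps)
  then have "(\<integral>\<^sup>+ x. ennreal (norm (gauss w (x::'a)) powr p) \<partial>lborel) = ennreal (LINT x|lborel. exp (- (pi * ?r * (norm (x::'a))\<^sup>2)))"
    by (simp only:) (intro nn_integral_eq_integral integrable_real_gauss r AE_I2, simp)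
  also have "(LINT x|lborel. exp (- (pi * ?r * (norm (x::'a))\<^sup>2))) = norm (FT (gauss (of_real ?r)) (0::'a))"
    by (simp add: FT_def gauss_of_real del: of_real_mult)
  also have "\<dots> = gauss_mass TYPE('a) * (p * Re w) powr (- (real DIM('a) / 2))"
    using r by (subst norm_gauss_mass) (auto simp del: of_real_mult)
  finally show ?thesis .
qed

section \<open>Gaussian multipliers and test functions\<close>

lemma measurable_vec_nth [measurable]: "(\<lambda>x::'a::euclidean_space^'l. x $ i) \<in> borel \<rightarrow>\<^sub>M borel"
  by (intro borel_measurable_continuous_onI continuous_intros)

lemma measurable_vec_lambda_PiM:
  "(\<lambda>f. \<chi> i. f i) \<in> (\<Pi>\<^sub>M i\<in>(UNIV::'l::finite set). lborel) \<rightarrow>\<^sub>M (borel :: ('a::euclidean_space^'l) measure)"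
proof (subst borel_measurable_euclidean_space, intro ballI)
  fix c :: "'a^'l" assume "c \<in> Basis"
  then obtain i b where c: "c = axis i b" "b \<in> Basis" by (auto simp: Basis_vec_def)
  have "(\<lambda>f. f i) \<in> (\<Pi>\<^sub>M i\<in>(UNIV::'l set). lborel) \<rightarrow>\<^sub>M (borel :: 'a measure)"
    using measurable_component_singleton[of i UNIV "\<lambda>_. lborel"] by simp
  then have "(\<lambda>f. f i \<bullet> b) \<in> borel_measurable (\<Pi>\<^sub>M i\<in>(UNIV::'l set). (lborel :: 'a measure))"
    by simp
  then show "(\<lambda>f. (\<chi> i. f i) \<bullet> c) \<in> borel_measurable (\<Pi>\<^sub>M i\<in>(UNIV::'l set). lborel)"
    unfolding c by (simp add: inner_axis)
qed

text \<open>Both sides agree on boxes, because the coordinates of \<open>'a^'l\<close> are the pairs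
  of a block index and a coordinate inside the block. It allows integrals of products over the
  blocks to be split.\<close>

lemma lborel_vec_eq_distr_PiM:
  "(lborel :: ('a::euclidean_space^'l) measure) = distr (\<Pi>\<^sub>M i\<in>UNIV. lborel) borel (\<lambda>f. \<chi> i. f i)"
proof (rule lborel_eqI)
  interpret product_sigma_finite "\<lambda>_::'l. lborel :: 'a measure" by standard
  fix l u :: "'a^'l"
  assume le: "\<And>b. b \<in> Basis \<Longrightarrow> l \<bullet> b \<le> u \<bullet> b"
  have le': "l $ i \<bullet> b \<le> u $ i \<bullet> b" if "b \<in> Basis" for i b
    using le[of "axis i b"] that by (simp add: inner_axis axis_in_Basis_iff)
  have "(\<lambda>f. \<chi> i. f i) -` box l u \<inter> space (\<Pi>\<^sub>M i\<in>(UNIV::'l set). (lborel::'a measure)) = (\<Pi>\<^sub>E i\<in>UNIV. box (l $ i) (u $ i))"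
    by (auto simp: space_PiM mem_box Basis_vec_def inner_axis PiE_iff)
  then have "emeasure (distr (\<Pi>\<^sub>M i\<in>UNIV. lborel) borel (\<lambda>f. \<chi> i. f i)) (box l u)
     = emeasure (\<Pi>\<^sub>M i\<in>(UNIV::'l set). lborel) (\<Pi>\<^sub>E i\<in>UNIV. box (l $ i) (u $ i))"
    by (subst emeasure_distr[OF measurable_vec_lambda_PiM]) auto
  also have "\<dots> = (\<Prod>i\<in>UNIV. emeasure lborel (box (l $ i) (u $ i)))"
    by (rule emeasure_PiM) auto
  also have "\<dots> = (\<Prod>i\<in>UNIV. ennreal (\<Prod>b\<in>Basis. (u $ i - l $ i) \<bullet> b))"
    using le' by (simp add: emeasure_lborel_box)
  also have "\<dots> = ennreal (\<Prod>i\<in>UNIV. \<Prod>b\<in>Basis. (u $ i - l $ i) \<bullet> b)"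
    using le' by (subst prod_ennreal) (auto intro!: prod_nonneg simp: inner_diff_left)
  also have "(\<Prod>i\<in>UNIV. \<Prod>b\<in>Basis. (u $ i - l $ i) \<bullet> b) = (\<Prod>b\<in>Basis. (u - l) \<bullet> b)"
  proof -
    have B: "(Basis :: ('a^'l) set) = (\<lambda>(i, b). axis i b) ` (UNIV \<times> Basis)"
      by (auto simp: Basis_vec_def)
    have inj: "inj_on (\<lambda>(i, b). axis i b :: 'a^'l) (UNIV \<times> Basis)"
      by (auto simp: inj_on_def axis_eq_axis nonzero_Basis)
    show ?thesis
      unfolding B by (subst prod.reindex[OF inj]) (simp add: prod.cartesian_product comp_def case_prod_beta inner_axis)
  qed
  finally show "emeasure (distr (\<Pi>\<^sub>M i\<in>UNIV. lborel) borel (\<lambda>f. \<chi> i. f i)) (box l u) = ennreal (\<Prod>b\<in>Basis. (u - l) \<bullet> b)" .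
qed simp

lemma integral_vec_prod:
  fixes g :: "'l::finite \<Rightarrow> 'a::euclidean_space \<Rightarrow> complex"
  assumes "\<And>i. integrable lborel (g i)"
  shows "(LINT \<xi>|lborel. (\<Prod>i\<in>UNIV. g i (\<xi> $ i))) = (\<Prod>i\<in>UNIV. LINT x|lborel. g i x)"
proof -
  interpret product_sigma_finite "\<lambda>_::'l. lborel :: 'a measure" by standard
  have [measurable]: "g i \<in> borel_measurable borel" for i
    using borel_measurable_integrable[OF assms[of i]] by simp
  have "(LINT \<xi>|lborel. (\<Prod>i\<in>UNIV. g i (\<xi> $ i)))
     = (LINT \<xi>|distr (\<Pi>\<^sub>M i\<in>(UNIV::'l set). (lborel :: 'a measure)) borel (\<lambda>f. \<chi> i. f i). (\<Prod>i\<in>UNIV. g i (\<xi> $ i)))"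
    by (subst lborel_vec_eq_distr_PiM) simp
  also have "\<dots> = (LINT f|(\<Pi>\<^sub>M i\<in>(UNIV::'l set). (lborel :: 'a measure)). (\<Prod>i\<in>UNIV. g i (f i)))"
    by (subst integral_distr[OF measurable_vec_lambda_PiM]) auto
  also have "\<dots> = (\<Prod>i\<in>UNIV. LINT x|lborel. g i x)"
    using assms by (intro product_integral_prod) auto
  finally show ?thesis .
qed

text \<open>The kernel \<open>k\<close> will be a phase that couples the two variables; all
  integrability comes from \<open>f\<close> and \<open>g\<close>.\<close>

lemma (in pair_sigma_finite) integrable_prod_bounded:
  fixes f :: "'a \<Rightarrow> complex" and g :: "'b \<Rightarrow> complex"
  assumes f: "integrable M1 f" and g: "integrable M2 g"
    and k: "(\<lambda>(x, y). k x y) \<in> borel_measurable (M1 \<Otimes>\<^sub>M M2)" "\<And>x y. norm (k x y) \<le> B"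
  shows "integrable (M1 \<Otimes>\<^sub>M M2) (\<lambda>(x, y). f x * g y * k x y)"
proof -
  note [measurable] = borel_measurable_integrable[OF f] borel_measurable_integrable[OF g] k(1)
  have fg: "integrable (M1 \<Otimes>\<^sub>M M2) (\<lambda>(x, y). f x * g y)"
  proof (rule Fubini_integrable)
    show "integrable M1 (\<lambda>x. LINT y|M2. norm (case (x, y) of (x, y) \<Rightarrow> f x * g y))"
      using f by (simp add: norm_mult)
    show "AE x in M1. integrable M2 (\<lambda>y. case (x, y) of (x, y) \<Rightarrow> f x * g y)"
      using g by simp
  qed measurable
  show ?thesis
  proof (rule Bochner_Integration.integrable_bound[OF integrable_mult_right[OF fg, of "of_real B"]])
    have "B \<ge> 0" using k(2) norm_ge_zero order_trans by blast
    then show "AE x in M1 \<Otimes>\<^sub>M M2. norm (case x of (x, y) \<Rightarrow> f x * g y * k x y)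
       \<le> norm (complex_of_real B * (case x of (x, y) \<Rightarrow> f x * g y))"
      using k(2) by (intro AE_I2) (auto simp: norm_mult mult.commute[of B] intro!: mult_left_mono)
  qed measurable
qed

lemma (in pair_sigma_finite) integral_swap_bounded:
  fixes f :: "'a \<Rightarrow> complex" and g :: "'b \<Rightarrow> complex"
  assumes "integrable M1 f" "integrable M2 g"
    and "(\<lambda>(x, y). k x y) \<in> borel_measurable (M1 \<Otimes>\<^sub>M M2)" "\<And>x y. norm (k x y) \<le> B"
  shows "(LINT y|M2. LINT x|M1. f x * g y * k x y) = (LINT x|M1. LINT y|M2. f x * g y * k x y)"
  using Fubini_integral[OF integrable_prod_bounded[OF assms]] .

section \<open>Gaussian integrals with a coupling through the sum of the variables\<close>

lemma gauss_mult: "gauss v x * gauss w x = gauss (v + w) x"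
  by (simp add: gauss_def exp_add[symmetric] algebra_simps)

lemma gauss_minus [simp]: "gauss w (- x) = gauss w x"
  by (simp add: gauss_def)

lemma prod_gauss: "finite A \<Longrightarrow> (\<Prod>i\<in>A. gauss (w i) x) = gauss (\<Sum>i\<in>A. w i) x"
  by (induction A rule: finite_induct) (simp_all add: gauss_mult, simp add: gauss_def)

lemma Re_inverse_pos: "Re w > 0 \<Longrightarrow> Re (1 / w) > 0"
  by (simp add: Re_divide sum_power2_gt_zero_iff)

lemma FT_gauss_nonzero: "Re w > 0 \<Longrightarrow> FT (gauss w) (0::'a::euclidean_space) \<noteq> 0"
  using norm_gauss_mass[of w, where ?'a='a] gauss_mass_pos[where ?'a='a] by force

text \<open>Exhibits a Gaussian as a superposition of characters. Under such an expansion a Gaussian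
  of a sum of variables splits into a product over the variables.\<close>

lemma gauss_eq_FT:
  fixes x :: "'a::euclidean_space"
  assumes "Re w > 0"
  shows "gauss w x = FT (gauss (1 / w)) x / FT (gauss (1 / w)) (0::'a)"
  using FT_gauss[OF Re_inverse_pos[OF assms], of x] FT_gauss_nonzero[OF Re_inverse_pos[OF assms], where ?'a='a]
  by simp

text \<open>Expanding the second factor into characters turns the convolution into a product of
  transforms, so the reciprocals of the weights add. The complex masses are carried along as
  constants.\<close>

lemma gauss_convolution:
  fixes x :: "'a::euclidean_space"
  assumes \<alpha>: "Re \<alpha> > 0" and \<beta>: "Re \<beta> > 0"
  shows "(LINT y|lborel. gauss \<alpha> y * gauss \<beta> (y - x))
    = FT (gauss \<alpha>) (0::'a) * FT (gauss (1 / \<alpha> + 1 / \<beta>)) (0::'a) / FT (gauss (1 / \<beta>)) (0::'a)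
       * gauss (1 / (1 / \<alpha> + 1 / \<beta>)) x"
proof -
  note \<beta>' = Re_inverse_pos[OF \<beta>]
  have s: "Re (1 / \<alpha> + 1 / \<beta>) > 0" using Re_inverse_pos[OF \<alpha>] \<beta>' by simp
  let ?k = "\<lambda>\<zeta> y. cis (- 2 * pi * (\<zeta> \<bullet> (y - x)))"
  have "(LINT y|lborel. gauss \<alpha> y * FT (gauss (1 / \<beta>)) (y - x))
     = (LINT y|lborel. LINT \<zeta>|lborel. gauss (1 / \<beta>) \<zeta> * gauss \<alpha> y * ?k \<zeta> y)"
    unfolding FT_def by (subst integral_mult_right_zero[symmetric]) (simp add: mult_ac)
  also have "\<dots> = (LINT \<zeta>|lborel. LINT y|lborel. gauss (1 / \<beta>) \<zeta> * gauss \<alpha> y * ?k \<zeta> y)"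
    by (rule lborel_pair.integral_swap_bounded[where B=1])
       (auto intro!: rapid_integrable rapid_gauss \<alpha> \<beta>')
  also have "\<dots> = (LINT \<zeta>|lborel. gauss (1 / \<beta>) \<zeta> * cis (- 2 * pi * (\<zeta> \<bullet> (- x))) * FT (gauss \<alpha>) \<zeta>)"
    unfolding FT_def
    by (subst integral_mult_right_zero[symmetric])
       (simp add: inner_diff_right cis_mult mult_ac inner_commute algebra_simps)
  also have "\<dots> = (LINT \<zeta>|lborel. FT (gauss \<alpha>) (0::'a) * (gauss (1 / \<alpha> + 1 / \<beta>) \<zeta> * cis (- 2 * pi * (\<zeta> \<bullet> (- x)))))"
    by (subst FT_gauss[OF \<alpha>]) (simp add: gauss_mult[symmetric] mult_ac)
  also have "\<dots> = FT (gauss \<alpha>) (0::'a) * FT (gauss (1 / \<alpha> + 1 / \<beta>)) (- x)"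
    unfolding FT_def by simp
  also have "\<dots> = FT (gauss \<alpha>) (0::'a) * (FT (gauss (1 / \<alpha> + 1 / \<beta>)) (0::'a) * gauss (1 / (1 / \<alpha> + 1 / \<beta>)) x)"
    by (subst FT_gauss[OF s]) simp
  finally show ?thesis
    by (subst gauss_eq_FT[OF \<beta>]) simp
qed

lemma power2_norm_vec: "(norm (\<eta>::'a::euclidean_space^'l))\<^sup>2 = (\<Sum>i\<in>UNIV. (norm (\<eta> $ i))\<^sup>2)"
  by (simp add: norm_vec_def L2_set_def sum_nonneg)

text \<open>The factor in the sum of the variables blocks a direct splitting. It is expanded into
  characters with a dual variable \<open>y\<close>; for fixed \<open>y\<close> the integral factors
  into the blocks, each contributing a Gaussian of weight \<open>1 / b i\<close> in
  \<open>y - x\<close>, and their product has weight \<beta>. What remains is a convolution of two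
  Gaussians in \<open>y\<close>.\<close>

lemma gauss_form_integral:
  fixes x :: "'a::euclidean_space" and b :: "'l::finite \<Rightarrow> real"
  assumes b: "\<And>i. b i > 0" and w: "Re w > 0"
  defines "\<beta> \<equiv> (\<Sum>i\<in>UNIV. 1 / b i)"
  shows "norm (LINT \<eta>|lborel. (\<Prod>i\<in>UNIV. gauss (of_real (b i)) (\<eta> $ i)) * gauss w (\<Sum>i\<in>UNIV. \<eta> $ i)
           * cis (2 * pi * (x \<bullet> (\<Sum>i\<in>UNIV. \<eta> $ i))))
    = gauss_mass TYPE('a) ^ CARD('l) * (\<Prod>i\<in>UNIV. b i powr (- (real DIM('a) / 2)))
       * norm (1 + of_real \<beta> * w) powr (- (real DIM('a) / 2)) * norm (gauss (of_real \<beta> / (1 + of_real \<beta> * w)) x)"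
proof -
  let ?n = "real DIM('a) / 2" and ?K = "gauss_mass TYPE('a)"
  let ?\<alpha> = "1 / w"
  have K: "?K > 0" by (rule gauss_mass_pos)
  have \<alpha>: "Re ?\<alpha> > 0" by (rule Re_inverse_pos[OF w])
  have \<beta>: "\<beta> > 0" unfolding \<beta>_def by (intro sum_pos) (auto simp: b)
  have w0: "w \<noteq> 0" using w by auto
  let ?P = "\<lambda>\<eta>::'a^'l. \<Prod>i\<in>UNIV. gauss (of_real (b i)) (\<eta> $ i)"
  let ?S = "\<lambda>\<eta>::'a^'l. \<Sum>i\<in>UNIV. \<eta> $ i"
  have rb: "integrable lborel (gauss (of_real (b i)) :: 'a \<Rightarrow> complex)" for i
    using b by (intro rapid_integrable rapid_gauss) simp
  have intP: "integrable lborel ?P"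
  proof (rule Bochner_Integration.integrable_bound)
    \<comment> \<open>The smallest weight gives one isotropic Gaussian that dominates the whole
      product.\<close>
    let ?c = "Min (range b)"
    show "integrable lborel (\<lambda>\<eta>::'a^'l. exp (- (pi * ?c * (norm \<eta>)\<^sup>2)))"
      by (rule integrable_real_gauss) (simp add: b)
    show "AE \<eta> in lborel. norm (?P \<eta>) \<le> norm (exp (- (pi * ?c * (norm \<eta>)\<^sup>2)))"
    proof (rule AE_I2)
      fix \<eta> :: "'a^'l"
      have "pi * ?c * (norm \<eta>)\<^sup>2 = (\<Sum>i\<in>UNIV. pi * ?c * (norm (\<eta> $ i))\<^sup>2)"
        by (simp add: power2_norm_vec sum_distrib_left)
      also have "\<dots> \<le> (\<Sum>i\<in>UNIV. pi * b i * (norm (\<eta> $ i))\<^sup>2)"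
        by (intro sum_mono mult_right_mono mult_left_mono) auto
      finally show "norm (?P \<eta>) \<le> norm (exp (- (pi * ?c * (norm \<eta>)\<^sup>2)))"
        by (simp add: prod_norm[symmetric] norm_gauss exp_sum[symmetric] sum_negf)
    qed
  qed measurable
  have inner: "(LINT \<eta>|lborel. ?P \<eta> * cis (- 2 * pi * ((y - x) \<bullet> ?S \<eta>))) = (\<Prod>i\<in>(UNIV::'l set). FT (gauss (of_real (b i))) (0::'a)) * gauss (of_real \<beta>) (y - x)"
    for y
  proof -
    have "cis (- 2 * pi * ((y - x) \<bullet> ?S \<eta>)) = (\<Prod>i\<in>UNIV. cis (- 2 * pi * (\<eta> $ i \<bullet> (y - x))))" for \<eta>
    proof -
      have "(\<Prod>i\<in>A. cis (h i)) = cis (\<Sum>i\<in>A. h i)" if "finite A" for A :: "'l set" and h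
        using that by (induction A rule: finite_induct) (auto simp: cis_mult)
      then show ?thesis by (simp add: inner_sum_right sum_distrib_left inner_commute)
    qed
    then have "(LINT \<eta>|lborel. ?P \<eta> * cis (- 2 * pi * ((y - x) \<bullet> ?S \<eta>)))
      = (LINT \<eta>|lborel. (\<Prod>i\<in>UNIV. gauss (of_real (b i)) (\<eta> $ i) * cis (- 2 * pi * (\<eta> $ i \<bullet> (y - x)))))"
      by (simp add: prod.distrib)
    also have "\<dots> = (\<Prod>i\<in>UNIV. FT (gauss (of_real (b i))) (y - x))"
      unfolding FT_def by (intro integral_vec_prod integrable_mult_cis rb) auto
    also have "\<dots> = (\<Prod>i\<in>(UNIV::'l set). FT (gauss (of_real (b i))) (0::'a) * gauss (1 / of_real (b i)) (y - x))"
      using b by (intro prod.cong refl FT_gauss) auto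
    finally show ?thesis by (simp add: prod.distrib prod_gauss \<beta>_def)
  qed
  have "(LINT \<eta>|lborel. ?P \<eta> * gauss w (?S \<eta>) * cis (2 * pi * (x \<bullet> ?S \<eta>)))
    = (LINT \<eta>|lborel. (LINT y|lborel. ?P \<eta> * gauss ?\<alpha> y * cis (- 2 * pi * ((y - x) \<bullet> ?S \<eta>)))) / FT (gauss ?\<alpha>) (0::'a)"
    unfolding gauss_eq_FT[OF w] 
    by (subst integral_divide_zero[symmetric], rule Bochner_Integration.integral_cong[OF refl], simp add: FT_def,
      subst integral_mult_right_zero[symmetric], subst integral_mult_left_zero[symmetric])
      (simp add: mult_ac cis_mult algebra_simps)
  also have "(LINT \<eta>|lborel. (LINT y|lborel. ?P \<eta> * gauss ?\<alpha> y * cis (- 2 * pi * ((y - x) \<bullet> ?S \<eta>))))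
    = (LINT y|lborel. (LINT \<eta>|lborel. ?P \<eta> * gauss ?\<alpha> y * cis (- 2 * pi * ((y - x) \<bullet> ?S \<eta>))))"
    by (rule lborel_pair.integral_swap_bounded[where B=1, symmetric])
       (auto intro!: intP rapid_integrable rapid_gauss \<alpha>)
  also have "\<dots> = (LINT y|lborel. (\<Prod>i\<in>(UNIV::'l set). FT (gauss (of_real (b i))) (0::'a)) * (gauss ?\<alpha> y * gauss (of_real \<beta>) (y - x)))"
  proof (rule Bochner_Integration.integral_cong[OF refl])
    fix y
    have "(LINT \<eta>|lborel. ?P \<eta> * gauss ?\<alpha> y * cis (- 2 * pi * ((y - x) \<bullet> ?S \<eta>)))
      = (LINT \<eta>|lborel. gauss ?\<alpha> y * (?P \<eta> * cis (- 2 * pi * ((y - x) \<bullet> ?S \<eta>))))"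
      by (simp add: mult_ac)
    also have "\<dots> = gauss ?\<alpha> y * ((\<Prod>i\<in>(UNIV::'l set). FT (gauss (of_real (b i))) (0::'a)) * gauss (of_real \<beta>) (y - x))"
      by (subst integral_mult_right_zero) (subst inner, rule refl)
    finally show "(LINT \<eta>|lborel. ?P \<eta> * gauss ?\<alpha> y * cis (- 2 * pi * ((y - x) \<bullet> ?S \<eta>))) =
      (\<Prod>i\<in>(UNIV::'l set). FT (gauss (of_real (b i))) (0::'a)) * (gauss ?\<alpha> y * gauss (of_real \<beta>) (y - x))"
      by (simp add: mult_ac)
  qed
  also have "\<dots> = (\<Prod>i\<in>(UNIV::'l set). FT (gauss (of_real (b i))) (0::'a)) *
     (FT (gauss ?\<alpha>) (0::'a) * FT (gauss (w + 1 / of_real \<beta>)) (0::'a) / FT (gauss (1 / of_real \<beta>)) (0::'a)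
       * gauss (1 / (w + 1 / of_real \<beta>)) x)"
    using gauss_convolution[OF \<alpha>, of "of_real \<beta>" x] \<beta> by simp
  finally have eq: "(LINT \<eta>|lborel. ?P \<eta> * gauss w (?S \<eta>) * cis (2 * pi * (x \<bullet> ?S \<eta>)))
    = (\<Prod>i\<in>(UNIV::'l set). FT (gauss (of_real (b i))) (0::'a)) * (FT (gauss (w + 1 / of_real \<beta>)) (0::'a) / FT (gauss (1 / of_real \<beta>)) (0::'a))
       * gauss (1 / (w + 1 / of_real \<beta>)) x"
    using FT_gauss_nonzero[OF \<alpha>, where ?'a='a] by simp
  have wb: "1 / (w + 1 / of_real \<beta>) = of_real \<beta> / (1 + of_real \<beta> * w)"
    using \<beta> by (simp add: field_simps)
  have wb': "norm (w + 1 / of_real \<beta>) = norm (1 + of_real \<beta> * w) / \<beta>"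
  proof -
    have "w + 1 / of_real \<beta> = (1 + of_real \<beta> * w) / of_real \<beta>" using \<beta> by (simp add: field_simps)
    then show ?thesis using \<beta> by (simp add: norm_divide)
  qed
  \<comment> \<open>In this quotient both the constant \<open>gauss_mass\<close> and the power of
    \<beta> cancel.\<close>
  have "norm (FT (gauss (w + 1 / of_real \<beta>)) (0::'a) / FT (gauss (1 / of_real \<beta>)) (0::'a))
      = norm (1 + of_real \<beta> * w) powr (- ?n)"
  proof -
    have "Re (1 / of_real \<beta>) > 0" using \<beta> by (simp add: Re_divide)
    moreover from this have "Re (w + 1 / of_real \<beta>) > 0" using w \<beta> by (simp add: add_pos_pos)
    ultimately have "norm (FT (gauss (w + 1 / of_real \<beta>)) (0::'a) / FT (gauss (1 / of_real \<beta>)) (0::'a))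
      = (?K * (norm (1 + of_real \<beta> * w) / \<beta>) powr (- ?n)) / (?K * (1 / \<beta>) powr (- ?n))"
      unfolding norm_divide using \<beta> by (simp add: norm_gauss_mass wb' norm_divide)
    also have "\<dots> = norm (1 + of_real \<beta> * w) powr (- ?n)"
      using K \<beta> by (simp add: powr_divide)
    finally show ?thesis .
  qed
  moreover have "norm (\<Prod>i\<in>(UNIV::'l set). FT (gauss (of_real (b i))) (0::'a)) = ?K ^ CARD('l) * (\<Prod>i\<in>UNIV. b i powr (- ?n))"
    unfolding prod_norm[symmetric] using b by (simp add: norm_gauss_mass prod.distrib abs_of_pos)
  ultimately show ?thesis
    unfolding eq norm_mult wb by simp
qed


section \<open>Modulated Gaussians as Schwartz functions\<close>

lemma schwartz_closedI:
  fixes f :: "'a::euclidean_space \<Rightarrow> complex"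
  assumes f: "f \<in> S"
    and cont: "\<And>g. g \<in> S \<Longrightarrow> continuous_on UNIV g"
    and rap: "\<And>g. g \<in> S \<Longrightarrow> rapid g"
    and der: "\<And>g b. g \<in> S \<Longrightarrow> b \<in> Basis \<Longrightarrow>
       \<exists>g'\<in>S. \<forall>x. ((\<lambda>t. g (x + t *\<^sub>R b)) has_vector_derivative g' x) (at 0)"
  shows "schwartz f"
proof -
  \<comment> \<open>The predicate \<open>schwartz\<close> asks for one coherent family of iterated
    derivatives; choosing, for each direction, a derivative inside \<open>S\<close> produces such a
    family.\<close>
  define d where "d b g = (SOME g'. g' \<in> S \<and> (\<forall>x. ((\<lambda>t. g (x + t *\<^sub>R b)) has_vector_derivative g' x) (at 0)))" for b g
  have "d b g \<in> S \<and> (\<forall>x. ((\<lambda>t. g (x + t *\<^sub>R b)) has_vector_derivative d b g x) (at 0))"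
    if "g \<in> S" "b \<in> Basis" for g b
  proof -
    have "\<exists>g'. g' \<in> S \<and> (\<forall>x. ((\<lambda>t. g (x + t *\<^sub>R b)) has_vector_derivative g' x) (at 0))"
      using der[OF that] by blast
    from someI_ex[OF this] show ?thesis unfolding d_def .
  qed
  then have d: "\<And>g b. g \<in> S \<Longrightarrow> b \<in> Basis \<Longrightarrow> d b g \<in> S"
    "\<And>g b x. g \<in> S \<Longrightarrow> b \<in> Basis \<Longrightarrow> ((\<lambda>t. g (x + t *\<^sub>R b)) has_vector_derivative d b g x) (at 0)"
    by blast+
  \<comment> \<open>\<open>foldr\<close> applies the head of the list last, in agreement with
    \<open>D (b # ds)\<close> being the derivative of \<open>D ds\<close> along
    \<open>b\<close>.\<close>
  define D where "D ds = foldr d ds f" for ds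
  have D: "D ds \<in> S" if "ds \<in> lists Basis" for ds
    using that unfolding D_def by (induction ds) (auto simp: f d(1))
  show ?thesis
    unfolding schwartz_def
  proof (intro exI[of _ D] conjI ballI allI)
    show "D [] = f" by (simp add: D_def)
    fix ds :: "'a list" assume ds: "ds \<in> lists Basis"
    show "continuous_on UNIV (D ds)" using cont D[OF ds] by blast
    show "\<exists>C. \<forall>x. (1 + norm x) ^ N * norm (D ds x) \<le> C" for N
      using rap[OF D[OF ds]] by (auto simp: rapid_def)
    show "((\<lambda>t. D ds (x + t *\<^sub>R b)) has_vector_derivative D (b # ds) x) (at 0)" if "b \<in> Basis" for b x
      using d(2)[OF D[OF ds] that] by (simp add: D_def)
  qed
qed

text \<open>Continuity, polynomial growth and stability under directional derivatives all follow by
  induction on this generation. Polynomials times a fixed modulated Gaussian then form a class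
  closed under derivatives, as \<open>schwartz_closedI\<close> demands.\<close>

inductive_set polynomials :: "('a::euclidean_space \<Rightarrow> complex) set" where
  const: "(\<lambda>x. c) \<in> polynomials"
| inner: "(\<lambda>x. complex_of_real (x \<bullet> b)) \<in> polynomials"
| add: "p \<in> polynomials \<Longrightarrow> q \<in> polynomials \<Longrightarrow> (\<lambda>x. p x + q x) \<in> polynomials"
| mult: "p \<in> polynomials \<Longrightarrow> q \<in> polynomials \<Longrightarrow> (\<lambda>x. p x * q x) \<in> polynomials"

lemma polynomials_continuous: "p \<in> polynomials \<Longrightarrow> continuous_on UNIV p"
  by (induction rule: polynomials.induct) (auto intro!: continuous_intros)

lemma polynomials_growth:
  "p \<in> polynomials \<Longrightarrow> \<exists>K M. 0 \<le> K \<and> (\<forall>x. norm (p x) \<le> K * (1 + norm x) ^ M)"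
proof (induction rule: polynomials.induct)
  case (const c)
  show ?case by (rule exI[of _ "norm c"], rule exI[of _ 0]) auto
next
  case (inner b)
  show ?case
  proof (rule exI[of _ "norm b"], rule exI[of _ 1], safe)
    fix x
    have "\<bar>x \<bullet> b\<bar> \<le> norm b * norm x" using Cauchy_Schwarz_ineq2[of x b] by (simp add: mult.commute)
    also have "\<dots> \<le> norm b * (1 + norm x)" by (intro mult_left_mono) auto
    finally show "norm (complex_of_real (x \<bullet> b)) \<le> norm b * (1 + norm x) ^ 1" by simp
  qed simp
next
  case (add p q)
  then obtain K M L N where K: "0 \<le> K" "\<And>x. norm (p x) \<le> K * (1 + norm x) ^ M"
    and L: "0 \<le> L" "\<And>x. norm (q x) \<le> L * (1 + norm x) ^ N" by blast
  have "norm (p x + q x) \<le> (K + L) * (1 + norm x) ^ (M + N)" for x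
  proof -
    have "norm (p x + q x) \<le> K * (1 + norm x) ^ M + L * (1 + norm x) ^ N"
      using norm_triangle_mono K(2) L(2) by blast
    also have "\<dots> \<le> K * (1 + norm x) ^ (M + N) + L * (1 + norm x) ^ (M + N)"
      by (intro add_mono mult_left_mono power_increasing K L) auto
    finally show ?thesis by (simp add: distrib_right)
  qed
  then show ?case using K(1) L(1) by (meson add_nonneg_nonneg)
next
  case (mult p q)
  then obtain K M L N where K: "0 \<le> K" "\<And>x. norm (p x) \<le> K * (1 + norm x) ^ M"
    and L: "0 \<le> L" "\<And>x. norm (q x) \<le> L * (1 + norm x) ^ N" by blast
  have "norm (p x * q x) \<le> (K * L) * (1 + norm x) ^ (M + N)" for x
  proof -
    have "norm (p x * q x) \<le> (K * (1 + norm x) ^ M) * (L * (1 + norm x) ^ N)"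
      unfolding norm_mult by (intro mult_mono K L) (auto simp: K)
    then show ?thesis by (simp add: power_add mult_ac)
  qed
  then show ?case using K(1) L(1) by (meson mult_nonneg_nonneg)
qed

lemma polynomials_derivative:
  "p \<in> polynomials \<Longrightarrow> \<exists>p'\<in>polynomials. \<forall>x. ((\<lambda>t. p (x + t *\<^sub>R b)) has_vector_derivative p' x) (at 0)"
proof (induction rule: polynomials.induct)
  case (const c)
  show ?case by (rule bexI[of _ "\<lambda>x. 0"]) (auto intro: polynomials.const)
next
  case (inner c)
  have "((\<lambda>t. complex_of_real ((x + t *\<^sub>R b) \<bullet> c)) has_vector_derivative complex_of_real (b \<bullet> c)) (at 0)" for x
  proof -
    have "((\<lambda>z. of_real (x \<bullet> c) + z * of_real (b \<bullet> c)) has_field_derivative of_real (b \<bullet> c)) (at (of_real 0 :: complex))"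
      by (auto intro!: derivative_eq_intros)
    from has_vector_derivative_real_field[OF this] show ?thesis by (simp add: inner_add_left)
  qed
  then show ?case by (intro bexI[of _ "\<lambda>x. complex_of_real (b \<bullet> c)"]) (auto intro: polynomials.const)
next
  case (add p q)
  then obtain p' q' where "p' \<in> polynomials" "q' \<in> polynomials"
    "\<And>x. ((\<lambda>t. p (x + t *\<^sub>R b)) has_vector_derivative p' x) (at 0)"
    "\<And>x. ((\<lambda>t. q (x + t *\<^sub>R b)) has_vector_derivative q' x) (at 0)" by blast
  then show ?case
    by (intro bexI[of _ "\<lambda>x. p' x + q' x"]) (auto intro: polynomials.add has_vector_derivative_add)
next
  case (mult p q)
  then obtain p' q' where p': "p' \<in> polynomials" "q' \<in> polynomials"
    "\<And>x. ((\<lambda>t. p (x + t *\<^sub>R b)) has_vector_derivative p' x) (at 0)"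
    "\<And>x. ((\<lambda>t. q (x + t *\<^sub>R b)) has_vector_derivative q' x) (at 0)" by blast
  show ?case
    using has_vector_derivative_mult[OF p'(3) p'(4)] mult p'(1,2)
    by (intro bexI[of _ "\<lambda>x. p x * q' x + p' x * q x"]) (auto intro!: polynomials.intros)
qed

text \<open>The modulation translates the Fourier transform to the centre \<open>a\<close>, where
  the multiplier lives.\<close>

definition mod_gauss :: "'a::euclidean_space \<Rightarrow> complex \<Rightarrow> 'a \<Rightarrow> complex" where
  "mod_gauss a w x = cis (2 * pi * (x \<bullet> a)) * gauss w x"

lemma norm_mod_gauss: "norm (mod_gauss a w x) = norm (gauss w x)"
  by (simp add: mod_gauss_def norm_mult)

lemma rapid_mod_gauss: "Re w > 0 \<Longrightarrow> rapid (mod_gauss a w)"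
  unfolding mod_gauss_def[abs_def] by (intro rapid_cis_mult rapid_gauss) auto

lemma mod_gauss_line_derivative:
  fixes w :: complex
  shows "((\<lambda>t. mod_gauss a w (x + t *\<^sub>R b)) has_vector_derivative
     (2 * pi * (b \<bullet> a) * \<i> + (- (2 * pi) * w) * complex_of_real (x \<bullet> b)) * mod_gauss a w x) (at 0)"
proof -
  have "((\<lambda>t. cis (2 * pi * (x \<bullet> a) + t * (2 * pi * (b \<bullet> a)))) has_vector_derivative
    (\<i> * complex_of_real (2 * pi * (b \<bullet> a)) * cis (2 * pi * (x \<bullet> a) + 0 * (2 * pi * (b \<bullet> a))))) (at 0)"
    by (rule has_vector_derivative_cis_affine)
  then have "((\<lambda>t. cis (2 * pi * ((x + t *\<^sub>R b) \<bullet> a))) has_vector_derivative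
    (\<i> * complex_of_real (2 * pi * (b \<bullet> a)) * cis (2 * pi * (x \<bullet> a)))) (at 0)"
    by (simp add: inner_add_left algebra_simps)
  from has_vector_derivative_mult[OF this gauss_line_derivative[of w x b]]
  show ?thesis by (simp add: mod_gauss_def algebra_simps)
qed

lemma schwartz_mod_gauss:
  assumes w: "Re w > 0" shows "schwartz (mod_gauss a w)"
proof (rule schwartz_closedI[where S="{\<lambda>x. p x * mod_gauss a w x | p. p \<in> polynomials}"])
  show "mod_gauss a w \<in> {\<lambda>x. p x * mod_gauss a w x | p. p \<in> polynomials}"
    by (auto intro!: exI[of _ "\<lambda>x. 1"] polynomials.const)
  fix g assume "g \<in> {\<lambda>x. p x * mod_gauss a w x | p. p \<in> polynomials}"
  then obtain p where g: "g = (\<lambda>x. p x * mod_gauss a w x)" and p: "p \<in> polynomials" by blast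
  show "continuous_on UNIV g"
    unfolding g mod_gauss_def gauss_def cis_conv_exp
    by (intro continuous_intros polynomials_continuous[OF p])
  obtain K M where "\<And>x. norm (p x) \<le> K * (1 + norm x) ^ M" using polynomials_growth[OF p] by blast
  then show "rapid g" unfolding g
    using polynomials_continuous[OF p]
    by (intro rapid_polynomial_mult rapid_mod_gauss w borel_measurable_continuous_onI)
  fix b :: 'a assume "b \<in> Basis"
  obtain p' where p': "p' \<in> polynomials" "\<And>x. ((\<lambda>t. p (x + t *\<^sub>R b)) has_vector_derivative p' x) (at 0)"
    using polynomials_derivative[OF p] by blast
  \<comment> \<open>The logarithmic derivative of \<open>mod_gauss\<close> is affine, hence itself a
    polynomial, and differentiation does not leave the class.\<close>
  let ?q = "\<lambda>x. p x * (2 * pi * (b \<bullet> a) * \<i> + (- (2 * pi) * w) * complex_of_real (x \<bullet> b)) + p' x"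
  have q: "?q \<in> polynomials" by (intro polynomials.intros p p')
  have "((\<lambda>t. g (x + t *\<^sub>R b)) has_vector_derivative ?q x * mod_gauss a w x) (at 0)" for x
    unfolding g using has_vector_derivative_mult[OF p'(2) mod_gauss_line_derivative[of a w x b]]
    by (simp add: algebra_simps)
  then show "\<exists>g'\<in>{\<lambda>x. p x * mod_gauss a w x | p. p \<in> polynomials}. \<forall>x. ((\<lambda>t. g (x + t *\<^sub>R b)) has_vector_derivative g' x) (at 0)"
    using q by (intro bexI[of _ "\<lambda>x. ?q x * mod_gauss a w x"] CollectI exI[of _ ?q]) auto
qed

lemma FT_mod_gauss:
  fixes \<xi> :: "'a::euclidean_space"
  assumes "Re w > 0"
  shows "FT (mod_gauss a w) \<xi> = FT (gauss w) (0::'a) * gauss (1 / w) (\<xi> - a)"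
proof -
  have "FT (mod_gauss a w) \<xi> = FT (gauss w) (\<xi> - a)"
    unfolding FT_def mod_gauss_def
    by (intro Bochner_Integration.integral_cong refl) (simp add: cis_mult inner_diff_right algebra_simps)
  then show ?thesis using FT_gauss[OF assms] by simp
qed

lemma Lp_norm_gauss:
  fixes f :: "'a::euclidean_space \<Rightarrow> complex"
  assumes f: "\<And>x. norm (f x) = A * norm (gauss w x)" and A: "A \<ge> 0" and w: "Re w > 0" and p: "p > 0"
  shows "Lp_norm p f = ennreal (A * (gauss_mass TYPE('a) * (p * Re w) powr (- (real DIM('a) / 2))) powr (1 / p))"
proof -
  let ?X = "gauss_mass TYPE('a) * (p * Re w) powr (- (real DIM('a) / 2))"
  have X: "?X \<ge> 0" using gauss_mass_pos[where ?'a='a] by (simp add: less_imp_le)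
  have "(\<integral>\<^sup>+ x. ennreal (norm (f x) powr p) \<partial>lborel) = (\<integral>\<^sup>+ x. ennreal (A powr p) * ennreal (norm (gauss w x) powr p) \<partial>(lborel::'a measure))"
    unfolding f using A by (simp add: powr_mult ennreal_mult)
  also have "\<dots> = ennreal (A powr p) * (\<integral>\<^sup>+ x. ennreal (norm (gauss w x) powr p) \<partial>(lborel::'a measure))"
    by (rule nn_integral_cmult) measurable
  also have "\<dots> = ennreal (A powr p * ?X)"
    using X nn_integral_norm_gauss_powr[OF w p, where ?'a='a] by (simp add: ennreal_mult)
  finally show ?thesis
    using A X p unfolding Lp_norm_def enn_root_def by (simp add: powr_mult powr_powr)
qed

section \<open>The Gaussian multiplier and its action on the test functions\<close>

definition gauss_multiplier :: "('l \<Rightarrow> complex) \<Rightarrow> complex \<Rightarrow> real^'n^'l \<Rightarrow> real^'n^'l \<Rightarrow> complex" where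
  "gauss_multiplier w v a \<xi> = (\<Prod>i\<in>UNIV. gauss (w i) ((\<xi> - a) $ i)) * gauss v (\<Sum>i\<in>UNIV. (\<xi> - a) $ i)"

lemma gauss_multiplier_measurable [measurable]: "gauss_multiplier w v a \<in> borel_measurable borel"
  unfolding gauss_multiplier_def[abs_def] by measurable

text \<open>The weight \<open>1 / cnj (w i)\<close> makes the transform of the test function a
  Gaussian of weight \<open>cnj (w i)\<close>, and \<open>cnj (w i) + w i = 2 * Re (w i)\<close>. So
  the chirps of all blocks cancel, real weights are left for \<open>gauss_form_integral\<close>, and
  only \<open>v\<close> stays complex. The imaginary parts survive in the constants
  \<open>norm (w i)\<close>, the source of the gain for the chirp family.\<close>

lemma norm_T_mult_gauss:
  fixes a :: "real^'n^'l" and x :: "real^'n"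
  assumes w: "\<And>i. Re (w i) > 0" and v: "Re v > 0"
  defines "\<beta> \<equiv> (\<Sum>i\<in>UNIV. 1 / (2 * Re (w i)))"
  shows "norm (T_mult (gauss_multiplier w v a) (\<lambda>i. mod_gauss (a $ i) (1 / cnj (w i))) x)
    = gauss_mass TYPE(real^'n) ^ (2 * CARD('l)) * (\<Prod>i\<in>UNIV. (norm (w i) / (2 * Re (w i))) powr (real CARD('n) / 2))
       * norm (1 + of_real \<beta> * v) powr (- (real CARD('n) / 2)) * norm (gauss (of_real \<beta> / (1 + of_real \<beta> * v)) x)"
proof -
  let ?n = "real CARD('n) / 2" and ?K = "gauss_mass TYPE(real^'n)"
  let ?I = "\<lambda>i. FT (gauss (1 / cnj (w i))) (0::real^'n)"
  have cw: "Re (cnj (w i)) > 0" "Re (1 / cnj (w i)) > 0" for i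
    using w[of i] Re_inverse_pos[of "cnj (w i)"] by auto
  let ?G = "\<lambda>\<eta>::real^'n^'l. (\<Prod>i\<in>UNIV. ?I i) * ((\<Prod>i\<in>UNIV. gauss (of_real (2 * Re (w i))) (\<eta> $ i)) * gauss v (\<Sum>i\<in>UNIV. \<eta> $ i)
       * cis (2 * pi * (x \<bullet> (\<Sum>i\<in>UNIV. \<eta> $ i)))) * cis (2 * pi * (x \<bullet> (\<Sum>i\<in>UNIV. a $ i)))"
  have [measurable]: "?G \<in> borel_measurable borel" by measurable
  \<comment> \<open>Translation by \<open>a\<close> centres all Gaussians at 0; the character then
    leaves a unimodular factor in the sum of the \<open>a $ i\<close>, which disappears in the
    modulus.\<close>
  have "T_mult (gauss_multiplier w v a) (\<lambda>i. mod_gauss (a $ i) (1 / cnj (w i))) x = (LINT \<xi>|lborel. ?G (- a + \<xi>))"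
    unfolding T_mult_def
  proof (rule Bochner_Integration.integral_cong[OF refl])
    fix \<xi> :: "real^'n^'l"
    let ?A = "\<Prod>i\<in>UNIV. FT (mod_gauss (a $ i) (1 / cnj (w i))) (\<xi> $ i)"
    let ?B = "\<Prod>i\<in>UNIV. gauss (w i) ((\<xi> - a) $ i)"
    have sw: "- a + \<xi> = \<xi> - a" by simp
    have 1: "?A * ?B = (\<Prod>i\<in>UNIV. ?I i) * (\<Prod>i\<in>UNIV. gauss (of_real (2 * Re (w i))) ((\<xi> - a) $ i))"
      unfolding prod.distrib[symmetric]
    proof (rule prod.cong[OF refl])
      fix i
      have "cnj (w i) + w i = of_real (2 * Re (w i))" by (simp add: complex_eq_iff)
      then show "FT (mod_gauss (a $ i) (1 / cnj (w i))) (\<xi> $ i) * gauss (w i) ((\<xi> - a) $ i)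
         = ?I i * gauss (of_real (2 * Re (w i))) ((\<xi> - a) $ i)"
        by (subst FT_mod_gauss[OF cw(2)]) (simp add: gauss_mult mult.assoc)
    qed
    have 2: "cis (2 * pi * (x \<bullet> (\<Sum>i\<in>UNIV. \<xi> $ i)))
       = cis (2 * pi * (x \<bullet> (\<Sum>i\<in>UNIV. (\<xi> - a) $ i))) * cis (2 * pi * (x \<bullet> (\<Sum>i\<in>UNIV. a $ i)))"
      by (simp add: cis_mult sum_subtractf inner_diff_right algebra_simps)
    have "?A * gauss_multiplier w v a \<xi> * cis (2 * pi * (x \<bullet> (\<Sum>i\<in>UNIV. \<xi> $ i)))
       = (?A * ?B) * gauss v (\<Sum>i\<in>UNIV. (\<xi> - a) $ i) * cis (2 * pi * (x \<bullet> (\<Sum>i\<in>UNIV. \<xi> $ i)))"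
      unfolding gauss_multiplier_def by (simp only: mult.assoc)
    then show "?A * gauss_multiplier w v a \<xi> * cis (2 * pi * (x \<bullet> (\<Sum>i\<in>UNIV. \<xi> $ i))) = ?G (- a + \<xi>)"
      unfolding 1 2 sw by (simp only: mult_ac)
  qed
  also have "\<dots> = (LINT \<xi>|lborel. ?G \<xi>)"
    by (rule lborel_integral_translate) measurable
  also have "\<dots> = (\<Prod>i\<in>UNIV. ?I i) * (LINT \<eta>|lborel. (\<Prod>i\<in>UNIV. gauss (of_real (2 * Re (w i))) (\<eta> $ i)) * gauss v (\<Sum>i\<in>UNIV. \<eta> $ i)
       * cis (2 * pi * (x \<bullet> (\<Sum>i\<in>UNIV. \<eta> $ i)))) * cis (2 * pi * (x \<bullet> (\<Sum>i\<in>UNIV. a $ i)))"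
    by simp
  finally have T: "norm (T_mult (gauss_multiplier w v a) (\<lambda>i. mod_gauss (a $ i) (1 / cnj (w i))) x)
    = norm (\<Prod>i\<in>UNIV. ?I i) * (?K ^ CARD('l) * (\<Prod>i\<in>UNIV. (2 * Re (w i)) powr (- ?n))
       * norm (1 + of_real \<beta> * v) powr (- ?n) * norm (gauss (of_real \<beta> / (1 + of_real \<beta> * v)) x))"
    using gauss_form_integral[of "\<lambda>i. 2 * Re (w i)" v x] w v by (simp add: norm_mult \<beta>_def)
  have I: "norm (\<Prod>i\<in>UNIV. ?I i) = ?K ^ CARD('l) * (\<Prod>i\<in>UNIV. norm (w i) powr ?n)"
  proof -
    have "norm (?I i) = ?K * norm (w i) powr ?n" for i
      using norm_gauss_mass[OF cw(2)[of i], where ?'a="real^'n"] by (simp add: norm_divide powr_divide powr_minus)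
    then show ?thesis unfolding prod_norm[symmetric] by (simp add: prod.distrib)
  qed
  have Q: "(\<Prod>i\<in>UNIV. (norm (w i) / (2 * Re (w i))) powr ?n) = (\<Prod>i\<in>UNIV. norm (w i) powr ?n) * (\<Prod>i\<in>UNIV. (2 * Re (w i)) powr (- ?n))"
    unfolding prod.distrib[symmetric]
  proof (rule prod.cong[OF refl])
    fix i
    have "(norm (w i) / (2 * Re (w i))) powr ?n = norm (w i) powr ?n / (2 * Re (w i)) powr ?n"
      using w[of i] by (intro powr_divide)
    then show "(norm (w i) / (2 * Re (w i))) powr ?n = norm (w i) powr ?n * (2 * Re (w i)) powr (- ?n)"
      unfolding powr_minus by (simp only: divide_inverse)
  qed
  have K2: "?K ^ (2 * CARD('l)) = ?K ^ CARD('l) * ?K ^ CARD('l)" by (simp add: mult_2 power_add)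
  have alg: "(k * p) * (k * q * c * g) = (k * k) * (p * q) * c * g" for k p q c g :: real
    by (simp add: mult_ac)
  show ?thesis unfolding T I Q K2 by (rule alg)
qed

section \<open>Sobolev norms by heat kernel subordination\<close>

text \<open>Jensen's inequality on a finite measure, by integrating the tangent line at the mean
  \<open>c\<close>; the power of the total mass makes up for the missing normalisation.\<close>

lemma powr_mean_le:
  assumes "finite_measure M" and X: "X \<in> borel_measurable M" "\<And>x. 0 \<le> X x" "\<And>x. X x \<le> B" and u: "u \<ge> (1::real)"
  shows "(LINT x|M. X x) powr u \<le> measure M (space M) powr (u - 1) * (LINT x|M. X x powr u)"
proof -
  interpret finite_measure M by fact
  note [measurable] = X(1)
  let ?m = "measure M (space M)"
  have int: "integrable M X" using X by (intro integrable_const_bound[of _ B]) auto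
  have intu: "integrable M (\<lambda>x. X x powr u)"
    using X u by (intro integrable_const_bound[of _ "B powr u"]) (auto intro!: powr_mono2)
  have I0: "(LINT x|M. X x) \<ge> 0" using X by (intro integral_nonneg_AE) auto
  show ?thesis
  proof (cases "(LINT x|M. X x) = 0")
    case True
    then show ?thesis using u by (auto intro!: mult_nonneg_nonneg integral_nonneg_AE)
  next
    case False
    then have Ipos: "(LINT x|M. X x) > 0" using I0 by simp
    have "?m \<noteq> 0"
    proof
      assume "?m = 0"
      then have "AE x in M. False"
        by (intro AE_I[of _ _ "space M"]) (auto simp: emeasure_eq_measure)
      then have "(LINT x|M. X x) = 0" by (intro integral_eq_zero_AE) auto
      then show False using False by simp
    qed
    then have m: "?m > 0" by (simp add: zero_less_measure_iff)
    define c where "c = (LINT x|M. X x) / ?m"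
    have c: "c > 0" using Ipos m by (simp add: c_def)
    \<comment> \<open>The value 0 lies outside the open half-line on which convexity is applied;
      there the tangent takes the value \<open>c powr u * (1 - u)\<close>, which is at most
      0.\<close>
    have tan: "c powr u + u * c powr (u - 1) * (X x - c) \<le> X x powr u" for x
    proof (cases "X x = 0")
      case True
      have "c powr u = c powr (u - 1) * c" using c by (simp add: powr_diff)
      then have "c powr u + u * c powr (u - 1) * (X x - c) = c powr u * (1 - u)"
        using True by (simp add: algebra_simps)
      also have "\<dots> \<le> 0" using u by (intro mult_nonneg_nonpos) auto
      finally show ?thesis by (metis order_trans powr_ge_zero)
    next
      case False
      then have x: "X x > 0" using X(2)[of x] by simp
      have "X x powr u - c powr u \<ge> u * c powr (u - 1) * (X x - c)"
      proof (rule convex_on_imp_above_tangent[where A="{0<..}"])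
        show "convex_on {0<..} (\<lambda>x::real. x powr u)" using u by (rule powr_convex)
        show "((\<lambda>x. x powr u) has_real_derivative u * c powr (u - 1)) (at c within {0<..})"
          using c by (auto intro!: derivative_eq_intros simp: powr_diff)
      qed (use c x in \<open>auto simp: interior_open\<close>)
      then show ?thesis by simp
    qed
    have "?m * c powr u = (LINT x|M. c powr u + u * c powr (u - 1) * (X x - c))"
      using int m by (simp add: c_def)
    also have "\<dots> \<le> (LINT x|M. X x powr u)"
      using int intu tan by (intro integral_mono) auto
    finally have le: "?m * c powr u \<le> (LINT x|M. X x powr u)" .
    have "(LINT x|M. X x) powr u = ?m powr (u - 1) * (?m * c powr u)"
      using m Ipos by (simp add: c_def powr_divide powr_diff)
    also have "\<dots> \<le> ?m powr (u - 1) * (LINT x|M. X x powr u)"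
      using le by (intro mult_left_mono) auto
    finally show ?thesis .
  qed
qed

text \<open>Convolution with a measure instead of a density: mixtures of heat kernels arise as
  push-forwards, and their densities never have to be written down.\<close>

definition mconv :: "'a::euclidean_space measure \<Rightarrow> ('a \<Rightarrow> complex) \<Rightarrow> 'a \<Rightarrow> complex" where
  "mconv \<kappa> E x = (LINT y|\<kappa>. E (x - y))"

lemma mconv_measurable [measurable]:
  assumes "finite_measure \<kappa>" and [measurable_cong]: "sets \<kappa> = sets borel" and [measurable]: "E \<in> borel_measurable borel"
  shows "mconv \<kappa> E \<in> borel_measurable borel"
proof -
  interpret finite_measure \<kappa> by fact
  show ?thesis unfolding mconv_def[abs_def] by measurable
qed

text \<open>Young's inequality with a finite positive measure in the role of the L^1 factor: Jensen
  in \<open>y\<close>, then Tonelli and translation invariance.\<close>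

lemma nn_integral_mconv_powr_le:
  assumes "finite_measure \<kappa>" and [measurable_cong]: "sets \<kappa> = sets borel"
    and [measurable]: "E \<in> borel_measurable borel" and E: "\<And>x. norm (E x) \<le> B" and u: "u \<ge> 1"
  shows "(\<integral>\<^sup>+ x. ennreal (norm (mconv \<kappa> E x) powr u) \<partial>lborel)
     \<le> ennreal (measure \<kappa> UNIV powr u) * (\<integral>\<^sup>+ x. ennreal (norm (E x) powr u) \<partial>lborel)"
proof -
  interpret finite_measure \<kappa> by fact
  interpret pair_sigma_finite \<kappa> "lborel :: 'a measure" by standard
  let ?m = "measure \<kappa> UNIV"
  have sp: "space \<kappa> = UNIV" using sets_eq_imp_space_eq[of \<kappa> borel] by (simp add: assms)
  have "(\<integral>\<^sup>+ x. ennreal (norm (mconv \<kappa> E x) powr u) \<partial>lborel)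
     \<le> (\<integral>\<^sup>+ x. ennreal (?m powr (u - 1)) * (\<integral>\<^sup>+ y. ennreal (norm (E (x - y)) powr u) \<partial>\<kappa>) \<partial>lborel)"
  proof (rule nn_integral_mono)
    fix x
    have intu: "integrable \<kappa> (\<lambda>y. norm (E (x - y)) powr u)"
      using E u by (intro integrable_const_bound[of _ "B powr u"]) (auto intro!: powr_mono2)
    have "norm (mconv \<kappa> E x) powr u \<le> (LINT y|\<kappa>. norm (E (x - y))) powr u"
      unfolding mconv_def using u by (intro powr_mono2 integral_norm_bound) auto
    also have "\<dots> \<le> ?m powr (u - 1) * (LINT y|\<kappa>. norm (E (x - y)) powr u)"
      using powr_mean_le[OF \<open>finite_measure \<kappa>\<close>, of "\<lambda>y. norm (E (x - y))" B u] E u by (simp add: sp)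
    finally have "ennreal (norm (mconv \<kappa> E x) powr u) \<le> ennreal (?m powr (u - 1) * (LINT y|\<kappa>. norm (E (x - y)) powr u))"
      by (rule ennreal_leI)
    also have "\<dots> = ennreal (?m powr (u - 1)) * (\<integral>\<^sup>+ y. ennreal (norm (E (x - y)) powr u) \<partial>\<kappa>)"
      using intu by (subst nn_integral_eq_integral) (auto intro!: ennreal_mult integral_nonneg_AE)
    finally show "ennreal (norm (mconv \<kappa> E x) powr u) \<le> \<dots>" .
  qed
  also have "\<dots> = ennreal (?m powr (u - 1)) * (\<integral>\<^sup>+ x. (\<integral>\<^sup>+ y. ennreal (norm (E (x - y)) powr u) \<partial>\<kappa>) \<partial>lborel)"
    by (rule nn_integral_cmult) measurable
  also have "(\<integral>\<^sup>+ x. (\<integral>\<^sup>+ y. ennreal (norm (E (x - y)) powr u) \<partial>\<kappa>) \<partial>lborel)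
     = (\<integral>\<^sup>+ y. (\<integral>\<^sup>+ x. ennreal (norm (E (x - y)) powr u) \<partial>lborel) \<partial>\<kappa>)"
    by (rule Fubini') measurable
  also have "\<dots> = (\<integral>\<^sup>+ y. (\<integral>\<^sup>+ x. ennreal (norm (E x) powr u) \<partial>lborel) \<partial>\<kappa>)"
  proof (rule nn_integral_cong)
    fix y
    show "(\<integral>\<^sup>+ x. ennreal (norm (E (x - y)) powr u) \<partial>lborel) = (\<integral>\<^sup>+ x. ennreal (norm (E x) powr u) \<partial>lborel)"
      using lborel_nn_integral_translate[of "\<lambda>x. ennreal (norm (E x) powr u)" "- y"] by simp
  qed
  also have "\<dots> = (\<integral>\<^sup>+ x. ennreal (norm (E x) powr u) \<partial>lborel) * ennreal ?m"
    by (simp add: emeasure_eq_measure sp)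
  also have "ennreal (?m powr (u - 1)) * ((\<integral>\<^sup>+ x. ennreal (norm (E x) powr u) \<partial>lborel) * ennreal ?m)
     = ennreal (?m powr u) * (\<integral>\<^sup>+ x. ennreal (norm (E x) powr u) \<partial>lborel)"
  proof -
    have "?m powr u = ?m powr (u - 1) * ?m" by (cases "?m = 0") (auto simp: powr_diff)
    then show ?thesis by (simp add: ennreal_mult mult_ac)
  qed
  finally show ?thesis .
qed

text \<open>The product rule for the transform of a convolution, in the tested form in which
  \<open>sobolev_norm\<close> states its Fourier identity. The two integrability claims allow
  several such identities to be added.\<close>

lemma mconv_FT_pairing:
  assumes "finite_measure \<kappa>" and [measurable_cong]: "sets \<kappa> = sets borel"
    and E: "integrable lborel E" and \<phi>: "integrable lborel \<phi>"
  shows "integrable lborel (\<lambda>x. mconv \<kappa> E x * FT \<phi> x)" (is ?int)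
    and "integrable lborel (\<lambda>\<xi>. (LINT y|\<kappa>. cis (- 2 * pi * (y \<bullet> \<xi>))) * FT E \<xi> * \<phi> \<xi>)" (is ?int')
    and "(LINT x|lborel. mconv \<kappa> E x * FT \<phi> x)
      = (LINT \<xi>|lborel. (LINT y|\<kappa>. cis (- 2 * pi * (y \<bullet> \<xi>))) * FT E \<xi> * \<phi> \<xi>)" (is "?L = ?R")
proof -
  interpret finite_measure \<kappa> by fact
  interpret pair_sigma_finite \<kappa> "lborel :: 'a measure" by standard
  have [measurable]: "E \<in> borel_measurable borel" "\<phi> \<in> borel_measurable borel"
    using borel_measurable_integrable[OF E] borel_measurable_integrable[OF \<phi>] by auto
  let ?B = "LINT x|lborel. norm (\<phi> x)" and ?BE = "LINT x|lborel. norm (E x)"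
  have B: "norm (FT \<phi> x) \<le> ?B" for x by (rule norm_FT_le[OF \<phi>])
  have BE: "norm (FT E x) \<le> ?BE" for x by (rule norm_FT_le[OF E])
  have Ey: "integrable lborel (\<lambda>x. E (x - y))" for y
  proof -
    have "integrable (distr lborel borel ((+) (- y))) E" by (simp add: lborel_distr_plus E)
    then have "integrable lborel (\<lambda>x. E (- y + x))" by (subst (asm) integrable_distr_eq) auto
    then show ?thesis by simp
  qed
  have EyF: "integrable lborel (\<lambda>x. E (x - y) * FT \<phi> x)" for y
  proof (rule Bochner_Integration.integrable_bound[OF integrable_mult_right[OF Ey[of y], of "of_real ?B"]])
    show "AE x in lborel. norm (E (x - y) * FT \<phi> x) \<le> norm (complex_of_real ?B * E (x - y))"
      using B by (intro AE_I2) (auto simp: norm_mult mult.commute[of "norm (E _)"] integral_nonneg_AE intro!: mult_right_mono)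
  qed measurable
  have int: "integrable (\<kappa> \<Otimes>\<^sub>M lborel) (\<lambda>(y, x). E (x - y) * FT \<phi> x)"
  proof (rule Fubini_integrable)
    show "integrable \<kappa> (\<lambda>y. LINT x|lborel. norm (case (y, x) of (y, x) \<Rightarrow> E (x - y) * FT \<phi> x))"
    proof (rule integrable_const_bound[of _ "?B * ?BE"])
      show "AE y in \<kappa>. norm (LINT x|lborel. norm (case (y, x) of (y, x) \<Rightarrow> E (x - y) * FT \<phi> x)) \<le> ?B * ?BE"
      proof (rule AE_I2)
        fix y
        have "(LINT x|lborel. norm (E (x - y) * FT \<phi> x)) \<le> (LINT x|lborel. ?B * norm (E (x - y)))"
        proof (rule integral_mono)
          show "integrable lborel (\<lambda>x. norm (E (x - y) * FT \<phi> x))" by (rule integrable_norm[OF EyF])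
          show "integrable lborel (\<lambda>x. ?B * norm (E (x - y)))" using Ey[of y] by simp
          show "norm (E (x - y) * FT \<phi> x) \<le> ?B * norm (E (x - y))" for x
            using B[of x] by (auto simp: norm_mult mult.commute[of "norm (E _)"] intro!: mult_right_mono)
        qed
        also have "\<dots> = ?B * ?BE"
          using lborel_integral_translate[of "\<lambda>x. norm (E x)" "- y"] by simp
        finally show "norm (LINT x|lborel. norm (case (y, x) of (y, x) \<Rightarrow> E (x - y) * FT \<phi> x)) \<le> ?B * ?BE"
          by (simp add: integral_nonneg_AE)
      qed
    qed measurable
    show "AE y in \<kappa>. integrable lborel (\<lambda>x. case (y, x) of (y, x) \<Rightarrow> E (x - y) * FT \<phi> x)"
      using EyF by simp
  qed measurable
  have eq: "mconv \<kappa> E x * FT \<phi> x = (LINT y|\<kappa>. E (x - y) * FT \<phi> x)" for x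
    by (simp add: mconv_def)
  show ?int
    unfolding eq using integrable_snd[OF int] by simp
  have inner: "(LINT x|lborel. E (x - y) * FT \<phi> x) = (LINT \<xi>|lborel. 1 * (FT E \<xi> * \<phi> \<xi>) * cis (- 2 * pi * (y \<bullet> \<xi>)))" for y
  proof -
    have "(LINT x|lborel. E (x - y) * FT \<phi> x) = (LINT x|lborel. E x * FT \<phi> (y + x))"
      using lborel_integral_translate[of "\<lambda>x. E (x - y) * FT \<phi> x" y] by simp
    also have "\<dots> = (LINT x|lborel. LINT \<xi>|lborel. \<phi> \<xi> * E x * cis (- 2 * pi * (\<xi> \<bullet> (y + x))))"
      unfolding FT_def by (subst integral_mult_right_zero[symmetric]) (simp add: mult_ac)
    also have "\<dots> = (LINT \<xi>|lborel. LINT x|lborel. \<phi> \<xi> * E x * cis (- 2 * pi * (\<xi> \<bullet> (y + x))))"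
      using E \<phi> by (intro lborel_pair.integral_swap_bounded[where B=1]) auto
    also have "\<dots> = (LINT \<xi>|lborel. 1 * (FT E \<xi> * \<phi> \<xi>) * cis (- 2 * pi * (y \<bullet> \<xi>)))"
    proof (rule Bochner_Integration.integral_cong[OF refl])
      fix \<xi>
      have "(LINT x|lborel. \<phi> \<xi> * E x * cis (- 2 * pi * (\<xi> \<bullet> (y + x))))
        = (LINT x|lborel. (\<phi> \<xi> * cis (- 2 * pi * (y \<bullet> \<xi>))) * (E x * cis (- 2 * pi * (x \<bullet> \<xi>))))"
        by (intro Bochner_Integration.integral_cong refl) (simp add: cis_mult inner_add_right inner_commute algebra_simps)
      also have "\<dots> = 1 * (FT E \<xi> * \<phi> \<xi>) * cis (- 2 * pi * (y \<bullet> \<xi>))"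
        by (subst integral_mult_right_zero) (simp add: FT_def mult_ac)
      finally show "(LINT x|lborel. \<phi> \<xi> * E x * cis (- 2 * pi * (\<xi> \<bullet> (y + x)))) = 1 * (FT E \<xi> * \<phi> \<xi>) * cis (- 2 * pi * (y \<bullet> \<xi>))" .
    qed
    finally show ?thesis .
  qed
  have intE\<phi>: "integrable lborel (\<lambda>\<xi>. FT E \<xi> * \<phi> \<xi>)"
  proof (rule Bochner_Integration.integrable_bound[OF integrable_mult_right[OF \<phi>, of "of_real ?BE"]])
    show "AE x in lborel. norm (FT E x * \<phi> x) \<le> norm (complex_of_real ?BE * \<phi> x)"
      using BE by (intro AE_I2) (auto simp: norm_mult integral_nonneg_AE intro!: mult_right_mono)
  qed measurable
  have eq2: "(LINT y|\<kappa>. cis (- 2 * pi * (y \<bullet> \<xi>))) * FT E \<xi> * \<phi> \<xi> = (LINT y|\<kappa>. 1 * (FT E \<xi> * \<phi> \<xi>) * cis (- 2 * pi * (y \<bullet> \<xi>)))" for \<xi>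
    by (subst integral_mult_right_zero) (simp add: mult_ac)
  \<comment> \<open>The constant 1 acts as the first factor and brings the integrand into the shape
    required by \<open>integral_swap_bounded\<close>.\<close>
  have one: "integrable \<kappa> (\<lambda>_. 1 :: complex)" by simp
  have kk: "(\<lambda>(y, \<xi>). cis (- 2 * pi * (y \<bullet> \<xi>))) \<in> borel_measurable (\<kappa> \<Otimes>\<^sub>M (lborel :: 'a measure))" by measurable
  have nn: "norm (cis (- 2 * pi * (y \<bullet> \<xi>))) \<le> 1" for y \<xi> :: 'a by simp
  show ?int'
    unfolding eq2 using integrable_snd[OF integrable_prod_bounded[OF one intE\<phi> kk nn]] by simp
  have "?L = (LINT x|lborel. LINT y|\<kappa>. E (x - y) * FT \<phi> x)" unfolding eq ..
  also have "\<dots> = (LINT y|\<kappa>. LINT x|lborel. E (x - y) * FT \<phi> x)"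
    using Fubini_integral[OF int] by simp
  also have "\<dots> = (LINT \<xi>|lborel. LINT y|\<kappa>. 1 * (FT E \<xi> * \<phi> \<xi>) * cis (- 2 * pi * (y \<bullet> \<xi>)))"
    unfolding inner using integral_swap_bounded[OF one intE\<phi> kk nn] by simp
  finally show "?L = ?R" unfolding eq2 .
qed


section \<open>Mixtures of heat kernels\<close>

lemma FT_gauss_one: "FT (gauss 1) (0::'a::euclidean_space) = of_real (gauss_mass TYPE('a))"
proof -
  have "FT (gauss 1) (0::'a) = of_real (LINT x|lborel. exp (- (pi * 1 * (norm (x::'a))\<^sup>2)))"
    using gauss_of_real[of 1, where ?'a='a] by (simp add: FT_def)
  moreover have "(LINT x|lborel. exp (- (pi * 1 * (norm (x::'a))\<^sup>2))) \<ge> 0"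
    by (intro integral_nonneg_AE) auto
  ultimately show ?thesis by (simp add: gauss_mass_def del: mult_1_right)
qed

definition std_gauss :: "'a::euclidean_space measure" where
  "std_gauss = density lborel (\<lambda>z. ennreal (exp (- (pi * (norm z)\<^sup>2)) / gauss_mass TYPE('a)))"

lemma sets_std_gauss [simp, measurable_cong]: "sets std_gauss = sets borel"
  by (simp add: std_gauss_def)

lemma prob_space_std_gauss: "prob_space (std_gauss :: 'a::euclidean_space measure)"
proof (rule prob_spaceI)
  let ?K = "gauss_mass TYPE('a)"
  have K: "?K > 0" by (rule gauss_mass_pos)
  have "emeasure (std_gauss :: 'a measure) (space std_gauss) = (\<integral>\<^sup>+ z. ennreal (1 / ?K) * ennreal (norm (gauss 1 (z::'a)) powr 1) \<partial>lborel)"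
    using K unfolding std_gauss_def
    by (subst emeasure_density) (auto simp: norm_gauss ennreal_mult[symmetric])
  also have "\<dots> = ennreal (1 / ?K) * (\<integral>\<^sup>+ z. ennreal (norm (gauss 1 (z::'a)) powr 1) \<partial>lborel)"
    by (rule nn_integral_cmult) measurable
  also have "\<dots> = 1"
    using K by (subst nn_integral_norm_gauss_powr) (auto simp: ennreal_mult[symmetric])
  finally show "emeasure (std_gauss :: 'a measure) (space std_gauss) = 1" .
qed

lemma std_gauss_characteristic:
  "(LINT z|std_gauss. cis (- 2 * pi * (z \<bullet> (\<xi>::'a::euclidean_space)))) = of_real (exp (- (pi * (norm \<xi>)\<^sup>2)))"
proof -
  let ?K = "gauss_mass TYPE('a)"
  have K: "?K > 0" by (rule gauss_mass_pos)
  have "(LINT z|std_gauss. cis (- 2 * pi * (z \<bullet> \<xi>))) = (LINT z|lborel. (exp (- (pi * (norm z)\<^sup>2)) / ?K) *\<^sub>R cis (- 2 * pi * (z \<bullet> \<xi>)))"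
    using K unfolding std_gauss_def by (subst integral_density) auto
  also have "\<dots> = (LINT z|lborel. (1 / of_real ?K) * (gauss 1 z * cis (- 2 * pi * (z \<bullet> \<xi>))))"
    using gauss_of_real[of 1, where ?'a='a]
    by (intro Bochner_Integration.integral_cong refl) (simp add: scaleR_conv_of_real)
  also have "\<dots> = (1 / of_real ?K) * FT (gauss 1) \<xi>"
    by (subst integral_mult_right_zero) (simp add: FT_def)
  also have "FT (gauss 1) \<xi> = of_real ?K * gauss 1 \<xi>"
    using FT_gauss[of 1 \<xi>] by (simp add: FT_gauss_one)
  finally show ?thesis using K gauss_of_real[of 1 \<xi>] by simp
qed

text \<open>The law of \<open>sqrt (4 * pi * t)\<close> times a standard Gaussian is the heat kernel
  at time \<open>t\<close>, with Fourier multiplier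
  \<open>exp (- (4 * pi\<^sup>2 * t * (norm \<xi>)\<^sup>2))\<close>; it is averaged over times
  distributed by \<rho>. The absolute value makes the map total; each \<rho> inserted below is
  concentrated on \<open>t \<ge> 0\<close>.\<close>

definition heat_mix :: "real measure \<Rightarrow> 'a::euclidean_space measure" where
  "heat_mix \<rho> = distr (\<rho> \<Otimes>\<^sub>M std_gauss) borel (\<lambda>(t, z). sqrt (4 * pi * \<bar>t\<bar>) *\<^sub>R z)"

lemma sets_heat_mix [simp, measurable_cong]: "sets (heat_mix \<rho>) = sets borel"
  by (simp add: heat_mix_def)

lemma
  assumes "finite_measure \<rho>" and [measurable_cong]: "sets \<rho> = sets borel"
  shows finite_measure_heat_mix: "finite_measure (heat_mix \<rho> :: 'a::euclidean_space measure)"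
    and measure_heat_mix: "measure (heat_mix \<rho> :: 'a measure) UNIV = measure \<rho> UNIV"
    and heat_mix_characteristic: "(LINT y|heat_mix \<rho>. cis (- 2 * pi * (y \<bullet> (\<xi>::'a))))
       = of_real (LINT t|\<rho>. exp (- (4 * pi\<^sup>2 * \<bar>t\<bar> * (norm \<xi>)\<^sup>2)))"
proof -
  interpret R: finite_measure \<rho> by fact
  interpret G: prob_space "std_gauss :: 'a measure" by (rule prob_space_std_gauss)
  interpret P: pair_sigma_finite \<rho> "std_gauss :: 'a measure" by standard
  interpret Q: finite_measure "\<rho> \<Otimes>\<^sub>M (std_gauss :: 'a measure)"
    using G.emeasure_pair_measure_Times[OF sets.top sets.top, of \<rho>] G.emeasure_space_1
    by (intro finite_measureI) (simp add: space_pair_measure)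
  have sp: "space \<rho> = UNIV" using sets_eq_imp_space_eq[of \<rho> borel] by (simp add: assms)
  have spG: "space (std_gauss :: 'a measure) = UNIV" by (simp add: std_gauss_def)
  have [measurable]: "(\<lambda>(t, z). sqrt (4 * pi * \<bar>t\<bar>) *\<^sub>R z) \<in> (\<rho> \<Otimes>\<^sub>M (std_gauss :: 'a measure)) \<rightarrow>\<^sub>M borel"
    by measurable
  show "finite_measure (heat_mix \<rho> :: 'a measure)"
    unfolding heat_mix_def by (rule Q.finite_measure_distr) measurable
  have "emeasure (heat_mix \<rho> :: 'a measure) UNIV = emeasure \<rho> UNIV"
    unfolding heat_mix_def
    using G.emeasure_pair_measure_Times[OF sets.top sets.top, of \<rho>] G.emeasure_space_1
    by (subst emeasure_distr) (auto simp: space_pair_measure sp spG)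
  then show "measure (heat_mix \<rho> :: 'a measure) UNIV = measure \<rho> UNIV"
    by (simp add: measure_def)
  have int: "integrable (\<rho> \<Otimes>\<^sub>M (std_gauss :: 'a measure)) (\<lambda>(t, z). cis (- 2 * pi * ((sqrt (4 * pi * \<bar>t\<bar>) *\<^sub>R z) \<bullet> \<xi>)))"
    by (rule Q.integrable_const_bound[of _ 1]) (auto simp: case_prod_beta)
  have "(LINT y|heat_mix \<rho>. cis (- 2 * pi * (y \<bullet> \<xi>)))
      = (LINT p|(\<rho> \<Otimes>\<^sub>M std_gauss). (case p of (t, z) \<Rightarrow> cis (- 2 * pi * ((sqrt (4 * pi * \<bar>t\<bar>) *\<^sub>R z) \<bullet> \<xi>))))"
    unfolding heat_mix_def
    by (rule trans[OF integral_distr], measurable, rule Bochner_Integration.integral_cong[OF refl], auto)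
  also have "\<dots> = (LINT t|\<rho>. LINT z|std_gauss. cis (- 2 * pi * ((sqrt (4 * pi * \<bar>t\<bar>) *\<^sub>R z) \<bullet> \<xi>)))"
    using P.integral_fst'[OF int] by simp
  also have "\<dots> = (LINT t|\<rho>. of_real (exp (- (4 * pi\<^sup>2 * \<bar>t\<bar> * (norm \<xi>)\<^sup>2))))"
  proof (rule Bochner_Integration.integral_cong[OF refl])
    fix t
    show "(LINT z|std_gauss. cis (- 2 * pi * ((sqrt (4 * pi * \<bar>t\<bar>) *\<^sub>R z) \<bullet> \<xi>))) = of_real (exp (- (4 * pi\<^sup>2 * \<bar>t\<bar> * (norm \<xi>)\<^sup>2)))"
      using std_gauss_characteristic[of "sqrt (4 * pi * \<bar>t\<bar>) *\<^sub>R \<xi>"]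
      by (simp add: power_mult_distrib power2_eq_square mult_ac)
  qed
  finally show "(LINT y|heat_mix \<rho>. cis (- 2 * pi * (y \<bullet> \<xi>))) = of_real (LINT t|\<rho>. exp (- (4 * pi\<^sup>2 * \<bar>t\<bar> * (norm \<xi>)\<^sup>2)))"
    by simp
qed

section \<open>The subordination formula for a fractional power\<close>

lemma nn_integral_powr_exp:
  assumes a: "a > (0::real)" and l: "l > 0"
  shows "(\<integral>\<^sup>+ t. ennreal (indicator {0..} t * t powr (a - 1) * exp (- (l * t))) \<partial>lborel) = ennreal (Gamma a * l powr (- a))"
proof -
  have "ennreal (Gamma a) = (\<integral>\<^sup>+ t. ennreal (indicator {0..} t * t powr (a - 1) / exp t) \<partial>lborel)"
    using Gamma_conv_nn_integral_real[OF a] .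
  also have "\<dots> = ennreal \<bar>l\<bar> * (\<integral>\<^sup>+ t. ennreal (indicator {0..} (0 + l * t) * (0 + l * t) powr (a - 1) / exp (0 + l * t)) \<partial>lborel)"
    using l by (intro nn_integral_real_affine) auto
  also have "\<dots> = (\<integral>\<^sup>+ t. ennreal (l powr a) * ennreal (indicator {0..} t * t powr (a - 1) * exp (- (l * t))) \<partial>lborel)"
  proof (subst nn_integral_cmult[symmetric], measurable, intro nn_integral_cong)
    fix t
    show "ennreal \<bar>l\<bar> * ennreal (indicator {0..} (0 + l * t) * (0 + l * t) powr (a - 1) / exp (0 + l * t))
      = ennreal (l powr a) * ennreal (indicator {0..} t * t powr (a - 1) * exp (- (l * t)))"
      using l by (cases "t \<ge> 0")
        (auto simp: ennreal_mult[symmetric] powr_mult powr_diff exp_minus field_simps zero_le_mult_iff indicator_def)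
  qed
  also have "\<dots> = ennreal (l powr a) * (\<integral>\<^sup>+ t. ennreal (indicator {0..} t * t powr (a - 1) * exp (- (l * t))) \<partial>lborel)"
    by (rule nn_integral_cmult) measurable
  finally have eq: "ennreal (Gamma a) = ennreal (l powr a) * (\<integral>\<^sup>+ t. ennreal (indicator {0..} t * t powr (a - 1) * exp (- (l * t))) \<partial>lborel)" .
  have "ennreal (Gamma a * l powr (- a)) = ennreal (l powr (- a)) * ennreal (Gamma a)"
    using a by (simp add: ennreal_mult[symmetric] less_imp_le mult.commute)
  also have "\<dots> = (\<integral>\<^sup>+ t. ennreal (indicator {0..} t * t powr (a - 1) * exp (- (l * t))) \<partial>lborel)"
    unfolding eq mult.assoc[symmetric] using l by (simp add: ennreal_mult[symmetric] powr_minus)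
  finally show ?thesis ..
qed

text \<open>The starting point writes
  \<open>Gamma (1 - \<sigma> / 2) * l powr (\<sigma> / 2)\<close> as \<open>l\<close> times the
  integral of \<open>t powr (- \<sigma> / 2) * exp (- (l * t))\<close> over
  \<open>t \<ge> 0\<close>. After time \<tau> an integration by parts removes the prefactor
  \<open>l\<close>. When \<open>l\<close> is the symbol of 1 - Laplacian, the extra second-order
  operator therefore falls on short times alone, where the integral is only of size
  \<open>\<tau> powr (1 - \<sigma> / 2)\<close>.\<close>

lemma
  assumes sg: "0 \<le> \<sigma>" "\<sigma> < 2" and l: "l > (0::real)" and \<tau>: "\<tau> > 0"
  shows integrable_heat_small: "integrable lborel (\<lambda>t. indicator {0..<\<tau>} t * t powr (- \<sigma> / 2) * exp (- (l * t)))"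
    and integrable_heat_large: "integrable lborel (\<lambda>t. indicator {\<tau>..} t * (\<sigma> / 2 * t powr (- \<sigma> / 2 - 1)) * exp (- (l * t)))"
    and powr_heat_representation:
      "Gamma (1 - \<sigma> / 2) * l powr (\<sigma> / 2) = l * (LINT t|lborel. indicator {0..<\<tau>} t * t powr (- \<sigma> / 2) * exp (- (l * t)))
         + \<tau> powr (- \<sigma> / 2) * exp (- (l * \<tau>))
         - (LINT t|lborel. indicator {\<tau>..} t * (\<sigma> / 2 * t powr (- \<sigma> / 2 - 1)) * exp (- (l * t)))"
    and heat_large_le: "(LINT t|lborel. indicator {\<tau>..} t * (\<sigma> / 2 * t powr (- \<sigma> / 2 - 1)) * exp (- (l * t))) \<le> \<tau> powr (- \<sigma> / 2)"
    and heat_small_le: "(LINT t|lborel. indicator {0..<\<tau>} t * t powr (- \<sigma> / 2) * exp (- (l * t)))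
         \<le> exp 1 * Gamma (1 - \<sigma> / 2) * \<tau> powr (1 - \<sigma> / 2)"
proof -
  let ?a = "1 - \<sigma> / 2"
  let ?h = "\<lambda>l t. indicator {0..} t * t powr (- \<sigma> / 2) * exp (- (l * t)) :: real"
  let ?h1 = "\<lambda>t. indicator {0..<\<tau>} t * t powr (- \<sigma> / 2) * exp (- (l * t)) :: real"
  let ?h2 = "\<lambda>t. indicator {\<tau>..} t * t powr (- \<sigma> / 2) * exp (- (l * t)) :: real"
  let ?h3 = "\<lambda>t. indicator {\<tau>..} t * (\<sigma> / 2 * t powr (- \<sigma> / 2 - 1)) * exp (- (l * t)) :: real"
  have a: "?a > 0" using sg by simp
  have hb: "has_bochner_integral lborel (?h l) (Gamma ?a * l powr (- ?a))" if "l > 0" for l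
    using nn_integral_powr_exp[OF a that] a
    by (intro has_bochner_integral_nn_integral) (auto intro!: mult_nonneg_nonneg simp: less_imp_le)
  have int: "integrable lborel (?h l)" using hb[OF l] by (rule integrable.intros)
  show int1: "integrable lborel ?h1"
    by (rule Bochner_Integration.integrable_bound[OF int]) (auto simp: indicator_def)
  have int2: "integrable lborel ?h2"
    using \<tau> by (intro Bochner_Integration.integrable_bound[OF int]) (auto simp: indicator_def)
  \<comment> \<open>The derivative of \<open>?F\<close> is the sum of the two tail integrands, so
    the fundamental theorem on the half-line is exactly the integration by parts.\<close>
  let ?F = "\<lambda>t. - (t powr (- \<sigma> / 2) * exp (- (l * t)))"
  have "(\<integral>\<^sup>+ t. ennreal (\<sigma> / 2 * t powr (- \<sigma> / 2 - 1) * exp (- (l * t)) + l * (t powr (- \<sigma> / 2) * exp (- (l * t)))) * indicator {\<tau>..} t \<partial>lborel) = ennreal (0 - ?F \<tau>)"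
  proof (rule nn_integral_FTC_atLeast)
    fix t assume t: "\<tau> \<le> t"
    show "(?F has_real_derivative \<sigma> / 2 * t powr (- \<sigma> / 2 - 1) * exp (- (l * t)) + l * (t powr (- \<sigma> / 2) * exp (- (l * t)))) (at t)"
      using t \<tau> by (auto intro!: derivative_eq_intros simp: powr_diff field_simps)
    show "0 \<le> \<sigma> / 2 * t powr (- \<sigma> / 2 - 1) * exp (- (l * t)) + l * (t powr (- \<sigma> / 2) * exp (- (l * t)))"
      using sg l by (intro add_nonneg_nonneg mult_nonneg_nonneg) auto
  next
    show "(?F \<longlongrightarrow> 0) at_top"
    proof (rule Lim_null_comparison[where g="\<lambda>t. \<tau> powr (- \<sigma> / 2) * exp (- (l * t))"])
      show "\<forall>\<^sub>F t in at_top. norm (?F t) \<le> \<tau> powr (- \<sigma> / 2) * exp (- (l * t))"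
        using eventually_ge_at_top[of \<tau>]
      proof eventually_elim
        case (elim t)
        then show ?case using \<tau> sg by (auto intro!: powr_mono2')
      qed
      have "((\<lambda>t. exp (- (l * t))) \<longlongrightarrow> 0) at_top"
        using l by (intro filterlim_compose[OF exp_at_bot] filterlim_compose[OF filterlim_uminus_at_bot_at_top]
            filterlim_tendsto_pos_mult_at_top[OF tendsto_const] filterlim_ident)
      then show "((\<lambda>t. \<tau> powr (- \<sigma> / 2) * exp (- (l * t))) \<longlongrightarrow> 0) at_top"
        by (rule tendsto_mult_right_zero)
    qed
  qed measurable
  then have hb3: "has_bochner_integral lborel (\<lambda>t. ?h3 t + l * ?h2 t) (\<tau> powr (- \<sigma> / 2) * exp (- (l * \<tau>)))"
    using sg l
    by (intro has_bochner_integral_nn_integral)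
       (auto intro!: add_nonneg_nonneg mult_nonneg_nonneg simp: indicator_def if_distrib cong: if_cong
         elim!: back_subst[where P="\<lambda>x. x = _"] intro!: nn_integral_cong)
  have "integrable lborel (\<lambda>t. (?h3 t + l * ?h2 t) - l * ?h2 t)"
    using integrable.intros[OF hb3] int2 by (intro Bochner_Integration.integrable_diff) auto
  then show int3: "integrable lborel ?h3" by simp
  have i3: "(LINT t|lborel. ?h3 t) + l * (LINT t|lborel. ?h2 t) = \<tau> powr (- \<sigma> / 2) * exp (- (l * \<tau>))"
    using has_bochner_integral_integral_eq[OF hb3] int2 int3 by simp
  have "?h l t = ?h1 t + ?h2 t" for t using \<tau> by (auto simp: indicator_def)
  then have "(LINT t|lborel. ?h l t) = (LINT t|lborel. ?h1 t) + (LINT t|lborel. ?h2 t)"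
    using int1 int2 by simp
  then have i1: "(LINT t|lborel. ?h1 t) + (LINT t|lborel. ?h2 t) = Gamma ?a * l powr (- ?a)"
    using has_bochner_integral_integral_eq[OF hb[OF l]] by simp
  have "Gamma ?a * l powr (\<sigma> / 2) = l * (Gamma ?a * l powr (- ?a))"
    using l powr_add[of l 1 "- ?a"] by simp
  also have "\<dots> = l * (LINT t|lborel. ?h1 t) + l * (LINT t|lborel. ?h2 t)"
    unfolding i1[symmetric] by (simp add: distrib_left)
  finally show "Gamma ?a * l powr (\<sigma> / 2) = l * (LINT t|lborel. ?h1 t) + \<tau> powr (- \<sigma> / 2) * exp (- (l * \<tau>)) - (LINT t|lborel. ?h3 t)"
    using i3 by simp
  have "(LINT t|lborel. ?h2 t) \<ge> 0" by (intro integral_nonneg_AE) auto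
  then have "l * (LINT t|lborel. ?h2 t) \<ge> 0" using l by (intro mult_nonneg_nonneg) auto
  then have "(LINT t|lborel. ?h3 t) \<le> \<tau> powr (- \<sigma> / 2) * exp (- (l * \<tau>))"
    using i3 by linarith
  also have "\<dots> \<le> \<tau> powr (- \<sigma> / 2)" using l \<tau> by (simp add: mult_left_le)
  finally show "(LINT t|lborel. ?h3 t) \<le> \<tau> powr (- \<sigma> / 2)" .
  have t1: "1 / \<tau> > 0" using \<tau> by simp
  \<comment> \<open>Before \<tau> one has
    \<open>exp (- (l * t)) \<le> 1 \<le> exp 1 * exp (- (t / \<tau>))\<close>, which allows
    comparison with the full Gamma integral at parameter \<open>1 / \<tau>\<close>. This is the
    origin of the factor \<open>exp 1\<close>.\<close>
  have "(LINT t|lborel. ?h1 t) \<le> (LINT t|lborel. exp 1 * ?h (1 / \<tau>) t)"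
  proof (rule integral_mono[OF int1])
    show "integrable lborel (\<lambda>t. exp 1 * ?h (1 / \<tau>) t)"
      using hb[OF t1] by (intro integrable_mult_right integrable.intros)
    fix t
    show "?h1 t \<le> exp 1 * ?h (1 / \<tau>) t"
    proof (cases "0 \<le> t \<and> t < \<tau>")
      case True
      have "exp (- (l * t)) \<le> 1" using l True by simp
      also have "\<dots> \<le> exp 1 * exp (- (1 / \<tau> * t))"
        using True \<tau> by (simp add: exp_add[symmetric] field_simps)
      finally have "t powr (- \<sigma> / 2) * exp (- (l * t)) \<le> t powr (- \<sigma> / 2) * (exp 1 * exp (- (1 / \<tau> * t)))"
        by (intro mult_left_mono) auto
      then show ?thesis using True by (simp add: mult_ac)
    qed (auto simp: indicator_def)
  qed
  also have "\<dots> = exp 1 * (Gamma ?a * (1 / \<tau>) powr (- ?a))"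
    using has_bochner_integral_integral_eq[OF hb[OF t1]] by simp
  also have "\<dots> = exp 1 * Gamma ?a * \<tau> powr ?a"
  proof -
    have "(1 / \<tau>) powr (- a) = \<tau> powr a" for a using \<tau> by (simp add: powr_divide powr_minus)
    then show ?thesis by (simp only: mult.assoc)
  qed
  finally show "(LINT t|lborel. ?h1 t) \<le> exp 1 * Gamma ?a * \<tau> powr ?a" .
qed


section \<open>Fractional Sobolev norms from two integer orders\<close>

lemma powr_norm_add3_le:
  fixes a b c :: complex
  assumes "u \<ge> 0"
  shows "norm (a + b - c) powr u \<le> 3 powr u * (norm a powr u + norm b powr u + norm c powr u)"
proof -
  let ?m = "max (norm a) (max (norm b) (norm c))"
  have "norm (a + b - c) \<le> norm a + norm b + norm c"
    by (meson add_mono norm_triangle_ineq norm_triangle_ineq4 order_refl order_trans)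
  also have "\<dots> \<le> 3 * ?m" by linarith
  finally have "norm (a + b - c) powr u \<le> (3 * ?m) powr u"
    using assms by (intro powr_mono2) auto
  also have "\<dots> = 3 powr u * ?m powr u" by (simp add: powr_mult le_max_iff_disj)
  also have "?m powr u \<le> norm a powr u + norm b powr u + norm c powr u"
    by (auto simp: max_def)
  finally show ?thesis by (simp add: mult_left_mono)
qed

lemma schwartz_imp_rapid:
  fixes \<phi> :: "'a::euclidean_space \<Rightarrow> complex"
  assumes "schwartz \<phi>" shows "rapid \<phi>"
proof -
  obtain D :: "'a list \<Rightarrow> 'a \<Rightarrow> complex" where D: "D [] = \<phi>" "\<forall>ds \<in> lists Basis. continuous_on UNIV (D ds)"
    "\<forall>ds \<in> lists Basis. \<forall>N::nat. \<exists>C. \<forall>x. (1 + norm x) ^ N * norm (D ds x) \<le> C"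
    using assms unfolding schwartz_def by blast
  have "continuous_on UNIV (D [])" "\<forall>N::nat. \<exists>C. \<forall>x. (1 + norm x) ^ N * norm (D [] x) \<le> C"
    using D(2,3) lists.Nil by blast+
  then show "rapid \<phi>" unfolding rapid_def D(1) by (auto intro: borel_measurable_continuous_onI)
qed

lemma rapid_bounded:
  assumes "rapid f" obtains B where "\<And>x. norm (f x) \<le> B"
  using rapid_bound[OF assms, of 0] by (metis inverse_1 mult.right_neutral power_0)

lemma Lp_norm_le:
  assumes "(\<integral>\<^sup>+ x. ennreal (norm (f x) powr p) \<partial>lborel) \<le> ennreal X" "X \<ge> 0" "p > 0"
  shows "Lp_norm p f \<le> ennreal (X powr (1 / p))"
proof -
  let ?I = "\<integral>\<^sup>+ x. ennreal (norm (f x) powr p) \<partial>lborel"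
  have "?I < top" using assms(1) by (simp add: order_le_less_trans)
  then have "?I \<noteq> top" by simp
  moreover have "enn2real ?I \<le> X" using assms(1,2) by (rule enn2real_leI[rotated])
  ultimately show ?thesis
    using assms(3) unfolding Lp_norm_def enn_root_def by (auto intro!: ennreal_leI powr_mono2)
qed

text \<open>Interpolation between the orders \<open>2 * M\<close> and \<open>2 * M + 2\<close>:
  \<open>E0\<close> and \<open>E1\<close> stand for the powers \<open>M\<close> and
  \<open>M + 1\<close> of 1 - Laplacian applied to \<open>F\<close>, of sizes \<open>Y\<close> and
  \<open>W\<^sup>2 * Y\<close>. As \<open>sobolev_norm\<close> is an infimum, it suffices to exhibit
  one admissible function \<open>G\<close>, here the subordination integral realised by
  convolutions.\<close>

lemma sobolev_norm_le_aux:
  fixes F E0 E1 :: "'a::euclidean_space \<Rightarrow> complex"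
  assumes u: "u \<ge> 1" and sg: "0 \<le> \<sigma>" "\<sigma> < 2" and W: "W \<ge> 1" and Y: "Y \<ge> 0"
    and F: "rapid F" and E0: "rapid E0" and E1: "rapid E1"
    and FE0: "\<And>\<xi>. FT E0 \<xi> = of_real ((1 + 4 * pi\<^sup>2 * (norm \<xi>)\<^sup>2) ^ M) * FT F \<xi>"
    and FE1: "\<And>\<xi>. FT E1 \<xi> = of_real ((1 + 4 * pi\<^sup>2 * (norm \<xi>)\<^sup>2) ^ Suc M) * FT F \<xi>"
    and Y0: "(\<integral>\<^sup>+ x. ennreal (norm (E0 x) powr u) \<partial>lborel) \<le> ennreal (Y powr u)"
    and Y1: "(\<integral>\<^sup>+ x. ennreal (norm (E1 x) powr u) \<partial>lborel) \<le> ennreal ((W\<^sup>2 * Y) powr u)"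
  shows "sobolev_norm u (2 * real M + \<sigma>) F
    \<le> ennreal (3 / Gamma (1 - \<sigma> / 2) * ((exp 1 * Gamma (1 - \<sigma> / 2)) powr u + 2) powr (1 / u) * W powr \<sigma> * Y)"
proof -
  let ?\<Gamma> = "Gamma (1 - \<sigma> / 2)"
  have \<Gamma>: "?\<Gamma> > 0" using sg by simp
  \<comment> \<open>The time at which the bounds balance: short times contribute mass
    \<open>W powr (\<sigma> - 2)\<close> against \<open>W\<^sup>2 * Y\<close>, long times contribute
    mass \<open>W powr \<sigma>\<close> against \<open>Y\<close>.\<close>
  define \<tau> where "\<tau> = W powr (- 2)"
  have \<tau>: "\<tau> > 0" using W by (simp add: \<tau>_def)
  have \<tau>p: "\<tau> powr (- \<sigma> / 2) = W powr \<sigma>" "\<tau> powr (1 - \<sigma> / 2) = W powr (\<sigma> - 2)"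
    unfolding \<tau>_def by (simp_all add: powr_powr algebra_simps)
  have dens: "finite_measure (density lborel (\<lambda>t. ennreal (g t)))"
    "measure (density lborel (\<lambda>t. ennreal (g t))) UNIV = (LINT t|lborel. g t)"
    if g: "integrable lborel g" "\<And>t. 0 \<le> g t" for g :: "real \<Rightarrow> real"
  proof -
    have [measurable]: "g \<in> borel_measurable borel" using borel_measurable_integrable[OF g(1)] by simp
    have e: "emeasure (density lborel (\<lambda>t. ennreal (g t))) UNIV = ennreal (LINT t|lborel. g t)"
      using nn_integral_eq_integral[OF g(1)] g(2) by (subst emeasure_density) auto
    show "finite_measure (density lborel (\<lambda>t. ennreal (g t)))"
      by (rule finite_measureI) (simp add: e)
    show "measure (density lborel (\<lambda>t. ennreal (g t))) UNIV = (LINT t|lborel. g t)"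
      using e g(2) by (simp add: measure_def integral_nonneg_AE)
  qed
  \<comment> \<open>The densities are taken at \<open>l = 1\<close>: the summand 1 of the symbol
    \<open>1 + 4 * pi\<^sup>2 * (norm \<xi>)\<^sup>2\<close> becomes the weight
    \<open>exp (- t)\<close>, and the heat kernels supply the rest.\<close>
  let ?g1 = "\<lambda>t. indicator {0..<\<tau>} t * t powr (- \<sigma> / 2) * exp (- (1 * t)) :: real"
  let ?g3 = "\<lambda>t. indicator {\<tau>..} t * (\<sigma> / 2 * t powr (- \<sigma> / 2 - 1)) * exp (- (1 * t)) :: real"
  define \<rho>1 where "\<rho>1 = density lborel (\<lambda>t. ennreal (?g1 t))"
  define \<rho>2 where "\<rho>2 = return (borel :: real measure) \<tau>"
  define \<rho>3 where "\<rho>3 = density lborel (\<lambda>t. ennreal (?g3 t))"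
  have g1: "integrable lborel ?g1" "\<And>t. 0 \<le> ?g1 t"
    using integrable_heat_small[OF sg zero_less_one \<tau>] by auto
  have g3: "integrable lborel ?g3" "\<And>t. 0 \<le> ?g3 t"
    using integrable_heat_large[OF sg zero_less_one \<tau>] sg by auto
  have f1: "finite_measure \<rho>1" and f3: "finite_measure \<rho>3"
    unfolding \<rho>1_def \<rho>3_def using dens(1)[OF g1] dens(1)[OF g3] by auto
  have f2: "finite_measure \<rho>2"
    unfolding \<rho>2_def by (intro prob_space.finite_measure prob_space_return) simp
  have s: "sets \<rho>1 = sets borel" "sets \<rho>2 = sets borel" "sets \<rho>3 = sets borel"
    by (simp_all add: \<rho>1_def \<rho>2_def \<rho>3_def)
  let ?\<kappa>1 = "heat_mix \<rho>1 :: 'a measure" and ?\<kappa>2 = "heat_mix \<rho>2 :: 'a measure" and ?\<kappa>3 = "heat_mix \<rho>3 :: 'a measure"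
  note fk1 = finite_measure_heat_mix[OF f1 s(1), where ?'a='a]
  note fk2 = finite_measure_heat_mix[OF f2 s(2), where ?'a='a]
  note fk3 = finite_measure_heat_mix[OF f3 s(3), where ?'a='a]
  have m1: "measure ?\<kappa>1 UNIV \<le> exp 1 * ?\<Gamma> * W powr (\<sigma> - 2)"
    using heat_small_le[OF sg zero_less_one \<tau>] dens(2)[OF g1, folded \<rho>1_def]
    by (simp only: measure_heat_mix[OF f1 s(1)] \<tau>p)
  have m2: "measure ?\<kappa>2 UNIV = 1"
    unfolding measure_heat_mix[OF f2 s(2)] by (simp add: \<rho>2_def measure_return)
  have m3: "measure ?\<kappa>3 UNIV \<le> W powr \<sigma>"
    using heat_large_le[OF sg zero_less_one \<tau>] dens(2)[OF g3, folded \<rho>3_def]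
    by (simp only: measure_heat_mix[OF f3 s(3)] \<tau>p)
  let ?c2 = "\<tau> powr (- \<sigma> / 2) * exp (- \<tau>)"
  \<comment> \<open>Mirrors the three terms of \<open>powr_heat_representation\<close>: short times
    act on \<open>E1\<close>, the boundary term and the long times act on \<open>E0\<close>.\<close>
  define G where "G x = of_real (1 / ?\<Gamma>) * (mconv ?\<kappa>1 E1 x + of_real ?c2 * mconv ?\<kappa>2 E0 x - mconv ?\<kappa>3 E0 x)" for x
  note [measurable] = rapid_measurable[OF E0] rapid_measurable[OF E1]
    mconv_measurable[OF fk1 sets_heat_mix] mconv_measurable[OF fk2 sets_heat_mix] mconv_measurable[OF fk3 sets_heat_mix]
  have Gm: "G \<in> borel_measurable lborel" unfolding G_def[abs_def] by measurable
  obtain B0 B1 where B: "\<And>x. norm (E0 x) \<le> B0" "\<And>x. norm (E1 x) \<le> B1"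
    using rapid_bounded[OF E0] rapid_bounded[OF E1] by metis
  have W0: "W > 0" using W by simp
  have n1: "(\<integral>\<^sup>+ x. ennreal (norm (mconv ?\<kappa>1 E1 x) powr u) \<partial>lborel) \<le> ennreal ((exp 1 * ?\<Gamma>) powr u * (W powr \<sigma> * Y) powr u)"
  proof -
    have "(\<integral>\<^sup>+ x. ennreal (norm (mconv ?\<kappa>1 E1 x) powr u) \<partial>lborel) \<le> ennreal (measure ?\<kappa>1 UNIV powr u) * ennreal ((W\<^sup>2 * Y) powr u)"
      using nn_integral_mconv_powr_le[OF fk1 sets_heat_mix rapid_measurable[OF E1] B(2) u]
      by (rule order_trans) (intro mult_left_mono Y1 zero_le)
    also have "\<dots> \<le> ennreal ((exp 1 * ?\<Gamma> * W powr (\<sigma> - 2)) powr u * (W\<^sup>2 * Y) powr u)"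
      using m1 u by (subst ennreal_mult[symmetric]) (auto intro!: ennreal_leI mult_right_mono powr_mono2)
    also have "(exp 1 * ?\<Gamma> * W powr (\<sigma> - 2)) powr u * (W\<^sup>2 * Y) powr u = (exp 1 * ?\<Gamma>) powr u * (W powr \<sigma> * Y) powr u"
    proof -
      have "W powr (\<sigma> - 2) * W\<^sup>2 = W powr \<sigma>"
        using W0 by (simp add: powr_diff)
      then have e: "exp 1 * ?\<Gamma> * W powr (\<sigma> - 2) * (W\<^sup>2 * Y) = (exp 1 * ?\<Gamma>) * (W powr \<sigma> * Y)"
        by (simp add: mult_ac)
      have "(exp 1 * ?\<Gamma> * W powr (\<sigma> - 2)) powr u * (W\<^sup>2 * Y) powr u = (exp 1 * ?\<Gamma> * W powr (\<sigma> - 2) * (W\<^sup>2 * Y)) powr u"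
        by (rule powr_mult[symmetric])
      also have "\<dots> = (exp 1 * ?\<Gamma>) powr u * (W powr \<sigma> * Y) powr u"
        unfolding e by (rule powr_mult)
      finally show ?thesis .
    qed
    finally show ?thesis .
  qed
  have n2: "(\<integral>\<^sup>+ x. ennreal (norm (of_real ?c2 * mconv ?\<kappa>2 E0 x) powr u) \<partial>lborel) \<le> ennreal ((W powr \<sigma> * Y) powr u)"
  proof -
    have c2: "?c2 \<le> W powr \<sigma>" unfolding \<tau>p using \<tau> by (simp add: mult_left_le)
    have "(\<integral>\<^sup>+ x. ennreal (norm (of_real ?c2 * mconv ?\<kappa>2 E0 x) powr u) \<partial>lborel)
       = (\<integral>\<^sup>+ x. ennreal (?c2 powr u) * ennreal (norm (mconv ?\<kappa>2 E0 x) powr u) \<partial>lborel)"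
      by (simp add: norm_mult powr_mult ennreal_mult)
    also have "\<dots> = ennreal (?c2 powr u) * (\<integral>\<^sup>+ x. ennreal (norm (mconv ?\<kappa>2 E0 x) powr u) \<partial>lborel)"
      by (rule nn_integral_cmult) measurable
    also have "\<dots> \<le> ennreal (?c2 powr u) * (ennreal (measure ?\<kappa>2 UNIV powr u) * ennreal (Y powr u))"
      using nn_integral_mconv_powr_le[OF fk2 sets_heat_mix rapid_measurable[OF E0] B(1) u]
      by (intro mult_left_mono, elim order_trans) (intro mult_left_mono Y0 zero_le, simp)
    also have "\<dots> \<le> ennreal ((W powr \<sigma>) powr u * Y powr u)"
      using c2 u by (simp add: m2 ennreal_mult[symmetric]) (auto intro!: ennreal_leI mult_right_mono powr_mono2)
    finally show ?thesis using Y by (simp add: powr_mult)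
  qed
  have n3: "(\<integral>\<^sup>+ x. ennreal (norm (mconv ?\<kappa>3 E0 x) powr u) \<partial>lborel) \<le> ennreal ((W powr \<sigma> * Y) powr u)"
  proof -
    have "(\<integral>\<^sup>+ x. ennreal (norm (mconv ?\<kappa>3 E0 x) powr u) \<partial>lborel) \<le> ennreal (measure ?\<kappa>3 UNIV powr u) * ennreal (Y powr u)"
      using nn_integral_mconv_powr_le[OF fk3 sets_heat_mix rapid_measurable[OF E0] B(1) u]
      by (rule order_trans) (intro mult_left_mono Y0 zero_le)
    also have "\<dots> \<le> ennreal ((W powr \<sigma>) powr u * Y powr u)"
      using m3 u by (subst ennreal_mult[symmetric]) (auto intro!: ennreal_leI mult_right_mono powr_mono2)
    finally show ?thesis using Y by (simp add: powr_mult)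
  qed
  let ?X = "(3 / ?\<Gamma>) powr u * (((exp 1 * ?\<Gamma>) powr u + 2) * (W powr \<sigma> * Y) powr u)"
  have "(\<integral>\<^sup>+ x. ennreal (norm (G x) powr u) \<partial>lborel)
    \<le> (\<integral>\<^sup>+ x. ennreal ((3 / ?\<Gamma>) powr u) * (ennreal (norm (mconv ?\<kappa>1 E1 x) powr u)
        + ennreal (norm (of_real ?c2 * mconv ?\<kappa>2 E0 x) powr u) + ennreal (norm (mconv ?\<kappa>3 E0 x) powr u)) \<partial>lborel)"
  proof (rule nn_integral_mono)
    fix x
    let ?a = "mconv ?\<kappa>1 E1 x" and ?b = "of_real ?c2 * mconv ?\<kappa>2 E0 x" and ?d = "mconv ?\<kappa>3 E0 x"
    have "norm (G x) powr u = (1 / ?\<Gamma>) powr u * norm (?a + ?b - ?d) powr u"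
    proof -
      have "norm (complex_of_real (1 / ?\<Gamma>)) = 1 / ?\<Gamma>" using \<Gamma> by (simp only: norm_of_real) simp
      then show ?thesis unfolding G_def norm_mult[of "of_real (1 / ?\<Gamma>)"] by (simp only: powr_mult)
    qed
    also have "\<dots> \<le> (1 / ?\<Gamma>) powr u * (3 powr u * (norm ?a powr u + norm ?b powr u + norm ?d powr u))"
      using u by (intro mult_left_mono powr_norm_add3_le) auto
    also have "\<dots> = (3 / ?\<Gamma>) powr u * (norm ?a powr u + norm ?b powr u + norm ?d powr u)"
      using \<Gamma> by (simp add: powr_divide)
    finally have "ennreal (norm (G x) powr u) \<le> ennreal ((3 / ?\<Gamma>) powr u * (norm ?a powr u + norm ?b powr u + norm ?d powr u))"
      by (rule ennreal_leI)
    then show "ennreal (norm (G x) powr u) \<le> ennreal ((3 / ?\<Gamma>) powr u) * (ennreal (norm ?a powr u)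
        + ennreal (norm ?b powr u) + ennreal (norm ?d powr u))"
      by (simp add: ennreal_mult ennreal_plus)
  qed
  also have "\<dots> = ennreal ((3 / ?\<Gamma>) powr u) * ((\<integral>\<^sup>+ x. ennreal (norm (mconv ?\<kappa>1 E1 x) powr u) \<partial>lborel)
        + (\<integral>\<^sup>+ x. ennreal (norm (of_real ?c2 * mconv ?\<kappa>2 E0 x) powr u) \<partial>lborel) + (\<integral>\<^sup>+ x. ennreal (norm (mconv ?\<kappa>3 E0 x) powr u) \<partial>lborel))"
    by (subst nn_integral_cmult, measurable, subst nn_integral_add, measurable, subst nn_integral_add, measurable)
  also have "\<dots> \<le> ennreal ((3 / ?\<Gamma>) powr u) * (ennreal ((exp 1 * ?\<Gamma>) powr u * (W powr \<sigma> * Y) powr u)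
      + ennreal ((W powr \<sigma> * Y) powr u) + ennreal ((W powr \<sigma> * Y) powr u))"
    by (intro mult_left_mono add_mono n1 n2 n3 zero_le)
  also have "\<dots> = ennreal ?X"
    by (simp add: ennreal_mult[symmetric] ennreal_plus[symmetric] algebra_simps del: ennreal_plus)
  finally have "Lp_norm u G \<le> ennreal (?X powr (1 / u))"
    using u by (intro Lp_norm_le) auto
  also have "?X powr (1 / u) = 3 / ?\<Gamma> * ((exp 1 * ?\<Gamma>) powr u + 2) powr (1 / u) * W powr \<sigma> * Y"
    using u \<Gamma> Y by (simp add: powr_mult powr_powr add_nonneg_nonneg)
  finally have LG: "Lp_norm u G \<le> ennreal (3 / ?\<Gamma> * ((exp 1 * ?\<Gamma>) powr u + 2) powr (1 / u) * W powr \<sigma> * Y)" .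
  have test: "(LINT x|lborel. G x * FT \<phi> x) =
      (LINT \<xi>|lborel. complex_of_real ((1 + 4 * pi\<^sup>2 * (norm \<xi>)\<^sup>2) powr ((2 * real M + \<sigma>) / 2)) * FT F \<xi> * \<phi> \<xi>)"
    if "schwartz \<phi>" for \<phi>
  proof -
    note \<phi> = rapid_integrable[OF schwartz_imp_rapid[OF that]]
    note E0' = rapid_integrable[OF E0] and E1' = rapid_integrable[OF E1]
    note p1 = mconv_FT_pairing[OF fk1 sets_heat_mix E1' \<phi>]
    note p2 = mconv_FT_pairing[OF fk2 sets_heat_mix E0' \<phi>]
    note p3 = mconv_FT_pairing[OF fk3 sets_heat_mix E0' \<phi>]
    let ?k = "\<lambda>\<kappa> \<xi>. LINT y|\<kappa>. cis (- 2 * pi * (y \<bullet> \<xi>))"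
    have "(LINT x|lborel. G x * FT \<phi> x) = (LINT x|lborel. of_real (1 / ?\<Gamma>) *
        (mconv ?\<kappa>1 E1 x * FT \<phi> x + of_real ?c2 * (mconv ?\<kappa>2 E0 x * FT \<phi> x) - mconv ?\<kappa>3 E0 x * FT \<phi> x))"
      by (simp add: G_def algebra_simps)
    also have "\<dots> = of_real (1 / ?\<Gamma>) * ((LINT x|lborel. mconv ?\<kappa>1 E1 x * FT \<phi> x)
       + of_real ?c2 * (LINT x|lborel. mconv ?\<kappa>2 E0 x * FT \<phi> x) - (LINT x|lborel. mconv ?\<kappa>3 E0 x * FT \<phi> x))"
      using p1(1) p2(1) p3(1) by simp
    also have "\<dots> = of_real (1 / ?\<Gamma>) * ((LINT \<xi>|lborel. ?k ?\<kappa>1 \<xi> * FT E1 \<xi> * \<phi> \<xi>)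
       + of_real ?c2 * (LINT \<xi>|lborel. ?k ?\<kappa>2 \<xi> * FT E0 \<xi> * \<phi> \<xi>) - (LINT \<xi>|lborel. ?k ?\<kappa>3 \<xi> * FT E0 \<xi> * \<phi> \<xi>))"
      unfolding p1(3) p2(3) p3(3) ..
    also have "\<dots> = (LINT \<xi>|lborel. of_real (1 / ?\<Gamma>) * (?k ?\<kappa>1 \<xi> * FT E1 \<xi> * \<phi> \<xi>
       + of_real ?c2 * (?k ?\<kappa>2 \<xi> * FT E0 \<xi> * \<phi> \<xi>) - ?k ?\<kappa>3 \<xi> * FT E0 \<xi> * \<phi> \<xi>))"
      using p1(2) p2(2) p3(2) by simp
    also have "\<dots> = (LINT \<xi>|lborel. complex_of_real ((1 + 4 * pi\<^sup>2 * (norm \<xi>)\<^sup>2) powr ((2 * real M + \<sigma>) / 2)) * FT F \<xi> * \<phi> \<xi>)"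
    proof (rule Bochner_Integration.integral_cong[OF refl])
      fix \<xi> :: 'a
      let ?l = "1 + 4 * pi\<^sup>2 * (norm \<xi>)\<^sup>2"
      have l: "?l > 0" by (simp add: add_pos_nonneg)
      let ?A1 = "LINT t|lborel. indicator {0..<\<tau>} t * t powr (- \<sigma> / 2) * exp (- (?l * t))"
      let ?A3 = "LINT t|lborel. indicator {\<tau>..} t * (\<sigma> / 2 * t powr (- \<sigma> / 2 - 1)) * exp (- (?l * t))"
      have k1: "?k ?\<kappa>1 \<xi> = of_real ?A1"
      proof -
        have "(LINT t|\<rho>1. exp (- (4 * pi\<^sup>2 * \<bar>t\<bar> * (norm \<xi>)\<^sup>2))) = (LINT t|lborel. ?g1 t *\<^sub>R exp (- (4 * pi\<^sup>2 * \<bar>t\<bar> * (norm \<xi>)\<^sup>2)))"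
          unfolding \<rho>1_def using g1(2) by (subst integral_density) auto
        also have "\<dots> = ?A1"
          by (intro Bochner_Integration.integral_cong refl) (auto simp: indicator_def exp_add[symmetric] algebra_simps)
        finally show ?thesis by (simp only: heat_mix_characteristic[OF f1 s(1)])
      qed
      have k3: "?k ?\<kappa>3 \<xi> = of_real ?A3"
      proof -
        have "(LINT t|\<rho>3. exp (- (4 * pi\<^sup>2 * \<bar>t\<bar> * (norm \<xi>)\<^sup>2))) = (LINT t|lborel. ?g3 t *\<^sub>R exp (- (4 * pi\<^sup>2 * \<bar>t\<bar> * (norm \<xi>)\<^sup>2)))"
          unfolding \<rho>3_def using g3(2) by (subst integral_density) auto
        also have "\<dots> = ?A3"
          using \<tau> by (intro Bochner_Integration.integral_cong refl) (auto simp: indicator_def exp_add[symmetric] algebra_simps)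
        finally show ?thesis by (simp only: heat_mix_characteristic[OF f3 s(3)])
      qed
      have k2: "?k ?\<kappa>2 \<xi> = of_real (exp (- (4 * pi\<^sup>2 * \<tau> * (norm \<xi>)\<^sup>2)))"
        unfolding heat_mix_characteristic[OF f2 s(2)] unfolding \<rho>2_def using \<tau> by (subst integral_return) auto
      have e2: "?c2 * exp (- (4 * pi\<^sup>2 * \<tau> * (norm \<xi>)\<^sup>2)) = \<tau> powr (- \<sigma> / 2) * exp (- (?l * \<tau>))"
        by (simp add: exp_add[symmetric] algebra_simps)
      \<comment> \<open>The scalar identity behind \<open>G\<close>: the subordination formula at
        the symbol \<open>?l\<close>, divided by the Gamma factor.\<close>
      have r: "(?l * ?A1 + ?c2 * exp (- (4 * pi\<^sup>2 * \<tau> * (norm \<xi>)\<^sup>2)) - ?A3) * (1 / ?\<Gamma>) = ?l powr (\<sigma> / 2)"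
        unfolding e2 powr_heat_representation[OF sg l \<tau>, symmetric] using \<Gamma> by simp
      have alg: "of_real g * (of_real A * (of_real (l ^ Suc M) * f) * p + of_real c * (of_real e * (of_real (l ^ M) * f) * p)
          - of_real B * (of_real (l ^ M) * f) * p) = of_real ((l * A + c * e - B) * g * l ^ M) * f * p"
        for g A l c e B :: real and f p :: complex
        by (simp add: algebra_simps)
      have p: "?l powr ((2 * real M + \<sigma>) / 2) = ?l powr (\<sigma> / 2) * ?l ^ M"
        using l by (simp add: add_divide_distrib powr_add powr_realpow)
      have "of_real (1 / ?\<Gamma>) * (?k ?\<kappa>1 \<xi> * FT E1 \<xi> * \<phi> \<xi> + of_real ?c2 * (?k ?\<kappa>2 \<xi> * FT E0 \<xi> * \<phi> \<xi>) - ?k ?\<kappa>3 \<xi> * FT E0 \<xi> * \<phi> \<xi>)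
        = of_real (((?l * ?A1 + ?c2 * exp (- (4 * pi\<^sup>2 * \<tau> * (norm \<xi>)\<^sup>2)) - ?A3) * (1 / ?\<Gamma>)) * ?l ^ M) * FT F \<xi> * \<phi> \<xi>"
        unfolding k1 k2 k3 FE0 FE1 by (rule alg)
      then show "of_real (1 / ?\<Gamma>) * (?k ?\<kappa>1 \<xi> * FT E1 \<xi> * \<phi> \<xi> + of_real ?c2 * (?k ?\<kappa>2 \<xi> * FT E0 \<xi> * \<phi> \<xi>) - ?k ?\<kappa>3 \<xi> * FT E0 \<xi> * \<phi> \<xi>)
        = complex_of_real (?l powr ((2 * real M + \<sigma>) / 2)) * FT F \<xi> * \<phi> \<xi>"
        unfolding r p .
    qed
    finally show ?thesis .
  qed
  have "sobolev_norm u (2 * real M + \<sigma>) F \<le> Lp_norm u G"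
    unfolding sobolev_norm_def
    using Gm test LG by (intro INF_lower) (auto simp: order_le_less_trans)
  then show ?thesis using LG by (rule order_trans)
qed

section \<open>Derivative bounds\<close>

text \<open>\<open>deriv_bd W U j A f\<close>: all directional derivatives of \<open>f\<close> of order \<open>i \<le> j\<close> exist everywhere
  and are bounded on \<open>U\<close> by \<open>W ^ i * A\<close>.\<close>

fun deriv_bd :: "real \<Rightarrow> 'a::euclidean_space set \<Rightarrow> nat \<Rightarrow> ('a \<Rightarrow> real) \<Rightarrow> ('a \<Rightarrow> complex) \<Rightarrow> bool" where
  "deriv_bd W U 0 A f \<longleftrightarrow> f \<in> borel_measurable borel \<and> (\<forall>x\<in>U. norm (f x) \<le> A x)"
| "deriv_bd W U (Suc j) A f \<longleftrightarrow> f \<in> borel_measurable borel \<and> (\<forall>x\<in>U. norm (f x) \<le> A x) \<and>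
     (\<forall>b\<in>Basis. \<exists>f'. (\<forall>x. ((\<lambda>t. f (x + t *\<^sub>R b)) has_vector_derivative f' x) (at 0)) \<and>
        deriv_bd W U j (\<lambda>x. W * A x) f')"

lemma deriv_bd_measurable: "deriv_bd W U j A f \<Longrightarrow> f \<in> borel_measurable borel"
  by (cases j) auto

lemma deriv_bd_norm_le: "deriv_bd W U j A f \<Longrightarrow> x \<in> U \<Longrightarrow> norm (f x) \<le> A x"
  by (cases j) auto

lemma deriv_bd_SucE:
  assumes "deriv_bd W U (Suc j) A f" "b \<in> Basis"
  obtains f' where "\<And>x. ((\<lambda>t. f (x + t *\<^sub>R b)) has_vector_derivative f' x) (at 0)" "deriv_bd W U j (\<lambda>x. W * A x) f'"
  using assms unfolding deriv_bd.simps by blast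

lemma deriv_bd_mono:
  assumes "deriv_bd W U j A f" "0 \<le> W" "W \<le> W'" "V \<subseteq> U" "\<And>x. x \<in> V \<Longrightarrow> A x \<le> A' x"
  shows "deriv_bd W' V j A' f"
  using assms
proof (induction j arbitrary: A A' f)
  case 0
  then show ?case by (auto intro: order_trans)
next
  case (Suc j)
  have "deriv_bd W' V j (\<lambda>x. W' * A' x) f'" if "deriv_bd W U j (\<lambda>x. W * A x) f'" for f'
  proof (rule Suc.IH[OF that Suc.prems(2,3,4)])
    fix x assume x: "x \<in> V"
    \<comment> \<open>The envelope is nonnegative on \<open>V\<close> because it dominates a norm
      there; this is what permits enlarging \<open>W\<close>.\<close>
    have "0 \<le> A x" using deriv_bd_norm_le[OF Suc.prems(1), of x] x Suc.prems(4) norm_ge_zero order_trans by blast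
    then show "W * A x \<le> W' * A' x" using Suc.prems(2,3) Suc.prems(5)[OF x] by (intro mult_mono) auto
  qed
  then have "\<exists>f'. (\<forall>x. ((\<lambda>t. f (x + t *\<^sub>R b)) has_vector_derivative f' x) (at 0)) \<and> deriv_bd W' V j (\<lambda>x. W' * A' x) f'"
    if "b \<in> Basis" for b
    using deriv_bd_SucE[OF Suc.prems(1) that] by metis
  moreover have "norm (f x) \<le> A' x" if "x \<in> V" for x
    using deriv_bd_norm_le[OF Suc.prems(1), of x] Suc.prems(5)[OF that] Suc.prems(4) that by fastforce
  ultimately show ?case using deriv_bd_measurable[OF Suc.prems(1)] by simp
qed

lemma deriv_bd_Suc_less: "deriv_bd W U (Suc j) A f \<Longrightarrow> deriv_bd W U j A f"
proof (induction j arbitrary: A f)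
  case (Suc j)
  show ?case
    unfolding deriv_bd.simps
  proof (intro conjI ballI)
    fix b :: 'a assume "b \<in> Basis"
    then obtain f' where "\<And>x. ((\<lambda>t. f (x + t *\<^sub>R b)) has_vector_derivative f' x) (at 0)" "deriv_bd W U (Suc j) (\<lambda>x. W * A x) f'"
      using deriv_bd_SucE[OF Suc.prems] by blast
    then show "\<exists>f'. (\<forall>x. ((\<lambda>t. f (x + t *\<^sub>R b)) has_vector_derivative f' x) (at 0)) \<and> deriv_bd W U j (\<lambda>x. W * A x) f'"
      using Suc.IH by blast
  qed (use deriv_bd_norm_le[OF Suc.prems] deriv_bd_measurable[OF Suc.prems] in auto)
qed simp

lemma deriv_bd_add:
  "deriv_bd W U j A f \<Longrightarrow> deriv_bd W U j B g \<Longrightarrow> deriv_bd W U j (\<lambda>x. A x + B x) (\<lambda>x. f x + g x)"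
proof (induction j arbitrary: A B f g)
  case 0
  then show ?case by (auto intro: norm_triangle_mono)
next
  case (Suc j)
  show ?case
    unfolding deriv_bd.simps
  proof (intro conjI ballI)
    fix b :: 'a assume b: "b \<in> Basis"
    obtain f' where f': "\<And>x. ((\<lambda>t. f (x + t *\<^sub>R b)) has_vector_derivative f' x) (at 0)" "deriv_bd W U j (\<lambda>x. W * A x) f'"
      using deriv_bd_SucE[OF Suc.prems(1) b] by blast
    obtain g' where g': "\<And>x. ((\<lambda>t. g (x + t *\<^sub>R b)) has_vector_derivative g' x) (at 0)" "deriv_bd W U j (\<lambda>x. W * B x) g'"
      using deriv_bd_SucE[OF Suc.prems(2) b] by blast
    show "\<exists>h'. (\<forall>x. ((\<lambda>t. f (x + t *\<^sub>R b) + g (x + t *\<^sub>R b)) has_vector_derivative h' x) (at 0)) \<and> deriv_bd W U j (\<lambda>x. W * (A x + B x)) h'"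
      using Suc.IH[OF f'(2) g'(2)] has_vector_derivative_add[OF f'(1) g'(1)]
      by (intro exI[of _ "\<lambda>x. f' x + g' x"]) (auto simp: distrib_left)
  qed (use deriv_bd_norm_le[OF Suc.prems(1)] deriv_bd_norm_le[OF Suc.prems(2)] deriv_bd_measurable[OF Suc.prems(1)]
      deriv_bd_measurable[OF Suc.prems(2)] in \<open>auto intro: norm_triangle_mono\<close>)
qed

text \<open>A crude Leibniz rule: each differentiation doubles the number of terms, all with the
  same envelope, hence \<open>2 ^ j\<close>.\<close>

lemma deriv_bd_mult:
  assumes "0 \<le> W" "deriv_bd W U j A f" "deriv_bd W U j B g"
  shows "deriv_bd W U j (\<lambda>x. 2 ^ j * (A x * B x)) (\<lambda>x. f x * g x)"
  using assms(2,3)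
proof (induction j arbitrary: A B f g)
  case 0
  then show ?case by (auto simp: norm_mult intro!: mult_mono order_trans[OF norm_ge_zero])
next
  case (Suc j)
  have bd: "norm (f x * g x) \<le> 2 ^ Suc j * (A x * B x)" if x: "x \<in> U" for x
  proof -
    have "norm (f x * g x) \<le> A x * B x"
      unfolding norm_mult using deriv_bd_norm_le[OF Suc.prems(1) x] deriv_bd_norm_le[OF Suc.prems(2) x]
      by (intro mult_mono) (auto intro: order_trans[OF norm_ge_zero])
    moreover have "(1::real) \<le> 2 ^ Suc j" by (rule one_le_power) simp
    ultimately have "1 * norm (f x * g x) \<le> 2 ^ Suc j * (A x * B x)"
      by (intro mult_mono) auto
    then show ?thesis by simp
  qed
  show ?case
    unfolding deriv_bd.simps
  proof (intro conjI ballI)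
    fix b :: 'a assume b: "b \<in> Basis"
    obtain f' where f': "\<And>x. ((\<lambda>t. f (x + t *\<^sub>R b)) has_vector_derivative f' x) (at 0)" "deriv_bd W U j (\<lambda>x. W * A x) f'"
      using deriv_bd_SucE[OF Suc.prems(1) b] by blast
    obtain g' where g': "\<And>x. ((\<lambda>t. g (x + t *\<^sub>R b)) has_vector_derivative g' x) (at 0)" "deriv_bd W U j (\<lambda>x. W * B x) g'"
      using deriv_bd_SucE[OF Suc.prems(2) b] by blast
    have "deriv_bd W U j (\<lambda>x. 2 ^ j * (A x * (W * B x)) + 2 ^ j * ((W * A x) * B x)) (\<lambda>x. f x * g' x + f' x * g x)"
      by (intro deriv_bd_add Suc.IH f' g' deriv_bd_Suc_less[OF Suc.prems(1)] deriv_bd_Suc_less[OF Suc.prems(2)])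
    also have "(\<lambda>x. 2 ^ j * (A x * (W * B x)) + 2 ^ j * ((W * A x) * B x)) = (\<lambda>x. W * (2 ^ Suc j * (A x * B x)))"
      by (auto simp: algebra_simps)
    finally show "\<exists>h'. (\<forall>x. ((\<lambda>t. f (x + t *\<^sub>R b) * g (x + t *\<^sub>R b)) has_vector_derivative h' x) (at 0))
       \<and> deriv_bd W U j (\<lambda>x. W * (2 ^ Suc j * (A x * B x))) h'"
      using has_vector_derivative_mult[OF f'(1) g'(1)]
      by (intro exI[of _ "\<lambda>x. f x * g' x + f' x * g x"]) auto
  qed (use bd deriv_bd_measurable[OF Suc.prems(1)] deriv_bd_measurable[OF Suc.prems(2)] in auto)
qed

lemma deriv_bd_const:
  assumes "0 \<le> W" "\<And>x. x \<in> U \<Longrightarrow> norm c \<le> A x"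
  shows "deriv_bd W U j A (\<lambda>_. c)"
  using assms(2)
proof (induction j arbitrary: A c)
  case (Suc j)
  have "0 \<le> A x" if "x \<in> U" for x using Suc.prems[OF that] norm_ge_zero order_trans by blast
  then have "deriv_bd W U j (\<lambda>x. W * A x) (\<lambda>_. 0)"
    using assms(1) by (intro Suc.IH) auto
  then show ?case using Suc.prems by (auto intro!: exI[of _ "\<lambda>_. 0"])
qed auto

text \<open>All derivatives beyond the first vanish, so bounds on the function and on its constant
  slopes serve for every order.\<close>

lemma deriv_bd_affine:
  assumes "0 \<le> W" "f \<in> borel_measurable borel" "\<And>x. x \<in> U \<Longrightarrow> norm (f x) \<le> A x"
    and "\<And>x b. b \<in> Basis \<Longrightarrow> ((\<lambda>t. f (x + t *\<^sub>R b)) has_vector_derivative c b) (at 0)"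
    and "\<And>x b. x \<in> U \<Longrightarrow> b \<in> Basis \<Longrightarrow> norm (c b) \<le> W * A x"
  shows "deriv_bd W U j A f"
proof (cases j)
  case (Suc i)
  have "deriv_bd W U i (\<lambda>x. W * A x) (\<lambda>_. c b)" if "b \<in> Basis" for b
    using assms(1,5) that by (intro deriv_bd_const) auto
  then show ?thesis unfolding Suc using assms by (auto intro!: exI[of _ "\<lambda>_. c _"])
qed (use assms in auto)

lemma line_derivative_support:
  fixes f :: "'a::euclidean_space \<Rightarrow> complex"
  assumes "closed U" "\<And>x. x \<notin> U \<Longrightarrow> f x = 0" "x \<notin> U"
    and der: "((\<lambda>t. f (x + t *\<^sub>R b)) has_vector_derivative f') (at 0)"
  shows "f' = 0"
proof -
  have "((\<lambda>t::real. x + t *\<^sub>R b) \<longlongrightarrow> x + 0 *\<^sub>R b) (at 0)" by (intro tendsto_intros)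
  moreover have "open (- U)" "x + 0 *\<^sub>R b \<in> - U" using assms by auto
  ultimately have "\<forall>\<^sub>F t in at 0. x + t *\<^sub>R b \<in> - U" by (rule topological_tendstoD)
  then have "\<forall>\<^sub>F t in at 0. (f (x + (0 + t) *\<^sub>R b) - f (x + 0 *\<^sub>R b)) /\<^sub>R t = 0"
    by eventually_elim (use assms(2,3) in auto)
  then have "((\<lambda>t. (f (x + (0 + t) *\<^sub>R b) - f (x + 0 *\<^sub>R b)) /\<^sub>R t) \<longlongrightarrow> 0) (at (0::real))"
    by (rule tendsto_eventually)
  from tendsto_unique[OF _ der[unfolded has_vector_derivative_at_iff_lim] this] show ?thesis by simp
qed

text \<open>The multiplier estimates hold on the annulus, whereas the Sobolev bound asks for all of
  space. Outside a closed set that carries \<open>f\<close> every derivative vanishes too, the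
  complement being open. Cutting the envelope off sharply is harmless because the envelope is never
  differentiated.\<close>

lemma deriv_bd_restrict:
  assumes "closed U" "deriv_bd W U j A f" "\<And>x. x \<notin> U \<Longrightarrow> f x = 0"
  shows "deriv_bd W UNIV j (\<lambda>x. if x \<in> U then A x else 0) f"
  using assms(2,3)
proof (induction j arbitrary: A f)
  case (Suc j)
  show ?case
    unfolding deriv_bd.simps
  proof (intro conjI ballI)
    fix b :: 'a assume b: "b \<in> Basis"
    obtain f' where f': "\<And>x. ((\<lambda>t. f (x + t *\<^sub>R b)) has_vector_derivative f' x) (at 0)" "deriv_bd W U j (\<lambda>x. W * A x) f'"
      using deriv_bd_SucE[OF Suc.prems(1) b] by blast
    have "f' x = 0" if "x \<notin> U" for x
      using line_derivative_support[OF assms(1) Suc.prems(2) that f'(1)] by blast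
    then have "deriv_bd W UNIV j (\<lambda>x. if x \<in> U then W * A x else 0) f'"
      by (rule Suc.IH[OF f'(2)])
    also have "(\<lambda>x. if x \<in> U then W * A x else 0) = (\<lambda>x. W * (if x \<in> U then A x else 0))" by auto
    finally show "\<exists>f'. (\<forall>x. ((\<lambda>t. f (x + t *\<^sub>R b)) has_vector_derivative f' x) (at 0)) \<and>
        deriv_bd W UNIV j (\<lambda>x. W * (if x \<in> U then A x else 0)) f'"
      using f'(1) by blast
  qed (use deriv_bd_norm_le[OF Suc.prems(1)] deriv_bd_measurable[OF Suc.prems(1)] Suc.prems(2) in auto)
qed auto

text \<open>Multiplying by coordinates keeps a function rapid, so its transform has bounded
  derivatives of every order. Applied to \<Theta>, it shows that the cutoff lives at frequency scale
  1, independently of \<open>W\<close>.\<close>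

lemma deriv_bd_FT:
  assumes "rapid f" shows "\<exists>C. deriv_bd 1 UNIV j (\<lambda>_. C) (FT f)"
  using assms
proof (induction j arbitrary: f)
  case 0
  then show ?case using norm_FT_le[OF rapid_integrable[OF 0]] rapid_measurable[OF 0] by auto
next
  case (Suc j)
  note [measurable] = rapid_measurable[OF Suc.prems]
  let ?g = "\<lambda>b x. (- 2 * pi * \<i>) * (complex_of_real (x \<bullet> b) * f x)"
  have "\<forall>b. \<exists>C. deriv_bd 1 UNIV j (\<lambda>_. C) (FT (?g b))"
    by (intro allI Suc.IH rapid_const_mult rapid_inner_mult Suc.prems)
  then obtain C where C: "\<And>b. deriv_bd 1 UNIV j (\<lambda>_. C b) (FT (?g b))" by metis
  define K where "K = max (LINT x|lborel. norm (f x)) (Max (C ` Basis))"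
  have "deriv_bd 1 UNIV (Suc j) (\<lambda>_. K) (FT f)"
    unfolding deriv_bd.simps
  proof (intro conjI ballI)
    show "norm (FT f x) \<le> K" for x
      using norm_FT_le[OF rapid_integrable[OF Suc.prems], of x] by (simp add: K_def)
    fix b :: 'a assume b: "b \<in> Basis"
    have "C b \<le> K" using b by (simp add: K_def le_max_iff_disj)
    then have "deriv_bd 1 UNIV j (\<lambda>_. 1 * K) (FT (?g b))"
      using C[of b] by (elim deriv_bd_mono) auto
    moreover have "((\<lambda>t. FT f (x + t *\<^sub>R b)) has_vector_derivative FT (?g b) x) (at 0)" for x
      using FT_has_vector_derivative[OF Suc.prems, of x b 0] by simp
    ultimately show "\<exists>f'. (\<forall>x. ((\<lambda>t. FT f (x + t *\<^sub>R b)) has_vector_derivative f' x) (at 0)) \<and> deriv_bd 1 UNIV j (\<lambda>_. 1 * K) f'"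
      by blast
  qed measurable
  then show ?case by blast
qed

section \<open>Powers of 1 - Laplacian applied to a compactly supported function\<close>

lemma deriv_bd_sum:
  assumes "finite S" "0 \<le> W" "\<And>b. b \<in> S \<Longrightarrow> deriv_bd W U j (A b) (f b)"
  shows "deriv_bd W U j (\<lambda>x. \<Sum>b\<in>S. A b x) (\<lambda>x. \<Sum>b\<in>S. f b x)"
  using assms(1,3)
proof (induction S rule: finite_induct)
  case empty
  show ?case using deriv_bd_const[OF assms(2), of U 0 "\<lambda>_. 0" j] by simp
next
  case (insert b S)
  have "deriv_bd W U j (\<lambda>x. A b x + (\<Sum>b\<in>S. A b x)) (\<lambda>x. f b x + (\<Sum>b\<in>S. f b x))"
    using insert by (intro deriv_bd_add) auto
  then show ?case using insert(1,2) by simp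
qed

lemma deriv_bd_uminus: "deriv_bd W U j A f \<Longrightarrow> deriv_bd W U j A (\<lambda>x. (- 1) * f x)"
proof (induction j arbitrary: A f)
  case (Suc j)
  show ?case unfolding deriv_bd.simps
  proof (intro conjI ballI)
    fix b :: 'a assume b: "b \<in> Basis"
    obtain f' where f': "\<And>x. ((\<lambda>t. f (x + t *\<^sub>R b)) has_vector_derivative f' x) (at 0)" "deriv_bd W U j (\<lambda>x. W * A x) f'"
      using deriv_bd_SucE[OF Suc.prems b] by blast
    show "\<exists>h. (\<forall>x. ((\<lambda>t. (- 1) * f (x + t *\<^sub>R b)) has_vector_derivative h x) (at 0)) \<and> deriv_bd W U j (\<lambda>x. W * A x) h"
      using Suc.IH[OF f'(2)] has_vector_derivative_mult_right[OF f'(1), of "- 1"]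
      by (intro exI[of _ "\<lambda>x. (- 1) * f' x"] conjI allI)
  qed (use Suc.prems in auto)
qed auto

text \<open>\<open>E\<close> is \<open>F\<close> minus the sum of its pure second derivatives along
  the basis, hence the factor \<open>1 + real DIM('a) * W\<^sup>2\<close>. The support condition
  keeps the derivatives rapid, so that \<open>FT_derivative\<close> can be applied twice in each
  direction.\<close>

lemma deriv_bd_laplace:
  fixes F :: "'a::euclidean_space \<Rightarrow> complex"
  assumes W: "0 \<le> W" and F: "deriv_bd W UNIV (Suc (Suc j)) A F" and supp: "\<And>x. norm x > 2 \<Longrightarrow> F x = 0"
    and A: "\<And>x. A x \<le> B"
  obtains E where "deriv_bd W UNIV j (\<lambda>x. (1 + real DIM('a) * W\<^sup>2) * A x) E" "\<And>x. norm x > 2 \<Longrightarrow> E x = 0"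
    "\<And>\<xi>. FT E \<xi> = of_real (1 + 4 * pi\<^sup>2 * (norm \<xi>)\<^sup>2) * FT F \<xi>"
proof -
  have cl: "closed (cball (0::'a) 2)" by simp
  have rap: "rapid f" if "deriv_bd W UNIV i (\<lambda>x. c * A x) f" "c \<ge> 0" "\<And>x. norm x > 2 \<Longrightarrow> f x = 0" for f i c
  proof (rule rapid_compact_support[where R=2])
    show "norm (f x) \<le> c * B" for x
      using deriv_bd_norm_le[OF that(1), of x] mult_left_mono[OF A[of x] that(2)] by simp
  qed (use that deriv_bd_measurable in auto)
  have F': "deriv_bd W UNIV (Suc (Suc j)) (\<lambda>x. 1 * A x) F" using F by (simp only: mult_1)
  have ex: "\<exists>g. deriv_bd W UNIV j (\<lambda>x. W * (W * A x)) g \<and> (\<forall>x. norm x > 2 \<longrightarrow> g x = 0) \<and> rapid g \<and>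
     (\<forall>\<xi>. FT g \<xi> = - of_real (4 * pi\<^sup>2 * (\<xi> \<bullet> b)\<^sup>2) * FT F \<xi>)" if b: "b \<in> Basis" for b
  proof -
    obtain F1 where F1: "\<And>x. ((\<lambda>t. F (x + t *\<^sub>R b)) has_vector_derivative F1 x) (at 0)" "deriv_bd W UNIV (Suc j) (\<lambda>x. W * A x) F1"
      using deriv_bd_SucE[OF F b] by blast
    obtain F2 where F2: "\<And>x. ((\<lambda>t. F1 (x + t *\<^sub>R b)) has_vector_derivative F2 x) (at 0)" "deriv_bd W UNIV j (\<lambda>x. W * (W * A x)) F2"
      using deriv_bd_SucE[OF F1(2) b] by blast
    have s1: "F1 x = 0" if "norm x > 2" for x
      using line_derivative_support[OF cl _ _ F1(1)[of x]] supp that by auto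
    have s2: "F2 x = 0" if "norm x > 2" for x
      using line_derivative_support[OF cl _ _ F2(1)[of x]] s1 that by auto
    have r0: "rapid F" using rap[OF F' zero_le_one supp] .
    have r1: "rapid F1" using rap[OF F1(2) W s1] .
    have r2: "rapid F2" using rap[of j "W * W" F2] F2(2) W s2 by (simp add: mult.assoc)
    have "FT F2 \<xi> = - of_real (4 * pi\<^sup>2 * (\<xi> \<bullet> b)\<^sup>2) * FT F \<xi>" for \<xi>
      unfolding FT_derivative[OF r1 r2 F2(1)] FT_derivative[OF r0 r1 F1(1)]
      by (simp add: power2_eq_square algebra_simps)
    then show ?thesis using F2(2) s2 r2 by blast
  qed
  define G where "G b = (SOME g. deriv_bd W UNIV j (\<lambda>x. W * (W * A x)) g \<and> (\<forall>x. norm x > 2 \<longrightarrow> g x = 0) \<and> rapid g \<and>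
     (\<forall>\<xi>. FT g \<xi> = - of_real (4 * pi\<^sup>2 * (\<xi> \<bullet> b)\<^sup>2) * FT F \<xi>))" for b
  have G: "deriv_bd W UNIV j (\<lambda>x. W * (W * A x)) (G b)" "\<And>x. norm x > 2 \<Longrightarrow> G b x = 0" "rapid (G b)"
    "\<And>\<xi>. FT (G b) \<xi> = - of_real (4 * pi\<^sup>2 * (\<xi> \<bullet> b)\<^sup>2) * FT F \<xi>" if "b \<in> Basis" for b
    using someI_ex[OF ex[OF that]] unfolding G_def[symmetric] by simp_all
  let ?E = "\<lambda>x. F x + (\<Sum>b\<in>Basis. (- 1) * G b x)"
  have "deriv_bd W UNIV j (\<lambda>x. A x + (\<Sum>b\<in>(Basis::'a set). W * (W * A x))) ?E"
  proof (intro deriv_bd_add deriv_bd_sum W)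
    show "deriv_bd W UNIV j A F" by (rule deriv_bd_Suc_less[OF deriv_bd_Suc_less[OF F]])
    show "deriv_bd W UNIV j (\<lambda>x. W * (W * A x)) (\<lambda>x. (- 1) * G b x)" if "b \<in> Basis" for b
      by (rule deriv_bd_uminus[OF G(1)[OF that]])
  qed auto
  moreover have "A x + (\<Sum>b\<in>(Basis::'a set). W * (W * A x)) = (1 + real DIM('a) * W\<^sup>2) * A x" for x
    by (simp add: power2_eq_square algebra_simps)
  ultimately have 1: "deriv_bd W UNIV j (\<lambda>x. (1 + real DIM('a) * W\<^sup>2) * A x) ?E" by simp
  have 2: "?E x = 0" if "norm x > 2" for x using supp[OF that] G(2)[OF _ that] by simp
  have r0: "rapid F" using rap[OF F' zero_le_one supp] .
  have 3: "FT ?E \<xi> = of_real (1 + 4 * pi\<^sup>2 * (norm \<xi>)\<^sup>2) * FT F \<xi>" for \<xi>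
  proof -
    have i: "integrable lborel (\<lambda>x. G b x * cis (- 2 * pi * (x \<bullet> \<xi>)))" if "b \<in> Basis" for b
      by (intro integrable_mult_cis rapid_integrable G that) auto
    have i0: "integrable lborel (\<lambda>x. F x * cis (- 2 * pi * (x \<bullet> \<xi>)))"
      by (intro integrable_mult_cis rapid_integrable r0) auto
    have "FT ?E \<xi> = (LINT x|lborel. F x * cis (- 2 * pi * (x \<bullet> \<xi>)) - (\<Sum>b\<in>Basis. G b x * cis (- 2 * pi * (x \<bullet> \<xi>))))"
      unfolding FT_def by (simp add: algebra_simps sum_negf sum_distrib_right)
    also have "\<dots> = FT F \<xi> - (\<Sum>b\<in>Basis. FT (G b) \<xi>)"
      using i i0 unfolding FT_def by (subst Bochner_Integration.integral_diff) (auto intro!: Bochner_Integration.integrable_sum Bochner_Integration.integral_sum)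
    also have "(\<Sum>b\<in>Basis. FT (G b) \<xi>) = (\<Sum>b\<in>(Basis::'a set). - of_real (4 * pi\<^sup>2 * (\<xi> \<bullet> b)\<^sup>2) * FT F \<xi>)"
      using G(4) by (intro sum.cong) auto
    also have "\<dots> = - of_real (4 * pi\<^sup>2 * (\<Sum>b\<in>Basis. (\<xi> \<bullet> b)\<^sup>2)) * FT F \<xi>"
      by (simp only: of_real_mult of_real_sum sum_distrib_left sum_distrib_right sum_negf mult_minus_left)
    also have "(\<Sum>b\<in>Basis. (\<xi> \<bullet> b)\<^sup>2) = (norm \<xi>)\<^sup>2"
      unfolding power2_norm_eq_inner by (subst (2) euclidean_inner) (simp add: power2_eq_square)
    finally show ?thesis by (simp add: algebra_simps)
  qed
  show ?thesis using that 1 2 3 by blast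
qed

text \<open>Each application of 1 - Laplacian spends two derivatives; \<open>j\<close> counts those
  left over.\<close>

lemma deriv_bd_laplace_iterate:
  fixes F :: "'a::euclidean_space \<Rightarrow> complex"
  assumes W: "0 \<le> W" and F: "deriv_bd W UNIV (2 * M + j) A F" and supp: "\<And>x. norm x > 2 \<Longrightarrow> F x = 0"
    and A: "\<And>x. A x \<le> B"
  shows "\<exists>E. deriv_bd W UNIV j (\<lambda>x. (1 + real DIM('a) * W\<^sup>2) ^ M * A x) E \<and> (\<forall>x. norm x > 2 \<longrightarrow> E x = 0) \<and>
    (\<forall>\<xi>. FT E \<xi> = of_real ((1 + 4 * pi\<^sup>2 * (norm \<xi>)\<^sup>2) ^ M) * FT F \<xi>)"
  using F
proof (induction M arbitrary: j)
  case 0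
  then show ?case using supp by (intro exI[of _ F]) auto
next
  case (Suc M)
  let ?d = "1 + real DIM('a) * W\<^sup>2"
  have "deriv_bd W UNIV (2 * M + Suc (Suc j)) A F" using Suc.prems by simp
  from Suc.IH[OF this] obtain E where E: "deriv_bd W UNIV (Suc (Suc j)) (\<lambda>x. ?d ^ M * A x) E" "\<And>x. norm x > 2 \<Longrightarrow> E x = 0"
    "\<And>\<xi>. FT E \<xi> = of_real ((1 + 4 * pi\<^sup>2 * (norm \<xi>)\<^sup>2) ^ M) * FT F \<xi>" by blast
  have "?d ^ M * A x \<le> ?d ^ M * B" for x using A by (intro mult_left_mono) auto
  from deriv_bd_laplace[OF W E(1,2) this] obtain E' where
    "deriv_bd W UNIV j (\<lambda>x. ?d * (?d ^ M * A x)) E'" "\<And>x. norm x > 2 \<Longrightarrow> E' x = 0"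
    "\<And>\<xi>. FT E' \<xi> = of_real (1 + 4 * pi\<^sup>2 * (norm \<xi>)\<^sup>2) * FT E \<xi>" by blast
  then show ?case using E(3) by (intro exI[of _ E']) (auto simp: mult.assoc)
qed

text \<open>The constant is chosen before \<open>W\<close>, \<open>Z\<close>, the envelope and
  \<open>F\<close>; this uniformity is what later permits a supremum over dilates and a limit in
  \<open>W\<close>. The bound \<open>B\<close> serves qualitatively, to make \<open>F\<close> and
  its derivatives rapid, and does not enter the estimate.\<close>

lemma sobolev_norm_le_deriv_bd:
  assumes u: "u \<ge> 1" and s: "s > 0"
  shows "\<exists>C\<ge>0. \<forall>W\<ge>1. \<forall>Z\<ge>0. \<forall>A B. \<forall>F :: 'a::euclidean_space \<Rightarrow> complex.
    A \<in> borel_measurable borel \<longrightarrow> (\<forall>x. 0 \<le> A x \<and> A x \<le> B) \<longrightarrow>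
    deriv_bd W UNIV (2 * nat \<lfloor>s / 2\<rfloor> + 2) A F \<longrightarrow> (\<forall>x. norm x > 2 \<longrightarrow> F x = 0) \<longrightarrow>
    (\<integral>\<^sup>+ x. ennreal (A x powr u) \<partial>lborel) \<le> ennreal (Z powr u) \<longrightarrow>
    sobolev_norm u s F \<le> ennreal (C * W powr s * Z)"
proof -
  \<comment> \<open>Splits \<open>s = 2 * M + \<sigma>\<close> with
    \<open>0 \<le> \<sigma> < 2\<close>; for an even integer \<open>s\<close> the remainder is 0, a
    value the subordination formula includes.\<close>
  define M where "M = nat \<lfloor>s / 2\<rfloor>"
  define \<sigma> where "\<sigma> = s - 2 * real M"
  have "real M = of_int \<lfloor>s / 2\<rfloor>" using s by (simp add: M_def)
  then have sg: "0 \<le> \<sigma>" "\<sigma> < 2" unfolding \<sigma>_def by linarith+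
  let ?c = "3 / Gamma (1 - \<sigma> / 2) * ((exp 1 * Gamma (1 - \<sigma> / 2)) powr u + 2) powr (1 / u)"
  have c: "?c \<ge> 0" using sg by (intro mult_nonneg_nonneg) auto
  let ?D = "(1 + real DIM('a)) ^ (M + 1)"
  have main: "sobolev_norm u s F \<le> ennreal (?c * ?D * W powr s * Z)"
    if W: "W \<ge> 1" and Z: "Z \<ge> 0" and [measurable]: "A \<in> borel_measurable borel" and A: "\<And>x. 0 \<le> A x" "\<And>x. A x \<le> B"
      and F: "deriv_bd W UNIV (2 * M + 2) A F" and supp: "\<And>x. norm x > 2 \<Longrightarrow> F x = 0"
      and int: "(\<integral>\<^sup>+ x. ennreal (A x powr u) \<partial>lborel) \<le> ennreal (Z powr u)"
    for W Z A B and F :: "'a \<Rightarrow> complex"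
  proof -
    let ?d = "1 + real DIM('a) * W\<^sup>2"
    have W0: "0 \<le> W" using W by simp
    obtain E0 where E0: "deriv_bd W UNIV 2 (\<lambda>x. ?d ^ M * A x) E0" "\<And>x. norm x > 2 \<Longrightarrow> E0 x = 0"
      "\<And>\<xi>. FT E0 \<xi> = of_real ((1 + 4 * pi\<^sup>2 * (norm \<xi>)\<^sup>2) ^ M) * FT F \<xi>"
      using deriv_bd_laplace_iterate[OF W0 F supp A(2)] by blast
    have "deriv_bd W UNIV (2 * Suc M + 0) A F" using F by simp
    from deriv_bd_laplace_iterate[OF W0 this supp A(2)]
    obtain E1 where E1: "deriv_bd W UNIV 0 (\<lambda>x. ?d ^ Suc M * A x) E1" "\<And>x. norm x > 2 \<Longrightarrow> E1 x = 0"
      "\<And>\<xi>. FT E1 \<xi> = of_real ((1 + 4 * pi\<^sup>2 * (norm \<xi>)\<^sup>2) ^ Suc M) * FT F \<xi>"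
      by blast
    have d: "?d \<le> (1 + real DIM('a)) * W\<^sup>2" using W by (simp add: distrib_right)
    have b0: "norm (E0 x) \<le> (?D * W ^ (2 * M)) * A x" for x
    proof -
      have "norm (E0 x) \<le> ?d ^ M * A x" using deriv_bd_norm_le[OF E0(1)] by simp
      also have "\<dots> \<le> ((1 + real DIM('a)) * W\<^sup>2) ^ M * A x"
        using d by (intro mult_right_mono power_mono A) auto
      also have "\<dots> = (1 + real DIM('a)) ^ M * W ^ (2 * M) * A x" by (simp add: power_mult_distrib power_mult[symmetric])
      also have "\<dots> \<le> (?D * W ^ (2 * M)) * A x"
        using W0 by (intro mult_right_mono power_increasing A) auto
      finally show ?thesis .
    qed
    have b1: "norm (E1 x) \<le> (W\<^sup>2 * (?D * W ^ (2 * M))) * A x" for x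
    proof -
      have "norm (E1 x) \<le> ?d ^ Suc M * A x" using deriv_bd_norm_le[OF E1(1)] by simp
      also have "\<dots> \<le> ((1 + real DIM('a)) * W\<^sup>2) ^ Suc M * A x"
        using d by (intro mult_right_mono power_mono A) auto
      also have "\<dots> = (W\<^sup>2 * (?D * W ^ (2 * M))) * A x"
        by (simp add: power_mult_distrib power_mult[symmetric] mult_ac)
      finally show ?thesis .
    qed
    have nn: "(\<integral>\<^sup>+ x. ennreal (norm (E x) powr u) \<partial>lborel) \<le> ennreal ((k * Z) powr u)"
      if "k \<ge> 0" "\<And>x. norm (E x) \<le> k * A x" for k and E :: "'a \<Rightarrow> complex"
    proof -
      have "(\<integral>\<^sup>+ x. ennreal (norm (E x) powr u) \<partial>lborel) \<le> (\<integral>\<^sup>+ x. ennreal (k powr u) * ennreal (A x powr u) \<partial>lborel)"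
      proof (rule nn_integral_mono)
        fix x
        have "norm (E x) powr u \<le> (k * A x) powr u" using that u by (intro powr_mono2) auto
        then show "ennreal (norm (E x) powr u) \<le> ennreal (k powr u) * ennreal (A x powr u)"
          by (simp add: ennreal_mult[symmetric] powr_mult ennreal_leI)
      qed
      also have "\<dots> = ennreal (k powr u) * (\<integral>\<^sup>+ x. ennreal (A x powr u) \<partial>lborel)"
        by (rule nn_integral_cmult) measurable
      also have "\<dots> \<le> ennreal (k powr u) * ennreal (Z powr u)" by (intro mult_left_mono int) simp
      finally show ?thesis by (simp add: ennreal_mult[symmetric] powr_mult)
    qed
    have rF: "rapid F"
    proof (rule rapid_compact_support[where R=2])
      show "norm (F x) \<le> B" for x using deriv_bd_norm_le[OF F, of x] A(2)[of x] by simp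
    qed (use supp deriv_bd_measurable[OF F] in auto)
    have B: "A x \<le> B" for x by (rule A(2))
    have r0: "rapid E0"
    proof (rule rapid_compact_support[where R=2])
      show "norm (E0 x) \<le> (?D * W ^ (2 * M)) * B" for x
        by (rule order_trans[OF b0[of x]], intro mult_left_mono B) (use W0 in auto)
    qed (use E0(2) deriv_bd_measurable[OF E0(1)] in auto)
    have r1: "rapid E1"
    proof (rule rapid_compact_support[where R=2])
      show "norm (E1 x) \<le> (W\<^sup>2 * (?D * W ^ (2 * M))) * B" for x
        by (rule order_trans[OF b1[of x]], intro mult_left_mono B) (use W0 in auto)
    qed (use E1(2) deriv_bd_measurable[OF E1(1)] in auto)
    let ?Y = "?D * W ^ (2 * M) * Z"
    have "sobolev_norm u (2 * real M + \<sigma>) F \<le> ennreal (?c * W powr \<sigma> * ?Y)"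
    proof (rule sobolev_norm_le_aux[OF u sg W _ rF r0 r1 E0(3) E1(3)])
      show "0 \<le> ?Y" using W0 Z by simp
      show "(\<integral>\<^sup>+ x. ennreal (norm (E0 x) powr u) \<partial>lborel) \<le> ennreal (?Y powr u)"
        using W0 by (intro nn b0) simp
      show "(\<integral>\<^sup>+ x. ennreal (norm (E1 x) powr u) \<partial>lborel) \<le> ennreal ((W\<^sup>2 * ?Y) powr u)"
        using nn[OF _ b1] W0 by (simp add: mult.assoc)
    qed
    also have "?c * W powr \<sigma> * ?Y = ?c * ?D * W powr s * Z"
    proof -
      have "W powr s = W powr \<sigma> * W ^ (2 * M)"
        using W by (simp add: \<sigma>_def powr_diff powr_realpow[symmetric])
      then show ?thesis by (simp only: mult_ac)
    qed
    finally show ?thesis by (simp add: \<sigma>_def)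
  qed
  show ?thesis
  proof (intro exI[of _ "?c * ?D"] conjI allI impI)
    show "0 \<le> ?c * ?D" by (rule mult_nonneg_nonneg[OF c]) simp
  qed (rule main, auto simp: M_def)
qed

section \<open>Sobolev size of Gaussian multipliers\<close>

text \<open>Minus the logarithm of the modulus of the multiplier at offset \<eta> from its centre.
  It sees the real parts of the weights alone, so a chirp leaves it at unit scale.\<close>

definition gform :: "('l::finite \<Rightarrow> complex) \<Rightarrow> complex \<Rightarrow> real^'n^'l \<Rightarrow> real" where
  "gform w v \<eta> = pi * ((\<Sum>i\<in>UNIV. Re (w i) * (norm (\<eta> $ i))\<^sup>2) + Re v * (norm (\<Sum>i\<in>UNIV. \<eta> $ i))\<^sup>2)"

lemma gform_measurable [measurable]: "gform w v \<in> borel_measurable borel"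
  unfolding gform_def[abs_def] by measurable

lemma gauss_multiplier_exp:
  "gauss_multiplier w v a \<xi> = exp (- (of_real pi * ((\<Sum>i\<in>UNIV. w i * of_real ((norm ((\<xi> - a) $ i))\<^sup>2))
      + v * of_real ((norm (\<Sum>i\<in>UNIV. (\<xi> - a) $ i))\<^sup>2))))"
proof -
  have "(\<Prod>i\<in>UNIV. gauss (w i) ((\<xi> - a) $ i)) = exp (\<Sum>i\<in>UNIV. - (of_real pi * w i * of_real ((norm ((\<xi> - a) $ i))\<^sup>2)))"
    unfolding gauss_def by (rule exp_sum[symmetric]) simp
  then show ?thesis
    unfolding gauss_multiplier_def gauss_def
    by (simp add: exp_add[symmetric] sum_negf sum_distrib_left algebra_simps)
qed

lemma norm_gauss_multiplier: "norm (gauss_multiplier w v a \<xi>) = exp (- gform w v (\<xi> - a))"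
  unfolding gauss_multiplier_exp gform_def norm_exp_eq_Re by simp

text \<open>The logarithmic derivative of the dilated multiplier in direction \<open>b\<close>.\<close>

definition gslope :: "('l::finite \<Rightarrow> complex) \<Rightarrow> complex \<Rightarrow> real \<Rightarrow> real^'n^'l \<Rightarrow> real^'n^'l \<Rightarrow> complex" where
  "gslope w v c b \<eta> = of_real (- (2 * pi * c)) * ((\<Sum>i\<in>UNIV. w i * of_real (\<eta> $ i \<bullet> b $ i))
      + v * of_real ((\<Sum>i\<in>UNIV. \<eta> $ i) \<bullet> (\<Sum>i\<in>UNIV. b $ i)))"

lemma gslope_measurable [measurable]: "gslope w v c b \<in> borel_measurable borel"
  unfolding gslope_def[abs_def] by measurable

lemma gauss_multiplier_line_derivative:
  "((\<lambda>t. gauss_multiplier w v a (c *\<^sub>R (x + t *\<^sub>R b))) has_vector_derivative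
     gslope w v c b (c *\<^sub>R x - a) * gauss_multiplier w v a (c *\<^sub>R x)) (at 0)"
proof -
  let ?\<eta> = "c *\<^sub>R x - a"
  let ?S = "\<lambda>\<eta>::real^'n^'l. \<Sum>i\<in>UNIV. \<eta> $ i"
  \<comment> \<open>Along a line the exponent is a quadratic polynomial in \<open>t\<close> whose
    coefficients are, up to powers of \<open>c\<close>, \<open>P0\<close>, \<open>P1\<close> and
    \<open>P2\<close>; the derivative at 0 retains \<open>P1\<close>, which is the content of
    \<open>gslope\<close>.\<close>
  define P0 where "P0 = (\<Sum>i\<in>UNIV. w i * of_real ((norm (?\<eta> $ i))\<^sup>2)) + v * of_real ((norm (?S ?\<eta>))\<^sup>2)"
  define P1 where "P1 = (\<Sum>i\<in>UNIV. w i * of_real (?\<eta> $ i \<bullet> b $ i)) + v * of_real (?S ?\<eta> \<bullet> ?S b)"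
  define P2 where "P2 = (\<Sum>i\<in>UNIV. w i * of_real (b $ i \<bullet> b $ i)) + v * of_real (?S b \<bullet> ?S b)"
  have sq: "complex_of_real ((norm (y + t *\<^sub>R z))\<^sup>2) = of_real ((norm y)\<^sup>2) + of_real t * (2 * of_real (y \<bullet> z)) + of_real t ^ 2 * of_real (z \<bullet> z)"
    for y z :: "real^'n" and t
  proof -
    have "(norm (y + t *\<^sub>R z))\<^sup>2 = (norm y)\<^sup>2 + t * (2 * (y \<bullet> z)) + t ^ 2 * (z \<bullet> z)"
      unfolding power2_norm_eq_inner
      by (simp add: inner_add_left inner_add_right inner_commute power2_eq_square algebra_simps)
    then show ?thesis by simp
  qed
  have eq: "gauss_multiplier w v a (c *\<^sub>R (x + t *\<^sub>R b)) = exp (- (of_real pi * (P0 + of_real t * (2 * of_real c * P1) + of_real t ^ 2 * (of_real c ^ 2 * P2))))" for t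
  proof -
    have n1: "(c *\<^sub>R (x + t *\<^sub>R b) - a) $ i = ?\<eta> $ i + (t * c) *\<^sub>R b $ i" for i
      by (simp add: algebra_simps)
    have n2: "(\<Sum>i\<in>UNIV. ?\<eta> $ i + (t * c) *\<^sub>R b $ i) = ?S ?\<eta> + (t * c) *\<^sub>R ?S b"
      by (simp add: sum.distrib scaleR_sum_right)
    have "(\<Sum>i\<in>UNIV. w i * of_real ((norm (?\<eta> $ i + (t * c) *\<^sub>R b $ i))\<^sup>2)) + v * of_real ((norm (?S ?\<eta> + (t * c) *\<^sub>R ?S b))\<^sup>2)
       = P0 + of_real t * (2 * of_real c * P1) + of_real t ^ 2 * (of_real c ^ 2 * P2)"
      unfolding sq P0_def P1_def P2_def
      by (simp add: distrib_left distrib_right sum.distrib sum_distrib_left power_mult_distrib mult_ac)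
    then show ?thesis unfolding gauss_multiplier_exp n1 n2 by simp
  qed
  have "((\<lambda>z. exp (- (of_real pi * (P0 + z * (2 * of_real c * P1) + z ^ 2 * (of_real c ^ 2 * P2))))) has_field_derivative
     (of_real (- (2 * pi * c)) * P1) * exp (- (of_real pi * P0))) (at (of_real 0))"
    by (auto intro!: derivative_eq_intros)
  from has_vector_derivative_real_field[OF this]
  show ?thesis
    unfolding eq using eq[of 0] by (simp add: gslope_def P1_def)
qed

text \<open>The slope is affine in the position, so its derivative is a constant that depends
  neither on \<open>x\<close> nor on \<open>a\<close>, as \<open>deriv_bd_affine\<close>
  expects.\<close>

lemma gslope_line_derivative:
  "((\<lambda>t. gslope w v c b (c *\<^sub>R (x + t *\<^sub>R b') - a)) has_vector_derivative gslope w v c b (c *\<^sub>R b')) (at 0)"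
proof -
  have eq: "gslope w v c b (c *\<^sub>R (x + t *\<^sub>R b') - a) = gslope w v c b (c *\<^sub>R x - a) + of_real t * gslope w v c b (c *\<^sub>R b')" for t
  proof -
    have n1: "(c *\<^sub>R (x + t *\<^sub>R b') - a) $ i = (c *\<^sub>R x - a) $ i + t *\<^sub>R (c *\<^sub>R b') $ i" for i
      by (simp add: algebra_simps)
    have n2: "(\<Sum>i\<in>UNIV. (c *\<^sub>R x - a) $ i + t *\<^sub>R (c *\<^sub>R b') $ i) = (\<Sum>i\<in>UNIV. (c *\<^sub>R x - a) $ i) + t *\<^sub>R (\<Sum>i\<in>UNIV. (c *\<^sub>R b') $ i)"
      by (simp only: sum.distrib scaleR_sum_right)
    show ?thesis
      unfolding gslope_def n1 n2 inner_add_left inner_scaleR_left of_real_add of_real_mult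
      by (simp only: distrib_left sum.distrib sum_distrib_left mult_ac add_ac)
  qed
  have "((\<lambda>z. gslope w v c b (c *\<^sub>R x - a) + z * gslope w v c b (c *\<^sub>R b')) has_field_derivative gslope w v c b (c *\<^sub>R b')) (at (of_real 0))"
    by (auto intro!: derivative_eq_intros)
  from has_vector_derivative_real_field[OF this] show ?thesis unfolding eq by simp
qed

text \<open>The condition \<open>(norm z)\<^sup>2 \<le> 4 * W\<^sup>2 * Re z\<close> bounds
  \<open>norm z * norm y\<close> by \<open>2 * W\<close> times the square root of
  \<open>Re z * (norm y)\<^sup>2\<close>: a gradient costs \<open>W\<close> times the square root of
  the exponent. It covers \<open>z = W\<^sup>2\<close> (concentration),
  \<open>z = 1 + \<i> * W\<close> (oscillation) and \<open>z = 1\<close> alike, so both families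
  share one Sobolev estimate.\<close>

definition admissible :: "real \<Rightarrow> ('l \<Rightarrow> complex) \<Rightarrow> complex \<Rightarrow> bool" where
  "admissible W w v \<longleftrightarrow> 1 \<le> W \<and> (\<forall>i. 1 \<le> Re (w i) \<and> (norm (w i))\<^sup>2 \<le> 4 * W\<^sup>2 * Re (w i)) \<and> 1 \<le> Re v \<and> (norm v)\<^sup>2 \<le> 4 * W\<^sup>2 * Re v"

lemma gform_lower:
  assumes "admissible W w v"
  shows "(norm \<eta>)\<^sup>2 \<le> gform w v \<eta>" "Re (w i) * (norm (\<eta> $ i))\<^sup>2 \<le> gform w v \<eta>"
    "Re v * (norm (\<Sum>i\<in>UNIV. \<eta> $ i))\<^sup>2 \<le> gform w v \<eta>"
proof -
  have pos: "0 \<le> Re (w i)" "0 \<le> Re v" for i using assms by (auto simp: admissible_def intro: order_trans[OF zero_le_one])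
  let ?s = "\<Sum>i\<in>UNIV. Re (w i) * (norm (\<eta> $ i))\<^sup>2" and ?t = "Re v * (norm (\<Sum>i\<in>UNIV. \<eta> $ i))\<^sup>2"
  have s: "0 \<le> ?s" "0 \<le> ?t" using pos by (auto intro!: sum_nonneg)
  have "1 * (?s + ?t) \<le> pi * (?s + ?t)" using s pi_ge_two by (intro mult_right_mono) auto
  then have g: "?s + ?t \<le> gform w v \<eta>" by (simp add: gform_def)
  have "(norm \<eta>)\<^sup>2 = (\<Sum>i\<in>UNIV. 1 * (norm (\<eta> $ i))\<^sup>2)" by (simp add: power2_norm_vec)
  also have "\<dots> \<le> ?s" using assms by (intro sum_mono mult_right_mono) (auto simp: admissible_def)
  finally show "(norm \<eta>)\<^sup>2 \<le> gform w v \<eta>" using g s by linarith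
  have "Re (w i) * (norm (\<eta> $ i))\<^sup>2 \<le> ?s" using pos by (intro member_le_sum) auto
  then show "Re (w i) * (norm (\<eta> $ i))\<^sup>2 \<le> gform w v \<eta>" using g s by linarith
  show "?t \<le> gform w v \<eta>" using g s by linarith
qed

lemma norm_weight_le:
  assumes "(norm z)\<^sup>2 \<le> 4 * W\<^sup>2 * Re z" "W \<ge> 1"
  shows "norm z \<le> 4 * W\<^sup>2"
proof (cases "z = 0")
  case False
  have "norm z * norm z \<le> 4 * W\<^sup>2 * norm z"
    using assms(1) complex_Re_le_cmod[of z] mult_left_mono[of "Re z" "norm z" "4 * W\<^sup>2"] by (simp add: power2_eq_square)
  then show ?thesis using False by simp
qed simp

lemma norm_gslope_le:
  fixes b \<eta> :: "real^'n^'l"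
  assumes b: "norm b \<le> 1" and c: "c > 0"
  shows "norm (gslope w v c b \<eta>) \<le> 2 * pi * c * ((\<Sum>i\<in>UNIV. norm (w i) * norm (\<eta> $ i)) + norm v * norm (\<Sum>i\<in>UNIV. \<eta> $ i) * real CARD('l))"
proof -
  have bi: "norm (b $ i) \<le> 1" for i using Finite_Cartesian_Product.norm_nth_le[of b i] b by simp
  have bs: "norm (\<Sum>i\<in>UNIV. b $ i) \<le> real CARD('l)"
    using sum_norm_le[of UNIV "\<lambda>i. b $ i" "\<lambda>_. 1"] bi by simp
  have "norm (\<Sum>i\<in>UNIV. w i * of_real (\<eta> $ i \<bullet> b $ i)) \<le> (\<Sum>i\<in>UNIV. norm (w i) * norm (\<eta> $ i))"
  proof (rule sum_norm_le)
    fix i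
    have "\<bar>\<eta> $ i \<bullet> b $ i\<bar> \<le> norm (\<eta> $ i) * norm (b $ i)" by (rule Cauchy_Schwarz_ineq2)
    also have "\<dots> \<le> norm (\<eta> $ i)" using bi[of i] by (simp add: mult_left_le)
    finally show "norm (w i * of_real (\<eta> $ i \<bullet> b $ i)) \<le> norm (w i) * norm (\<eta> $ i)"
      by (simp add: norm_mult mult_left_mono)
  qed
  moreover have "norm (v * of_real ((\<Sum>i\<in>UNIV. \<eta> $ i) \<bullet> (\<Sum>i\<in>UNIV. b $ i))) \<le> norm v * norm (\<Sum>i\<in>UNIV. \<eta> $ i) * real CARD('l)"
  proof -
    have "\<bar>(\<Sum>i\<in>UNIV. \<eta> $ i) \<bullet> (\<Sum>i\<in>UNIV. b $ i)\<bar> \<le> norm (\<Sum>i\<in>UNIV. \<eta> $ i) * norm (\<Sum>i\<in>UNIV. b $ i)" by (rule Cauchy_Schwarz_ineq2)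
    also have "\<dots> \<le> norm (\<Sum>i\<in>UNIV. \<eta> $ i) * real CARD('l)" using bs by (intro mult_left_mono) auto
    finally show ?thesis by (simp add: norm_mult mult.assoc mult_left_mono)
  qed
  ultimately have "norm ((\<Sum>i\<in>UNIV. w i * of_real (\<eta> $ i \<bullet> b $ i)) + v * of_real ((\<Sum>i\<in>UNIV. \<eta> $ i) \<bullet> (\<Sum>i\<in>UNIV. b $ i)))
     \<le> (\<Sum>i\<in>UNIV. norm (w i) * norm (\<eta> $ i)) + norm v * norm (\<Sum>i\<in>UNIV. \<eta> $ i) * real CARD('l)"
    by (rule norm_triangle_mono)
  then show ?thesis
    unfolding gslope_def norm_mult norm_of_real using c by (simp add: abs_mult mult_left_mono)
qed

text \<open>The dilation \<open>c\<close> is unbounded, but for \<open>norm \<xi> \<ge> 1/2\<close>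
  it is at most \<open>2 * norm (c *\<^sub>R \<xi>)\<close>, hence at most twice the square root of
  \<open>gform\<close> plus a constant depending on \<open>a\<close>. Products of two such
  quantities are dominated by a multiple of \<open>1 + gform\<close>, which an arbitrarily small
  exponential absorbs. The second estimate concerns the constant slopes of \<open>gslope\<close>, of
  size \<open>W\<^sup>2 * c\<^sup>2\<close>.\<close>

lemma gslope_bounds:
  fixes a :: "real^'n^'l"
  assumes \<delta>: "\<delta> > (0::real)"
  shows "\<exists>K\<ge>0. \<forall>W w v c. \<forall>\<xi> b b' :: real^'n^'l. admissible W w v \<longrightarrow> c > 0 \<longrightarrow> norm \<xi> \<ge> 1/2 \<longrightarrow> norm b \<le> 1 \<longrightarrow> norm b' \<le> 1 \<longrightarrow>
    norm (gslope w v c b (c *\<^sub>R \<xi> - a)) \<le> K * W * exp (\<delta> * gform w v (c *\<^sub>R \<xi> - a)) \<and>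
    norm (gslope w v c b (c *\<^sub>R b')) \<le> W * (K * W * exp (\<delta> * gform w v (c *\<^sub>R \<xi> - a)))"
proof -
  let ?l = "real CARD('l)"
  \<comment> \<open>\<open>K1\<close> and \<open>K2\<close> collect the constants of the first and
    the second estimate; \<open>1 + 1 / \<delta>\<close> is the price for replacing
    \<open>1 + q\<close> by \<open>exp (\<delta> * q)\<close>.\<close>
  define K1 where "K1 = 8 * pi * ?l * (2 + 2 * norm a)"
  define K2 where "K2 = 8 * pi * (?l + ?l\<^sup>2) * (8 * (1 + (norm a)\<^sup>2))"
  define K where "K = (K1 + K2) * (1 + 1 / \<delta>)"
  have K12: "K1 \<ge> 0" "K2 \<ge> 0" by (auto simp: K1_def K2_def)
  have main: "norm (gslope w v c b (c *\<^sub>R \<xi> - a)) \<le> K * W * exp (\<delta> * gform w v (c *\<^sub>R \<xi> - a)) \<and>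
    norm (gslope w v c b (c *\<^sub>R b')) \<le> W * (K * W * exp (\<delta> * gform w v (c *\<^sub>R \<xi> - a)))"
    if adm: "admissible W w v" and c: "c > 0" and \<xi>: "norm \<xi> \<ge> 1/2" and b: "norm b \<le> 1" and b': "norm b' \<le> 1"
    for W w v c and \<xi> b b' :: "real^'n^'l"
  proof -
    let ?\<eta> = "c *\<^sub>R \<xi> - a"
    let ?q = "gform w v ?\<eta>"
    define r where "r = sqrt ?q"
    have W: "W \<ge> 1" using adm by (simp add: admissible_def)
    have q: "?q \<ge> 0" using gform_lower(1)[OF adm, of ?\<eta>] by (meson order_trans zero_le_power2)
    have r: "r \<ge> 0" "r\<^sup>2 = ?q" using q by (auto simp: r_def)
    have wr: "norm z * norm y \<le> 2 * W * r" if "(norm z)\<^sup>2 \<le> 4 * W\<^sup>2 * Re z" "Re z * (norm y)\<^sup>2 \<le> ?q" for z and y :: "real^'n"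
    proof (rule power2_le_imp_le)
      have "(norm z * norm y)\<^sup>2 \<le> 4 * W\<^sup>2 * (Re z * (norm y)\<^sup>2)"
        using mult_right_mono[OF that(1), of "(norm y)\<^sup>2"] by (simp add: power_mult_distrib mult_ac)
      also have "\<dots> \<le> 4 * W\<^sup>2 * ?q" using that(2) by (intro mult_left_mono) auto
      finally show "(norm z * norm y)\<^sup>2 \<le> (2 * W * r)\<^sup>2" by (simp add: power_mult_distrib r)
      show "0 \<le> 2 * W * r" using W r by simp
    qed
    have "c * norm \<xi> \<le> norm ?\<eta> + norm a"
      using norm_triangle_ineq[of ?\<eta> a] c by simp
    moreover have "norm ?\<eta> \<le> r" using gform_lower(1)[OF adm, of ?\<eta>] unfolding r_def by (rule real_le_rsqrt)
    moreover have "c * (1/2) \<le> c * norm \<xi>" using c \<xi> by (intro mult_left_mono) auto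
    ultimately have cr: "c \<le> 2 * r + 2 * norm a" by linarith
    have r1: "r \<le> 1 + ?q" using r q sum_squares_bound[of r 1] by simp
    have e: "1 + ?q \<le> (1 + 1 / \<delta>) * exp (\<delta> * ?q)"
    proof -
      have "\<delta> * ?q \<le> exp (\<delta> * ?q)" using exp_ge_add_one_self[of "\<delta> * ?q"] by linarith
      then have 1: "?q \<le> 1 / \<delta> * exp (\<delta> * ?q)" using \<delta> by (simp add: field_simps)
      have "1 \<le> exp (\<delta> * ?q)" using \<delta> q by simp
      with 1 show ?thesis unfolding distrib_right by linarith
    qed
    have k: "k * (1 + ?q) \<le> K * exp (\<delta> * ?q)" if "k \<ge> 0" "k \<le> K1 + K2" for k
    proof -
      have "k * (1 + ?q) \<le> (K1 + K2) * ((1 + 1 / \<delta>) * exp (\<delta> * ?q))"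
        using that e q by (intro mult_mono) auto
      then show ?thesis by (simp add: K_def mult.assoc)
    qed
    have "norm (gslope w v c b ?\<eta>) \<le> 2 * pi * c * ((\<Sum>i\<in>(UNIV::'l set). 2 * W * r) + (2 * W * r) * ?l)"
    proof (rule order_trans[OF norm_gslope_le[OF b c]], intro mult_left_mono add_mono sum_mono mult_right_mono wr)
      show "Re (w i) * (norm (?\<eta> $ i))\<^sup>2 \<le> ?q" for i by (rule gform_lower(2)[OF adm])
      show "Re v * (norm (\<Sum>i\<in>UNIV. ?\<eta> $ i))\<^sup>2 \<le> ?q" by (rule gform_lower(3)[OF adm])
    qed (use adm c in \<open>auto simp: admissible_def\<close>)
    also have "\<dots> = 8 * pi * ?l * W * (c * r)" by simp
    also have "c * r \<le> (2 * r + 2 * norm a) * r" using cr r by (intro mult_right_mono) auto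
    also have "\<dots> = 2 * ?q + 2 * norm a * r" using r(2) by (simp add: power2_eq_square algebra_simps)
    also have "\<dots> \<le> 2 * (1 + ?q) + 2 * norm a * (1 + ?q)" using r1 by (intro add_mono mult_left_mono) auto
    also have "8 * pi * ?l * W * \<dots> = W * (K1 * (1 + ?q))" by (simp add: K1_def algebra_simps)
    also have "\<dots> \<le> W * (K * exp (\<delta> * ?q))" using W K12 by (intro mult_left_mono k) auto
    finally have 1: "norm (gslope w v c b ?\<eta>) \<le> K * W * exp (\<delta> * ?q)"
      using W by (simp add: mult_left_mono mult_right_mono mult_ac)
    have c2: "c\<^sup>2 \<le> 8 * (1 + (norm a)\<^sup>2) * (1 + ?q)"
    proof -
      have "c\<^sup>2 \<le> (2 * r + 2 * norm a)\<^sup>2" using cr c by (intro power_mono) auto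
      also have "\<dots> \<le> 8 * r\<^sup>2 + 8 * (norm a)\<^sup>2"
        using sum_squares_bound[of r "norm a"] by (simp add: power2_eq_square algebra_simps)
      also have "\<dots> \<le> 8 * (1 + (norm a)\<^sup>2) * (1 + ?q)" using q by (simp add: r algebra_simps)
      finally show ?thesis .
    qed
    have "norm (gslope w v c b (c *\<^sub>R b')) \<le> 2 * pi * c * ((\<Sum>i\<in>(UNIV::'l set). 4 * W\<^sup>2 * c) + (4 * W\<^sup>2 * (c * ?l)) * ?l)"
    proof (rule order_trans[OF norm_gslope_le[OF b c]], intro mult_left_mono add_mono sum_mono mult_right_mono mult_mono)
      show "norm (w i) \<le> 4 * W\<^sup>2" for i using adm by (intro norm_weight_le) (auto simp: admissible_def)
      show "norm v \<le> 4 * W\<^sup>2" using adm by (intro norm_weight_le) (auto simp: admissible_def)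
      have bi: "norm (b' $ i) \<le> 1" for i using Finite_Cartesian_Product.norm_nth_le[of b' i] b' by simp
      show "norm ((c *\<^sub>R b') $ i) \<le> c" for i using bi[of i] c by (simp add: mult_left_le)
      then show "norm (\<Sum>i\<in>UNIV. (c *\<^sub>R b') $ i) \<le> c * ?l"
        using sum_norm_le[of UNIV "\<lambda>i. (c *\<^sub>R b') $ i" "\<lambda>_. c"] by (simp add: mult.commute)
    qed (use c in auto)
    also have "\<dots> = 8 * pi * (?l + ?l\<^sup>2) * W\<^sup>2 * c\<^sup>2" by (simp add: power2_eq_square algebra_simps)
    also have "\<dots> \<le> 8 * pi * (?l + ?l\<^sup>2) * W\<^sup>2 * (8 * (1 + (norm a)\<^sup>2) * (1 + ?q))"
      by (intro mult_left_mono c2) auto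
    also have "8 * pi * (?l + ?l\<^sup>2) * W\<^sup>2 * (8 * (1 + (norm a)\<^sup>2) * (1 + ?q)) = W\<^sup>2 * (K2 * (1 + ?q))"
      by (simp add: K2_def algebra_simps)
    also have "\<dots> \<le> W\<^sup>2 * (K * exp (\<delta> * ?q))" using K12 by (intro mult_left_mono k) auto
    finally have 2: "norm (gslope w v c b (c *\<^sub>R b')) \<le> W * (K * W * exp (\<delta> * ?q))"
      by (simp add: power2_eq_square mult_ac)
    show ?thesis using 1 2 by blast
  qed
  have "K \<ge> 0" using K12 \<delta> by (simp add: K_def)
  then show ?thesis using main by blast
qed

section \<open>Estimates uniform over all dilates\<close>

abbreviation annulus :: "'a::real_normed_vector set" where
  "annulus \<equiv> {\<xi>. 1/2 \<le> norm \<xi> \<and> norm \<xi> \<le> 2}"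

text \<open>The derivative estimates retain half of the Gaussian exponent; raising that half to the
  power \<open>u\<close> gives \<open>u / 2\<close>.\<close>

abbreviation shell_mass :: "real \<Rightarrow> ('l::finite \<Rightarrow> complex) \<Rightarrow> complex \<Rightarrow> real^'n^'l \<Rightarrow> real \<Rightarrow> ennreal" where
  "shell_mass u w v a c \<equiv>
     \<integral>\<^sup>+ \<xi>. ennreal (indicator annulus \<xi> * exp (- (u / 2 * gform w v (c *\<^sub>R \<xi> - a)))) \<partial>lborel"

text \<open>Every derivative brings a factor \<open>gslope\<close>, which costs one \<open>W\<close>
  and a portion \<delta> of the exponent. The constant is independent of \<open>W\<close>, of the
  weights and of the dilation.\<close>

lemma deriv_bd_gauss_multiplier:
  fixes a :: "real^'n^'l"
  assumes \<delta>: "\<delta> > 0"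
  shows "\<exists>C\<ge>1. \<forall>W w v c. admissible W w v \<longrightarrow> c > 0 \<longrightarrow>
    deriv_bd W annulus j (\<lambda>\<xi>. C * exp (- ((1 - real j * \<delta>) * gform w v (c *\<^sub>R \<xi> - a))))
       (\<lambda>\<xi>. gauss_multiplier w v a (c *\<^sub>R \<xi>))"
proof -
  let ?U = "annulus :: (real^'n^'l) set"
  obtain K where K: "K \<ge> 0" "\<And>W w v c. \<And>\<xi> b b' :: real^'n^'l. admissible W w v \<Longrightarrow> c > 0 \<Longrightarrow> norm \<xi> \<ge> 1/2 \<Longrightarrow> norm b \<le> 1 \<Longrightarrow> norm b' \<le> 1 \<Longrightarrow>
    norm (gslope w v c b (c *\<^sub>R \<xi> - a)) \<le> K * W * exp (\<delta> * gform w v (c *\<^sub>R \<xi> - a)) \<and>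
    norm (gslope w v c b (c *\<^sub>R b')) \<le> W * (K * W * exp (\<delta> * gform w v (c *\<^sub>R \<xi> - a)))"
    using gslope_bounds[OF \<delta>, of a] by blast
  have meas: "(\<lambda>\<xi>. gauss_multiplier w v a (c *\<^sub>R \<xi>)) \<in> borel_measurable borel" for w v c by measurable
  show ?thesis
  proof (induction j)
    case 0
    show ?case using meas by (intro exI[of _ 1]) (auto simp: norm_gauss_multiplier)
  next
    case (Suc j)
    then obtain C where C: "C \<ge> 1" "\<And>W w v c. admissible W w v \<Longrightarrow> c > 0 \<Longrightarrow>
      deriv_bd W ?U j (\<lambda>\<xi>. C * exp (- ((1 - real j * \<delta>) * gform w v (c *\<^sub>R \<xi> - a)))) (\<lambda>\<xi>. gauss_multiplier w v a (c *\<^sub>R \<xi>))"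
      by blast
    \<comment> \<open>The summand 1 dominates the undifferentiated multiplier; the other summand is
      what \<open>deriv_bd_mult\<close> yields for the derivative.\<close>
    define C' where "C' = 1 + 2 ^ j * (K * C)"
    have C': "C' \<ge> 1" using K(1) C(1) by (simp add: C'_def)
    have "deriv_bd W ?U (Suc j) (\<lambda>\<xi>. C' * exp (- ((1 - real (Suc j) * \<delta>) * gform w v (c *\<^sub>R \<xi> - a)))) (\<lambda>\<xi>. gauss_multiplier w v a (c *\<^sub>R \<xi>))"
      if adm: "admissible W w v" and c: "c > 0" for W w v c
      unfolding deriv_bd.simps
    proof (intro conjI ballI)
      let ?q = "\<lambda>\<xi>. gform w v (c *\<^sub>R \<xi> - a)"
      have W: "W \<ge> 1" using adm by (simp add: admissible_def)
      show "(\<lambda>\<xi>. gauss_multiplier w v a (c *\<^sub>R \<xi>)) \<in> borel_measurable borel" by (rule meas)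
      show "norm (gauss_multiplier w v a (c *\<^sub>R \<xi>)) \<le> C' * exp (- ((1 - real (Suc j) * \<delta>) * ?q \<xi>))" for \<xi>
      proof -
        have q: "0 \<le> ?q \<xi>" using gform_lower(1)[OF adm] by (meson order_trans zero_le_power2)
        have "0 \<le> (real (Suc j) * \<delta>) * ?q \<xi>" using \<delta> q by (intro mult_nonneg_nonneg) auto
        then have "(1 - real (Suc j) * \<delta>) * ?q \<xi> \<le> ?q \<xi>" by (simp add: algebra_simps)
        then have "1 * exp (- ?q \<xi>) \<le> C' * exp (- ((1 - real (Suc j) * \<delta>) * ?q \<xi>))"
          using C' by (intro mult_mono) auto
        then show ?thesis by (simp add: norm_gauss_multiplier)
      qed
      fix b :: "real^'n^'l" assume b: "b \<in> Basis"
      have "deriv_bd W ?U j (\<lambda>\<xi>. K * W * exp (\<delta> * ?q \<xi>)) (\<lambda>\<xi>. gslope w v c b (c *\<^sub>R \<xi> - a))"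
      proof (rule deriv_bd_affine[where c="\<lambda>b'. gslope w v c b (c *\<^sub>R b')"])
        show "((\<lambda>t. gslope w v c b (c *\<^sub>R (x + t *\<^sub>R b') - a)) has_vector_derivative gslope w v c b (c *\<^sub>R b')) (at 0)" for x b'
          by (rule gslope_line_derivative)
        show "norm (gslope w v c b (c *\<^sub>R x - a)) \<le> K * W * exp (\<delta> * ?q x)" if "x \<in> ?U" for x
          using K(2)[OF adm c, of x b b] that b by simp
        show "norm (gslope w v c b (c *\<^sub>R b')) \<le> W * (K * W * exp (\<delta> * ?q x))" if "x \<in> ?U" "b' \<in> Basis" for x b'
          using K(2)[OF adm c, of x b b'] that b by simp
      qed (use W in auto)
      then have "deriv_bd W ?U j (\<lambda>\<xi>. 2 ^ j * ((K * W * exp (\<delta> * ?q \<xi>)) * (C * exp (- ((1 - real j * \<delta>) * ?q \<xi>)))))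
         (\<lambda>\<xi>. gslope w v c b (c *\<^sub>R \<xi> - a) * gauss_multiplier w v a (c *\<^sub>R \<xi>))"
        using W C(2)[OF adm c] by (intro deriv_bd_mult) auto
      then have "deriv_bd W ?U j (\<lambda>\<xi>. W * (C' * exp (- ((1 - real (Suc j) * \<delta>) * ?q \<xi>))))
         (\<lambda>\<xi>. gslope w v c b (c *\<^sub>R \<xi> - a) * gauss_multiplier w v a (c *\<^sub>R \<xi>))"
      proof (rule deriv_bd_mono)
        fix \<xi>
        have "exp (\<delta> * ?q \<xi>) * exp (- ((1 - real j * \<delta>) * ?q \<xi>)) = exp (- ((1 - real (Suc j) * \<delta>) * ?q \<xi>))"
          by (simp add: exp_add[symmetric] algebra_simps)
        then have "2 ^ j * ((K * W * exp (\<delta> * ?q \<xi>)) * (C * exp (- ((1 - real j * \<delta>) * ?q \<xi>))))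
           = W * ((2 ^ j * (K * C)) * exp (- ((1 - real (Suc j) * \<delta>) * ?q \<xi>)))" by (simp add: mult_ac)
        also have "\<dots> \<le> W * (C' * exp (- ((1 - real (Suc j) * \<delta>) * ?q \<xi>)))"
          using W by (intro mult_left_mono mult_right_mono) (auto simp: C'_def)
        finally show "2 ^ j * ((K * W * exp (\<delta> * ?q \<xi>)) * (C * exp (- ((1 - real j * \<delta>) * ?q \<xi>))))
           \<le> W * (C' * exp (- ((1 - real (Suc j) * \<delta>) * ?q \<xi>)))" .
      qed (use W in auto)
      then show "\<exists>f'. (\<forall>x. ((\<lambda>t. gauss_multiplier w v a (c *\<^sub>R (x + t *\<^sub>R b))) has_vector_derivative f' x) (at 0)) \<and>
         deriv_bd W ?U j (\<lambda>\<xi>. W * (C' * exp (- ((1 - real (Suc j) * \<delta>) * ?q \<xi>)))) f'"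
        by (intro exI[of _ "\<lambda>\<xi>. gslope w v c b (c *\<^sub>R \<xi> - a) * gauss_multiplier w v a (c *\<^sub>R \<xi>)"] conjI allI
            gauss_multiplier_line_derivative)
    qed
    then show ?case using C' by blast
  qed
qed

text \<open>The dilates enter through \<open>shell_mass\<close> alone, so the supremum over
  \<open>k\<close> is reduced to a uniform bound on explicit Gaussian integrals.\<close>

lemma A_norm_gauss_multiplier_le:
  fixes \<Theta> :: "real^'n^'l \<Rightarrow> complex" and a :: "real^'n^'l"
  assumes \<Theta>: "rapid \<Theta>" and supp: "\<And>\<xi>. FT \<Theta> \<xi> \<noteq> 0 \<Longrightarrow> 1/2 \<le> norm \<xi> \<and> norm \<xi> \<le> 2"
    and u: "u \<ge> 1" and s: "s > 0"
  shows "\<exists>C\<ge>0. \<forall>W w v Z. admissible W w v \<longrightarrow> Z \<ge> 0 \<longrightarrow>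
    (\<forall>k::int. shell_mass u w v a (2 powr real_of_int k)
       \<le> ennreal (Z powr u)) \<longrightarrow>
    A_norm \<Theta> u s (gauss_multiplier w v a) \<le> ennreal (C * W powr s * Z)"
proof -
  let ?U = "annulus :: (real^'n^'l) set"
  define J where "J = 2 * nat \<lfloor>s / 2\<rfloor> + 2"
  have J: "J > 0" by (simp add: J_def)
  have clU: "closed ?U"
    by (intro closed_Collect_conj closed_Collect_le continuous_intros)
  have mU [measurable]: "?U \<in> sets borel" using clU by (rule borel_closed)
  \<comment> \<open>\<open>J\<close> derivatives, each costing \<delta>, leave exactly half of the
    exponent.\<close>
  define \<delta> where "\<delta> = 1 / (2 * real J)"
  have \<delta>: "\<delta> > 0" "1 - real J * \<delta> = 1/2" using J by (auto simp: \<delta>_def)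
  obtain C1 where C1: "C1 \<ge> 1" "\<And>W w v c. admissible W w v \<Longrightarrow> c > 0 \<Longrightarrow>
    deriv_bd W ?U J (\<lambda>\<xi>. C1 * exp (- ((1 - real J * \<delta>) * gform w v (c *\<^sub>R \<xi> - a)))) (\<lambda>\<xi>. gauss_multiplier w v a (c *\<^sub>R \<xi>))"
    using deriv_bd_gauss_multiplier[OF \<delta>(1), of J a] by blast
  obtain C2 where C2: "deriv_bd 1 UNIV J (\<lambda>_. C2) (FT \<Theta>)" using deriv_bd_FT[OF \<Theta>] by blast
  have C2pos: "C2 \<ge> 0" using deriv_bd_norm_le[OF C2, of 0] norm_ge_zero order_trans by blast
  obtain C3 where C3: "C3 \<ge> 0" "\<And>W Z A B. \<And>F :: real^'n^'l \<Rightarrow> complex. W \<ge> 1 \<Longrightarrow> Z \<ge> 0 \<Longrightarrow>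
    A \<in> borel_measurable borel \<Longrightarrow> (\<forall>x. 0 \<le> A x \<and> A x \<le> B) \<Longrightarrow>
    deriv_bd W UNIV J A F \<Longrightarrow> (\<forall>x. norm x > 2 \<longrightarrow> F x = 0) \<Longrightarrow>
    (\<integral>\<^sup>+ x. ennreal (A x powr u) \<partial>lborel) \<le> ennreal (Z powr u) \<Longrightarrow>
    sobolev_norm u s F \<le> ennreal (C3 * W powr s * Z)"
    using sobolev_norm_le_deriv_bd[OF u s, where ?'a="real^'n^'l"] unfolding J_def[symmetric] by blast
  define D where "D = 2 ^ J * (C1 * C2)"
  have D: "D \<ge> 0" using C1 C2pos by (simp add: D_def)
  have "A_norm \<Theta> u s (gauss_multiplier w v a) \<le> ennreal ((C3 * D) * W powr s * Z)"
    if adm: "admissible W w v" and Z: "Z \<ge> 0"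
      and int: "\<And>k::int. shell_mass u w v a (2 powr real_of_int k) \<le> ennreal (Z powr u)"
    for W w v Z
    unfolding A_norm_def
  proof (rule SUP_least)
    fix k :: int
    let ?c = "2 powr real_of_int k"
    let ?q = "\<lambda>\<xi>. gform w v (?c *\<^sub>R \<xi> - a)"
    let ?F = "\<lambda>\<xi>. gauss_multiplier w v a (?c *\<^sub>R \<xi>) * FT \<Theta> \<xi>"
    let ?A = "\<lambda>\<xi>. if \<xi> \<in> ?U then D * exp (- (1/2 * ?q \<xi>)) else 0"
    have W: "W \<ge> 1" using adm by (simp add: admissible_def)
    have "deriv_bd W ?U J (\<lambda>\<xi>. C1 * exp (- (1/2 * ?q \<xi>))) (\<lambda>\<xi>. gauss_multiplier w v a (?c *\<^sub>R \<xi>))"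
      using C1(2)[OF adm, of ?c] unfolding \<delta>(2) by simp
    moreover have "deriv_bd W ?U J (\<lambda>_. C2) (FT \<Theta>)" using C2 W by (elim deriv_bd_mono) auto
    ultimately have "deriv_bd W ?U J (\<lambda>\<xi>. 2 ^ J * (C1 * exp (- (1/2 * ?q \<xi>)) * C2)) ?F"
      using W by (intro deriv_bd_mult) auto
    also have "(\<lambda>\<xi>. 2 ^ J * (C1 * exp (- (1/2 * ?q \<xi>)) * C2)) = (\<lambda>\<xi>. D * exp (- (1/2 * ?q \<xi>)))"
      by (simp add: D_def mult_ac)
    finally have bd: "deriv_bd W UNIV J ?A ?F"
      using supp by (intro deriv_bd_restrict[OF clU]) auto
    have "sobolev_norm u s ?F \<le> ennreal (C3 * W powr s * (D * Z))"
    proof (rule C3(2)[OF W _ _ _ bd])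
      show "D * Z \<ge> 0" using D Z by simp
      show "?A \<in> borel_measurable borel" by measurable
      show "\<forall>\<xi>. 0 \<le> ?A \<xi> \<and> ?A \<xi> \<le> D"
      proof
        fix \<xi>
        have "0 \<le> ?q \<xi>" using gform_lower(1)[OF adm] by (meson order_trans zero_le_power2)
        then show "0 \<le> ?A \<xi> \<and> ?A \<xi> \<le> D" using D by (auto intro: mult_left_le)
      qed
      show "\<forall>\<xi>. norm \<xi> > 2 \<longrightarrow> ?F \<xi> = 0" using supp by fastforce
      have "(\<integral>\<^sup>+ \<xi>. ennreal (?A \<xi> powr u) \<partial>lborel) = (\<integral>\<^sup>+ \<xi>. ennreal (D powr u) * ennreal (indicator ?U \<xi> * exp (- (u / 2 * ?q \<xi>))) \<partial>lborel)"
      proof (rule nn_integral_cong)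
        fix \<xi>
        show "ennreal (?A \<xi> powr u) = ennreal (D powr u) * ennreal (indicator ?U \<xi> * exp (- (u / 2 * ?q \<xi>)))"
          using D u by (auto simp: powr_mult ennreal_mult[symmetric] powr_def[of "exp _"])
      qed
      also have "\<dots> = ennreal (D powr u) * (\<integral>\<^sup>+ \<xi>. ennreal (indicator ?U \<xi> * exp (- (u / 2 * ?q \<xi>))) \<partial>lborel)"
        by (rule nn_integral_cmult) measurable
      also have "\<dots> \<le> ennreal (D powr u) * ennreal (Z powr u)" by (intro mult_left_mono int) simp
      finally show "(\<integral>\<^sup>+ \<xi>. ennreal (?A \<xi> powr u) \<partial>lborel) \<le> ennreal ((D * Z) powr u)"
        by (simp add: ennreal_mult[symmetric] powr_mult)
    qed
    then show "sobolev_norm u s ?F \<le> ennreal ((C3 * D) * W powr s * Z)" by (simp add: mult_ac)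
  qed
  then show ?thesis using C3(1) D by (intro exI[of _ "C3 * D"]) auto
qed

section \<open>The necessary conditions\<close>

lemma exponent_le_of_powr_le:
  fixes \<alpha> \<beta> c C :: real
  assumes c: "c > 0" and le: "\<And>W. W \<ge> 1 \<Longrightarrow> c * W powr \<alpha> \<le> C * W powr \<beta>"
  shows "\<alpha> \<le> \<beta>"
proof (rule ccontr)
  assume "\<not> \<alpha> \<le> \<beta>"
  then have d: "\<alpha> - \<beta> > 0" by simp
  have C: "C > 0" using le[of 1] c by simp
  \<comment> \<open>Solves \<open>W powr (\<alpha> - \<beta>) = 1 + C / c\<close>, beyond the value
    \<open>C / c\<close> that the hypothesis allows.\<close>
  define W where "W = (1 + C / c) powr (1 / (\<alpha> - \<beta>))"
  have W: "W \<ge> 1" using C c d by (simp add: W_def ge_one_powr_ge_zero)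
  have "W powr (\<alpha> - \<beta>) = 1 + C / c" using C c d by (simp add: W_def powr_powr add_pos_pos)
  moreover have "c * W powr (\<alpha> - \<beta>) \<le> C"
    using le[OF W] W by (simp add: powr_diff field_simps)
  ultimately have "c * (1 + C / c) \<le> C" by simp
  then show False using c by (simp add: distrib_left)
qed

text \<open>This is \<open>ln x \<le> x - 1\<close> at \<open>x = \<kappa> * y / \<nu>\<close>. It
  trades the Gaussian smallness away from the centre for a prescribed power of
  \<open>W\<close>.\<close>

lemma exp_minus_le_powr:
  fixes \<kappa> \<nu> y :: real
  assumes "\<kappa> > 0" "\<nu> > 0" "y > 0"
  shows "exp (- (\<kappa> * y)) \<le> exp (\<nu> * ln (\<nu> / \<kappa>)) * y powr (- \<nu>)"
proof -
  have "ln (\<kappa> * y / \<nu>) \<le> \<kappa> * y / \<nu> - 1" using assms by (intro ln_le_minus_one) simp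
  moreover have "ln (\<kappa> * y / \<nu>) = ln y - ln (\<nu> / \<kappa>)" using assms by (simp add: ln_div ln_mult)
  ultimately have "ln y \<le> \<kappa> * y / \<nu> + ln (\<nu> / \<kappa>)" by linarith
  then have "\<nu> * ln y \<le> \<nu> * (\<kappa> * y / \<nu> + ln (\<nu> / \<kappa>))" using assms by (intro mult_left_mono) auto
  then have "\<nu> * ln y \<le> \<kappa> * y + \<nu> * ln (\<nu> / \<kappa>)" using assms by (simp add: distrib_left)
  then have "- (\<kappa> * y) \<le> \<nu> * ln (\<nu> / \<kappa>) + (- \<nu>) * ln y" by simp
  then have "exp (- (\<kappa> * y)) \<le> exp (\<nu> * ln (\<nu> / \<kappa>) + (- \<nu>) * ln y)" by simp
  also have "\<dots> = exp (\<nu> * ln (\<nu> / \<kappa>)) * y powr (- \<nu>)" using assms by (simp only: exp_add powr_def) simp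
  finally show ?thesis .
qed

lemma nn_integral_lborel_affine:
  fixes f :: "'a::euclidean_space \<Rightarrow> ennreal"
  assumes [measurable]: "f \<in> borel_measurable borel" and c: "c > 0"
  shows "(\<integral>\<^sup>+ x. f (c *\<^sub>R x - a) \<partial>lborel) = ennreal ((1 / c) ^ DIM('a)) * (\<integral>\<^sup>+ x. f x \<partial>lborel)"
proof -
  have "(\<integral>\<^sup>+ x. f x \<partial>lborel) = (\<integral>\<^sup>+ x. f x \<partial>density (distr lborel borel (\<lambda>x. - a + c *\<^sub>R x)) (\<lambda>_. \<bar>c\<bar> ^ DIM('a)))"
    using c by (subst lborel_affine[of c "- a"]) auto
  also have "\<dots> = ennreal (c ^ DIM('a)) * (\<integral>\<^sup>+ x. f (c *\<^sub>R x - a) \<partial>lborel)"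
    using c by (simp add: nn_integral_density nn_integral_distr nn_integral_cmult)
  finally have "ennreal ((1 / c) ^ DIM('a)) * (\<integral>\<^sup>+ x. f x \<partial>lborel)
     = ennreal ((1 / c) ^ DIM('a) * c ^ DIM('a)) * (\<integral>\<^sup>+ x. f (c *\<^sub>R x - a) \<partial>lborel)"
    using c by (simp add: ennreal_mult mult.assoc)
  also have "(1 / c) ^ DIM('a) * c ^ DIM('a) = 1" using c by (simp add: power_mult_distrib[symmetric])
  finally show ?thesis by simp
qed

abbreviation multiplier_bound ::
  "(real^'n^'l \<Rightarrow> complex) \<Rightarrow> real \<Rightarrow> real \<Rightarrow> ('l \<Rightarrow> real) \<Rightarrow> real \<Rightarrow> real \<Rightarrow> bool" where
  "multiplier_bound \<Theta> u s p pp C \<equiv> \<forall>m :: real^'n^'l \<Rightarrow> complex.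
     m \<in> borel_measurable lborel \<and> bounded (range m) \<and> A_norm \<Theta> u s m < top \<longrightarrow>
     (\<forall>f :: 'l \<Rightarrow> real^'n \<Rightarrow> complex. (\<forall>i. schwartz (f i)) \<longrightarrow>
        Lp_norm pp (T_mult m f) \<le> ennreal C * A_norm \<Theta> u s m * (\<Prod>i\<in>UNIV. Lp_norm (p i) (f i)))"

text \<open>Distils what the assumed bound says about the Gaussian family. Both sides are explicit
  in the weights, and everything else is absorbed into \<open>C0\<close>. The left-hand factors come
  from the modulus of \<open>T_mult\<close> and its norm with exponent \<open>pp\<close>; those on
  the right come from the seminorm and from the norms of the test functions.\<close>

lemma key_inequality:
  fixes \<Theta> :: "real^'n^'l \<Rightarrow> complex" and p :: "'l \<Rightarrow> real" and pp u s C :: real and a :: "real^'n^'l"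
  assumes Theta_schwartz: "schwartz \<Theta>"
    and Theta_supp: "\<forall>\<xi>. FT \<Theta> \<xi> \<noteq> 0 \<longrightarrow> 1/2 \<le> norm \<xi> \<and> norm \<xi> \<le> 2"
    and p_range: "\<forall>i. 1 < p i" and pp: "pp > 0" and u_range: "1 < u" and s_pos: "0 < s"
    and bounded: "multiplier_bound \<Theta> u s p pp C"
  shows "\<exists>C0\<ge>0. \<forall>W w v Z. admissible W w v \<longrightarrow> Z \<ge> 0 \<longrightarrow>
    (\<forall>k::int. shell_mass u w v a (2 powr real_of_int k)
       \<le> ennreal (Z powr u)) \<longrightarrow>
    (\<Prod>i\<in>UNIV. (norm (w i) / (2 * Re (w i))) powr (real CARD('n) / 2))
       * norm (1 + of_real (\<Sum>i\<in>UNIV. 1 / (2 * Re (w i))) * v) powr (- (real CARD('n) / 2))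
       * Re (of_real (\<Sum>i\<in>UNIV. 1 / (2 * Re (w i))) / (1 + of_real (\<Sum>i\<in>UNIV. 1 / (2 * Re (w i))) * v)) powr (- (real CARD('n) / (2 * pp)))
     \<le> C0 * W powr s * Z * (\<Prod>i\<in>UNIV. ((norm (w i))\<^sup>2 / Re (w i)) powr (real CARD('n) / (2 * p i)))"
proof -
  let ?n = "real CARD('n)" and ?K = "gauss_mass TYPE(real^'n)"
  have K: "?K > 0" by (rule gauss_mass_pos)
  have u: "u \<ge> 1" using u_range by simp
  obtain C1 where C1: "C1 \<ge> 0" "\<And>W w v Z. admissible W w v \<Longrightarrow> Z \<ge> 0 \<Longrightarrow>
    (\<And>k::int. shell_mass u w v a (2 powr real_of_int k)
       \<le> ennreal (Z powr u)) \<Longrightarrow> A_norm \<Theta> u s (gauss_multiplier w v a) \<le> ennreal (C1 * W powr s * Z)"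
    using A_norm_gauss_multiplier_le[OF schwartz_imp_rapid[OF Theta_schwartz] _ u s_pos, of a] Theta_supp by blast
  define cT where "cT = ?K ^ (2 * CARD('l)) * (?K * pp powr (- (?n / 2))) powr (1 / pp)"
  define cf where "cf = (\<Prod>i\<in>UNIV. (?K * p i powr (- (?n / 2))) powr (1 / p i))"
  have cT: "cT > 0" using K pp by (simp add: cT_def)
  have cf: "cf \<ge> 0" unfolding cf_def by (intro prod_nonneg) auto
  \<comment> \<open>\<open>max C 0\<close> because \<open>ennreal\<close> truncates a negative
    \<open>C\<close> to 0.\<close>
  define C0 where "C0 = max C 0 * C1 * cf / cT"
  have C0: "C0 \<ge> 0" using C1 cf cT by (simp add: C0_def)
  show ?thesis
  proof (intro exI[of _ C0] conjI allI impI C0)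
    fix W v Z and w :: "'l \<Rightarrow> complex"
    assume adm: "admissible W w v" and Z: "Z \<ge> 0"
      and int: "\<forall>k::int. shell_mass u w v a (2 powr real_of_int k)
       \<le> ennreal (Z powr u)"
    define \<beta> where "\<beta> = (\<Sum>i\<in>UNIV. 1 / (2 * Re (w i)))"
    define \<omega> where "\<omega> = of_real \<beta> / (1 + of_real \<beta> * v)"
    define B where "B = (\<Prod>i\<in>UNIV. (norm (w i) / (2 * Re (w i))) powr (?n / 2)) * norm (1 + of_real \<beta> * v) powr (- (?n / 2))"
    define Q where "Q = (\<Prod>i\<in>UNIV. ((norm (w i))\<^sup>2 / Re (w i)) powr (?n / (2 * p i)))"
    have B: "B \<ge> 0" unfolding B_def by (intro mult_nonneg_nonneg prod_nonneg) auto
    have Q: "Q \<ge> 0" unfolding Q_def by (intro prod_nonneg) auto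
    have w: "Re (w i) > 0" for i using adm by (auto simp: admissible_def intro: less_le_trans[OF zero_less_one])
    have v: "Re v > 0" using adm by (auto simp: admissible_def)
    have W: "W \<ge> 1" using adm by (simp add: admissible_def)
    have \<beta>: "\<beta> > 0" unfolding \<beta>_def using w by (intro sum_pos) auto
    have \<omega>: "Re \<omega> > 0"
    proof -
      have "\<omega> = of_real \<beta> * (1 / (1 + of_real \<beta> * v))" by (simp add: \<omega>_def)
      moreover have "Re (1 / (1 + of_real \<beta> * v)) > 0" using \<beta> v by (intro Re_inverse_pos) (simp add: add_pos_pos)
      ultimately show ?thesis using \<beta>
        by (simp only: times_complex.sel Re_complex_of_real Im_complex_of_real mult_zero_left diff_zero) simp
    qed
    let ?m = "gauss_multiplier w v a" and ?f = "\<lambda>i. mod_gauss (a $ i) (1 / cnj (w i))"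
    have cw: "Re (1 / cnj (w i)) > 0" for i using w by (intro Re_inverse_pos) simp
    \<comment> \<open>The reciprocal \<open>(norm (w i))\<^sup>2 / Re (w i)\<close> is, up to a
      constant, the squared spatial width of the test function; for \<open>i \<in> I\<close> it is
      of order \<open>W\<^sup>2\<close> in both families.\<close>
    have Rew: "Re (1 / cnj (w i)) = Re (w i) / (norm (w i))\<^sup>2" for i
      by (simp add: Re_divide cmod_power2)
    have An: "A_norm \<Theta> u s ?m \<le> ennreal (C1 * W powr s * Z)" using C1(2)[OF adm Z] int by blast
    have "bounded (range ?m)"
      unfolding bounded_iff
    proof (intro exI[of _ 1] ballI)
      fix y assume "y \<in> range ?m"
      then obtain \<xi> where y: "y = ?m \<xi>" by blast
      have "0 \<le> gform w v (\<xi> - a)" using gform_lower(1)[OF adm] by (meson order_trans zero_le_power2)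
      then show "norm y \<le> 1" by (simp add: y norm_gauss_multiplier)
    qed
    moreover have "A_norm \<Theta> u s ?m < top" using An by (simp add: order_le_less_trans)
    moreover have "?m \<in> borel_measurable lborel" by measurable
    ultimately have main: "Lp_norm pp (T_mult ?m ?f) \<le> ennreal C * A_norm \<Theta> u s ?m * (\<Prod>i\<in>UNIV. Lp_norm (p i) (?f i))"
      by (intro bounded[rule_format]) (auto intro!: schwartz_mod_gauss cw)
    have LT: "Lp_norm pp (T_mult ?m ?f) = ennreal (cT * (B * Re \<omega> powr (- (?n / (2 * pp)))))"
    proof -
      have "norm (T_mult ?m ?f x) = (?K ^ (2 * CARD('l)) * B) * norm (gauss \<omega> x)" for x
        unfolding norm_T_mult_gauss[OF w v] B_def \<omega>_def \<beta>_def by (simp only: mult.assoc)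
      from Lp_norm_gauss[OF this _ \<omega> pp]
      have "Lp_norm pp (T_mult ?m ?f) = ennreal ((?K ^ (2 * CARD('l)) * B) * (?K * (pp * Re \<omega>) powr (- (?n / 2))) powr (1 / pp))"
        using B K by simp
      also have "(?K * (pp * Re \<omega>) powr (- (?n / 2))) powr (1 / pp) = (?K * pp powr (- (?n / 2))) powr (1 / pp) * Re \<omega> powr (- (?n / (2 * pp)))"
        by (simp add: powr_mult powr_powr)
      finally show ?thesis by (simp add: cT_def mult_ac)
    qed
    have Lf: "(\<Prod>i\<in>UNIV. Lp_norm (p i) (?f i)) = ennreal (cf * Q)"
    proof -
      have "Lp_norm (p i) (?f i) = ennreal ((?K * p i powr (- (?n / 2))) powr (1 / p i) * ((norm (w i))\<^sup>2 / Re (w i)) powr (?n / (2 * p i)))" for i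
      proof -
        have pi: "p i > 0" using p_range by (meson less_trans zero_less_one)
        have "norm (?f i x) = 1 * norm (gauss (1 / cnj (w i)) x)" for x by (simp add: norm_mod_gauss)
        from Lp_norm_gauss[OF this zero_le_one cw pi]
        have "Lp_norm (p i) (?f i) = ennreal ((?K * (p i * (Re (w i) / (norm (w i))\<^sup>2)) powr (- (?n / 2))) powr (1 / p i))"
          by (simp add: Rew)
        also have "(p i * (Re (w i) / (norm (w i))\<^sup>2)) powr (- (?n / 2)) = p i powr (- (?n / 2)) * ((norm (w i))\<^sup>2 / Re (w i)) powr (?n / 2)"
        proof -
          have "norm (w i) > 0" using w[of i] by (metis complex_Re_le_cmod less_le_trans)
          then have "(Re (w i) / (norm (w i))\<^sup>2) powr (- (?n / 2)) = ((norm (w i))\<^sup>2 / Re (w i)) powr (?n / 2)"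
            using w[of i] by (simp add: powr_def ln_div algebra_simps)
          then show ?thesis by (simp only: powr_mult)
        qed
        also have "(?K * (p i powr (- (?n / 2)) * ((norm (w i))\<^sup>2 / Re (w i)) powr (?n / 2))) powr (1 / p i)
          = (?K * p i powr (- (?n / 2))) powr (1 / p i) * ((norm (w i))\<^sup>2 / Re (w i)) powr (?n / (2 * p i))"
          by (simp only: powr_mult powr_powr mult.assoc[symmetric]) (simp add: mult.commute)
        finally show ?thesis .
      qed
      then show ?thesis
        unfolding cf_def Q_def prod.distrib[symmetric] by (simp add: prod_ennreal)
    qed
    have "ennreal (cT * (B * Re \<omega> powr (- (?n / (2 * pp))))) \<le> ennreal C * A_norm \<Theta> u s ?m * ennreal (cf * Q)"
      using main unfolding LT Lf .
    also have "\<dots> \<le> ennreal (max C 0) * ennreal (C1 * W powr s * Z) * ennreal (cf * Q)"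
      by (intro mult_right_mono mult_mono An ennreal_leI) auto
    also have "\<dots> = ennreal (max C 0 * (C1 * W powr s * Z) * (cf * Q))"
    proof -
      have "ennreal x * ennreal y * ennreal z = ennreal (x * y * z)" if "0 \<le> x" "0 \<le> y" "0 \<le> z" for x y z
        using that by (simp add: ennreal_mult)
      then show ?thesis using C1(1) Z cf Q by (simp only: mult_nonneg_nonneg powr_ge_zero max.cobounded2)
    qed
    finally have "cT * (B * Re \<omega> powr (- (?n / (2 * pp)))) \<le> max C 0 * (C1 * W powr s * Z) * (cf * Q)"
      using C1(1) Z cf Q by (subst (asm) ennreal_le_iff) auto
    then have "B * Re \<omega> powr (- (?n / (2 * pp))) \<le> C0 * W powr s * Z * Q"
      using cT by (simp add: C0_def field_simps)
    then show "(\<Prod>i\<in>UNIV. (norm (w i) / (2 * Re (w i))) powr (?n / 2))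
       * norm (1 + of_real (\<Sum>i\<in>UNIV. 1 / (2 * Re (w i))) * v) powr (- (?n / 2))
       * Re (of_real (\<Sum>i\<in>UNIV. 1 / (2 * Re (w i))) / (1 + of_real (\<Sum>i\<in>UNIV. 1 / (2 * Re (w i))) * v)) powr (- (?n / (2 * pp)))
     \<le> C0 * W powr s * Z * (\<Prod>i\<in>UNIV. ((norm (w i))\<^sup>2 / Re (w i)) powr (?n / (2 * p i)))"
      unfolding B_def \<omega>_def Q_def \<beta>_def .
  qed
qed


section \<open>The chirp family\<close>

lemma prod_if_powr:
  fixes x :: real
  assumes "x > 0"
  shows "(\<Prod>i\<in>(UNIV::'l::finite set). if i \<in> I then x powr e i else 1) = x powr (\<Sum>i\<in>I. e i)"
  using assms by (simp add: prod.If_cases powr_sum)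

text \<open>All real parts are 1, so \<open>Z\<close> can be a constant, while derivatives cost
  \<open>R\<close> and the seminorm grows at most like \<open>R powr s\<close>. In the output each
  \<open>i \<in> I\<close> contributes \<open>R powr (n / 2)\<close>, the coupling
  \<open>R powr (- n / 2)\<close>, and the spreading to width \<open>R\<close> a factor
  \<open>R powr (n / pp)\<close>. An input with \<open>i \<in> I\<close> has width of order
  \<open>R\<close> and norm of order \<open>R powr (n / p i)\<close>. The claim compares the
  exponents.\<close>

lemma chirp_condition:
  fixes \<Theta> :: "real^'n^'l \<Rightarrow> complex" and p :: "'l \<Rightarrow> real" and pp u s C :: real and I :: "'l set"
  assumes Theta_schwartz: "schwartz \<Theta>"
    and Theta_supp: "\<forall>\<xi>. FT \<Theta> \<xi> \<noteq> 0 \<longrightarrow> 1/2 \<le> norm \<xi> \<and> norm \<xi> \<le> 2"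
    and p_range: "\<forall>i. 1 < p i" and pp: "pp > 0" and u_range: "1 < u" and s_pos: "0 < s"
    and bounded: "multiplier_bound \<Theta> u s p pp C"
  shows "real CARD('n) * (1 / pp - 1/2 - (\<Sum>i\<in>I. 1 / p i - 1/2)) \<le> s"
proof -
  let ?n = "real CARD('n)" and ?l = "real CARD('l)"
  let ?U = "annulus :: (real^'n^'l) set"
  obtain C0 where C0: "C0 \<ge> 0" "\<And>W w v Z. admissible W w v \<Longrightarrow> Z \<ge> 0 \<Longrightarrow>
    (\<And>k::int. shell_mass u w v (0 :: real^'n^'l) (2 powr real_of_int k)
       \<le> ennreal (Z powr u)) \<Longrightarrow>
    (\<Prod>i\<in>UNIV. (norm (w i) / (2 * Re (w i))) powr (?n / 2))
       * norm (1 + of_real (\<Sum>i\<in>UNIV. 1 / (2 * Re (w i))) * v) powr (- (?n / 2))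
       * Re (of_real (\<Sum>i\<in>UNIV. 1 / (2 * Re (w i))) / (1 + of_real (\<Sum>i\<in>UNIV. 1 / (2 * Re (w i))) * v)) powr (- (?n / (2 * pp)))
     \<le> C0 * W powr s * Z * (\<Prod>i\<in>UNIV. ((norm (w i))\<^sup>2 / Re (w i)) powr (?n / (2 * p i)))"
    using key_inequality[OF assms, of 0] by blast
  \<comment> \<open>The modulus of the multiplier never exceeds 1, so the volume of a ball
    containing the annulus bounds every shell mass.\<close>
  define V where "V = measure lborel (cball (0 :: real^'n^'l) 2)"
  define Z where "Z = V powr (1 / u)"
  have V: "V \<ge> 0" by (simp add: V_def)
  have Z: "Z \<ge> 0" "Z powr u = V" using V u_range by (auto simp: Z_def powr_powr)
  define \<beta> where "\<beta> = ?l / 2"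
  have \<beta>: "\<beta> > 0" by (simp add: \<beta>_def)
  \<comment> \<open>One factor for each of the three lower bounds \<open>1\<close>, \<open>2\<close>
    and \<open>3\<close> below.\<close>
  define c where "c = ((1/2) powr (?n / 2)) ^ CARD('l) * (1 + 2 * \<beta>) powr (- (?n / 2)) * ((1 + \<beta>) / \<beta>) powr (- (?n / (2 * pp)))"
  define D where "D = C0 * Z * 4 powr (\<Sum>i\<in>I. ?n / (2 * p i))"
  have c: "c > 0" using \<beta> by (simp add: c_def)
  have n0: "?n > 0" by simp
  have "c * R powr ((\<Sum>i\<in>I. ?n / 2) - ?n / 2 + ?n / pp) \<le> D * R powr (s + (\<Sum>i\<in>I. ?n / p i))" if R: "R \<ge> 1" for R
  proof -
    define z where "z = Complex 1 R"
    define w where "w i = (if i \<in> I then z else 1)" for i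
    have z: "Re z = 1" "Im z = R" "(norm z)\<^sup>2 = 1 + R\<^sup>2" by (auto simp: z_def cmod_power2)
    have RR: "1 \<le> R\<^sup>2" using R by simp
    have zR: "R \<le> norm z" using abs_Im_le_cmod[of z] R by (simp add: z)
    have zR2: "norm z \<le> 2 * R"
    proof (rule power2_le_imp_le)
      show "(norm z)\<^sup>2 \<le> (2 * R)\<^sup>2" unfolding z(3) power_mult_distrib using RR by simp
      show "0 \<le> 2 * R" using R by simp
    qed
    have adm: "admissible R w z"
    proof -
      have "1 \<le> 3 * R\<^sup>2" "1 \<le> 4 * R\<^sup>2" using RR by linarith+
      then show ?thesis using R by (auto simp: admissible_def w_def z)
    qed
    have Rw: "Re (w i) = 1" for i by (simp add: w_def z)
    have S: "(\<Sum>i\<in>UNIV. 1 / (2 * Re (w i))) = \<beta>" by (simp add: Rw \<beta>_def)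
    have int: "shell_mass u w z (0 :: real^'n^'l) (2 powr real_of_int k) \<le> ennreal (Z powr u)" for k :: int
    proof -
      have "shell_mass u w z (0 :: real^'n^'l) (2 powr real_of_int k)
         \<le> (\<integral>\<^sup>+ \<xi>. indicator (cball (0 :: real^'n^'l) 2) \<xi> \<partial>lborel)"
      proof (rule nn_integral_mono)
        fix \<xi> :: "real^'n^'l"
        have "0 \<le> gform w z ((2 powr real_of_int k) *\<^sub>R \<xi> - 0)" using gform_lower(1)[OF adm] by (meson order_trans zero_le_power2)
        then show "ennreal (indicator ?U \<xi> * exp (- (u / 2 * gform w z ((2 powr real_of_int k) *\<^sub>R \<xi> - 0)))) \<le> indicator (cball 0 2) \<xi>"
          using u_range by (auto simp: indicator_def)
      qed
      also have "\<dots> = ennreal V" 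
      proof -
        have "emeasure lborel (cball (0 :: real^'n^'l) 2) \<noteq> top" using emeasure_lborel_cball_finite[of "0 :: real^'n^'l" 2] by simp
        from emeasure_eq_ennreal_measure[OF this] show ?thesis by (simp add: V_def)
      qed
      finally show ?thesis by (simp add: Z)
    qed
    have main: "(\<Prod>i\<in>UNIV. (norm (w i) / (2 * Re (w i))) powr (?n / 2))
       * norm (1 + of_real \<beta> * z) powr (- (?n / 2)) * Re (of_real \<beta> / (1 + of_real \<beta> * z)) powr (- (?n / (2 * pp)))
     \<le> C0 * R powr s * Z * (\<Prod>i\<in>UNIV. ((norm (w i))\<^sup>2 / Re (w i)) powr (?n / (2 * p i)))"
      using C0(2)[OF adm Z(1) int] unfolding S .
    have 1: "((1/2) powr (?n / 2)) ^ CARD('l) * R powr (\<Sum>i\<in>I. ?n / 2) \<le> (\<Prod>i\<in>UNIV. (norm (w i) / (2 * Re (w i))) powr (?n / 2))"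
    proof -
      have "((1/2) powr (?n / 2)) ^ CARD('l) * R powr (\<Sum>i\<in>I. ?n / 2) = (\<Prod>i\<in>UNIV. (1/2) powr (?n / 2) * (if i \<in> I then R powr (?n / 2) else 1))"
        using prod_if_powr[of R I "\<lambda>_. ?n / 2"] R by (simp add: prod.distrib)
      also have "\<dots> \<le> (\<Prod>i\<in>UNIV. (norm (w i) / (2 * Re (w i))) powr (?n / 2))"
      proof (rule prod_mono, intro conjI)
        fix i
        show "(1/2) powr (?n / 2) * (if i \<in> I then R powr (?n / 2) else 1) \<le> (norm (w i) / (2 * Re (w i))) powr (?n / 2)"
          using zR R by (auto simp: w_def z powr_mult[symmetric] intro!: powr_mono2)
      qed auto
      finally show ?thesis .
    qed
    have 2: "(1 + 2 * \<beta>) powr (- (?n / 2)) * R powr (- (?n / 2)) \<le> norm (1 + of_real \<beta> * z) powr (- (?n / 2))"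
    proof -
      have "norm (1 + of_real \<beta> * z) \<le> 1 + \<beta> * norm z"
        using norm_triangle_ineq[of 1 "of_real \<beta> * z"] \<beta> by (simp add: norm_mult)
      also have "\<dots> \<le> R + \<beta> * (2 * R)" using zR2 R \<beta> by (intro add_mono mult_left_mono) auto
      also have "\<dots> = (1 + 2 * \<beta>) * R" by (simp add: algebra_simps)
      finally have le: "norm (1 + of_real \<beta> * z) \<le> (1 + 2 * \<beta>) * R" .
      have "Re (1 + of_real \<beta> * z) > 0" using \<beta> by (simp add: z)
      then have "norm (1 + of_real \<beta> * z) > 0" by (metis complex_Re_le_cmod less_le_trans)
      then have "((1 + 2 * \<beta>) * R) powr (- (?n / 2)) \<le> norm (1 + of_real \<beta> * z) powr (- (?n / 2))"
        using le by (intro powr_mono2') auto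
      then show ?thesis by (simp add: powr_mult)
    qed
    \<comment> \<open>The real part of the output weight is at most a multiple of
      \<open>R powr (- 2)\<close>; since it is raised to a negative power, this upper bound becomes
      the lower bound on the output norm.\<close>
    have 3: "((1 + \<beta>) / \<beta>) powr (- (?n / (2 * pp))) * R powr (?n / pp) \<le> Re (of_real \<beta> / (1 + of_real \<beta> * z)) powr (- (?n / (2 * pp)))"
    proof -
      have N: "(norm (1 + of_real \<beta> * z))\<^sup>2 = (1 + \<beta>)\<^sup>2 + (\<beta> * R)\<^sup>2" by (simp add: cmod_power2 z)
      have "Re (of_real \<beta> / (1 + of_real \<beta> * z)) = \<beta> * (1 + \<beta>) / ((1 + \<beta>)\<^sup>2 + (\<beta> * R)\<^sup>2)"
        by (simp add: Re_divide z)
      moreover have "\<beta> * (1 + \<beta>) / ((1 + \<beta>)\<^sup>2 + (\<beta> * R)\<^sup>2) \<le> \<beta> * (1 + \<beta>) / (\<beta> * R)\<^sup>2"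
        using \<beta> R by (intro divide_left_mono mult_nonneg_nonneg mult_pos_pos add_pos_pos) auto
      moreover have "\<beta> * (1 + \<beta>) / (\<beta> * R)\<^sup>2 = (1 + \<beta>) / \<beta> * R powr (- 2)"
        using \<beta> R by (simp add: powr_minus power2_eq_square field_simps)
      moreover have "\<beta> * (1 + \<beta>) / ((1 + \<beta>)\<^sup>2 + (\<beta> * R)\<^sup>2) > 0"
        using \<beta> R by (intro divide_pos_pos mult_pos_pos add_pos_pos) auto
      ultimately have "((1 + \<beta>) / \<beta> * R powr (- 2)) powr (- (?n / (2 * pp))) \<le> Re (of_real \<beta> / (1 + of_real \<beta> * z)) powr (- (?n / (2 * pp)))"
        using pp by (intro powr_mono2') auto
      moreover have "(R powr (- 2)) powr (- (?n / (2 * pp))) = R powr (?n / pp)" using pp by (simp add: powr_powr)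
      ultimately show ?thesis by (simp only: powr_mult)
    qed
    have 4: "(\<Prod>i\<in>UNIV. ((norm (w i))\<^sup>2 / Re (w i)) powr (?n / (2 * p i))) \<le> 4 powr (\<Sum>i\<in>I. ?n / (2 * p i)) * R powr (\<Sum>i\<in>I. ?n / p i)"
    proof -
      have "(\<Prod>i\<in>UNIV. ((norm (w i))\<^sup>2 / Re (w i)) powr (?n / (2 * p i))) \<le> (\<Prod>i\<in>UNIV. if i \<in> I then (4 * R\<^sup>2) powr (?n / (2 * p i)) else 1)"
      proof (rule prod_mono, intro conjI)
        fix i
        have "p i > 0" using p_range by (meson less_trans zero_less_one)
        moreover have "1 + R\<^sup>2 \<le> 4 * R\<^sup>2" using RR by simp
        ultimately show "((norm (w i))\<^sup>2 / Re (w i)) powr (?n / (2 * p i)) \<le> (if i \<in> I then (4 * R\<^sup>2) powr (?n / (2 * p i)) else 1)"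
          by (auto simp: w_def z intro!: powr_mono2)
      qed auto
      also have "\<dots> = (4 * R\<^sup>2) powr (\<Sum>i\<in>I. ?n / (2 * p i))" using R by (intro prod_if_powr) simp
      also have "\<dots> = 4 powr (\<Sum>i\<in>I. ?n / (2 * p i)) * (R powr 2) powr (\<Sum>i\<in>I. ?n / (2 * p i))" using R by (simp add: powr_mult)
      also have "(R powr 2) powr (\<Sum>i\<in>I. ?n / (2 * p i)) = R powr (\<Sum>i\<in>I. ?n / p i)"
        by (simp add: powr_powr sum_distrib_left)
      finally show ?thesis .
    qed
    have "c * R powr ((\<Sum>i\<in>I. ?n / 2) - ?n / 2 + ?n / pp)
      = (((1/2) powr (?n / 2)) ^ CARD('l) * R powr (\<Sum>i\<in>I. ?n / 2)) * ((1 + 2 * \<beta>) powr (- (?n / 2)) * R powr (- (?n / 2)))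
         * (((1 + \<beta>) / \<beta>) powr (- (?n / (2 * pp))) * R powr (?n / pp))"
    proof -
      have "R powr ((\<Sum>i\<in>I. ?n / 2) - ?n / 2 + ?n / pp) = R powr (\<Sum>i\<in>I. ?n / 2) * R powr (- (?n / 2)) * R powr (?n / pp)"
        unfolding powr_add[symmetric] by simp
      then show ?thesis unfolding c_def by (simp only: mult_ac)
    qed
    also have "\<dots> \<le> (\<Prod>i\<in>UNIV. (norm (w i) / (2 * Re (w i))) powr (?n / 2))
       * norm (1 + of_real \<beta> * z) powr (- (?n / 2)) * Re (of_real \<beta> / (1 + of_real \<beta> * z)) powr (- (?n / (2 * pp)))"
      by (intro mult_mono 1 2 3 mult_nonneg_nonneg prod_nonneg) auto
    also have "\<dots> \<le> C0 * R powr s * Z * (\<Prod>i\<in>UNIV. ((norm (w i))\<^sup>2 / Re (w i)) powr (?n / (2 * p i)))" by (rule main)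
    also have "\<dots> \<le> C0 * R powr s * Z * (4 powr (\<Sum>i\<in>I. ?n / (2 * p i)) * R powr (\<Sum>i\<in>I. ?n / p i))"
      using C0(1) Z(1) by (intro mult_left_mono 4) auto
    also have "\<dots> = D * R powr (s + (\<Sum>i\<in>I. ?n / p i))"
      unfolding D_def powr_add by (simp only: mult_ac)
    finally show ?thesis .
  qed
  from exponent_le_of_powr_le[OF c this]
  have le: "(\<Sum>i\<in>I. ?n / 2) - ?n / 2 + ?n / pp \<le> s + (\<Sum>i\<in>I. ?n / p i)" .
  have "?n * (1 / pp - 1/2 - (\<Sum>i\<in>I. 1 / p i - 1/2)) = ?n / pp - ?n / 2 - ((\<Sum>i\<in>I. ?n / p i) - (\<Sum>i\<in>I. ?n / 2))"
    by (simp add: right_diff_distrib sum_distrib_left sum_subtractf)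
  then show ?thesis using le by linarith
qed


section \<open>The bump family\<close>

lemma admissible_bump:
  assumes "W \<ge> 1"
  shows "admissible W (\<lambda>i. if i \<in> I then of_real (W\<^sup>2) else 1) (of_real (W\<^sup>2))"
proof -
  have W: "1 \<le> W\<^sup>2" using assms by simp
  have c: "(norm z)\<^sup>2 \<le> 4 * W\<^sup>2 * Re z \<and> 1 \<le> Re z" if "z = of_real (W\<^sup>2) \<or> z = 1" for z
    using that
  proof
    assume z: "z = of_real (W\<^sup>2)"
    have "W\<^sup>2 * W\<^sup>2 \<le> 4 * W\<^sup>2 * W\<^sup>2" by (intro mult_right_mono) auto
    then show ?thesis using W by (simp add: z norm_power power2_eq_square[of "W\<^sup>2"] del: of_real_power)
  next
    assume "z = 1"
    moreover have "1 \<le> 4 * W\<^sup>2" using W by linarith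
    ultimately show ?thesis by simp
  qed
  show ?thesis unfolding admissible_def
  proof (intro conjI allI)
    fix i
    let ?z = "if i \<in> I then complex_of_real (W\<^sup>2) else 1"
    have "?z = of_real (W\<^sup>2) \<or> ?z = 1" by (simp only: split: if_split) blast
    from c[OF this] show "1 \<le> Re ?z" "(norm ?z)\<^sup>2 \<le> 4 * W\<^sup>2 * Re ?z" by blast+
  qed (use assms c[of "of_real (W\<^sup>2)"] in blast)+
qed

text \<open>\<mu> counts the blocks of \<open>n\<close> variables in which the multiplier is
  confined to width \<open>1 / W\<close>: those in \<open>I\<close>, and one more through the sum of
  all blocks, unless \<open>I\<close> is everything and the sum is confined already. Each confined
  block contributes \<open>W powr (- n)\<close>.\<close>

lemma bump_mass_le:
  fixes I :: "'l::finite set" and a :: "real^'n^'l"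
  assumes u: "u > 0" and a: "\<And>i. a $ i = e" "norm e = 1"
  defines "\<mu> \<equiv> real (card I) + (if I = UNIV then 0 else 1)"
  shows "\<exists>C\<ge>0. \<forall>W\<ge>1. \<forall>k::int.
    shell_mass u (\<lambda>i. if i \<in> I then of_real (W\<^sup>2) else 1) (of_real (W\<^sup>2)) a (2 powr real_of_int k)
    \<le> ennreal (C * W powr (- (real CARD('n) * \<mu>)))"
proof -
  let ?n = "real CARD('n)" and ?K = "gauss_mass TYPE(real^'n)" and ?l = "real CARD('l)"
  let ?U = "annulus :: (real^'n^'l) set"
  let ?w = "\<lambda>W i. if i \<in> I then complex_of_real (W\<^sup>2) else 1" and ?v = "\<lambda>W. complex_of_real (W\<^sup>2)"
  have K: "?K > 0" by (rule gauss_mass_pos)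
  have l1: "?l \<ge> 1" by (simp add: Suc_leI)
  have \<mu>: "\<mu> > 0"
    unfolding \<mu>_def by (auto intro: add_nonneg_pos)
  note adm = admissible_bump[of _ I]
  define Ca where "Ca = 4 ^ DIM(real^'n^'l) * (?K ^ CARD('l) * ((u / 2) powr (- (?n / 2))) ^ CARD('l))"
  define V where "V = measure lborel (cball (0 :: real^'n^'l) 2)"
  \<comment> \<open>Chosen so that \<open>(W\<^sup>2) powr (- ?\<nu>)\<close> is the target power of
    \<open>W\<close>.\<close>
  let ?\<nu> = "?n * \<mu> / 2"
  define Cb where "Cb = V * exp (?\<nu> * ln (?\<nu> / (u / 8)))"
  have Ca: "Ca \<ge> 0" using K by (simp add: Ca_def)
  have V: "V \<ge> 0" by (simp add: V_def)
  then have Cb: "Cb \<ge> 0" by (simp add: Cb_def)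
  have nu: "?\<nu> > 0" using \<mu> by simp
  \<comment> \<open>For dilations bounded below the annulus may be dropped: rescaling the integral
    over all of space costs at most \<open>4 ^ DIM(real^'n^'l)\<close>.\<close>
  have large: "shell_mass u (?w W) (?v W) a c
    \<le> ennreal (Ca * W powr (- (?n * \<mu>)))" if W: "W \<ge> 1" and c: "c \<ge> 1/4" for W c :: real
  proof -
    have c0: "c > 0" using c by simp
    have W0: "W > 0" using W by simp
    \<comment> \<open>Raising the Gaussian to the power \<open>u / 2\<close> multiplies all weights
      by \<open>u / 2\<close>, so \<open>gauss_form_integral\<close> at \<open>x = 0\<close>
      evaluates the mass exactly.\<close>
    define b where "b i = (if i \<in> I then u / 2 * W\<^sup>2 else u / 2)" for i
    have b: "b i > 0" for i using u W0 by (simp add: b_def)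
    have v: "Re (of_real (u / 2 * W\<^sup>2)) > 0" using u W0 by simp
    define \<beta> where "\<beta> = (\<Sum>i\<in>UNIV. 1 / b i)"
    have \<beta>: "\<beta> > 0" unfolding \<beta>_def using b by (intro sum_pos) auto
    let ?h = "\<lambda>\<eta>::real^'n^'l. exp (- (u / 2 * gform (?w W) (?v W) \<eta>))"
    have eq: "(\<Prod>i\<in>UNIV. gauss (of_real (b i)) (\<eta> $ i)) * gauss (of_real (u / 2 * W\<^sup>2)) (\<Sum>i\<in>UNIV. \<eta> $ i) = of_real (?h \<eta>)" for \<eta> :: "real^'n^'l"
    proof -
      have "(\<Prod>i\<in>UNIV. gauss (of_real (b i)) (\<eta> $ i)) * gauss (of_real (u / 2 * W\<^sup>2)) (\<Sum>i\<in>UNIV. \<eta> $ i)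
        = of_real ((\<Prod>i\<in>UNIV. exp (- (pi * b i * (norm (\<eta> $ i))\<^sup>2))) * exp (- (pi * (u / 2 * W\<^sup>2) * (norm (\<Sum>i\<in>UNIV. \<eta> $ i))\<^sup>2)))"
        unfolding gauss_of_real unfolding of_real_mult of_real_prod ..
      also have "(\<Prod>i\<in>UNIV. exp (- (pi * b i * (norm (\<eta> $ i))\<^sup>2))) = exp (- (u / 2 * (pi * (\<Sum>i\<in>UNIV. Re (?w W i) * (norm (\<eta> $ i))\<^sup>2))))"
      proof -
        have "pi * b i * (norm (\<eta> $ i))\<^sup>2 = u / 2 * (pi * (Re (?w W i) * (norm (\<eta> $ i))\<^sup>2))" for i
          by (simp add: b_def)
        then show ?thesis
          by (simp only: exp_sum[symmetric] finite sum_negf sum_distrib_left)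
      qed
      also have "\<dots> * exp (- (pi * (u / 2 * W\<^sup>2) * (norm (\<Sum>i\<in>UNIV. \<eta> $ i))\<^sup>2)) = ?h \<eta>"
        by (simp add: gform_def exp_add[symmetric] algebra_simps)
      finally show ?thesis .
    qed
    have G: "(\<integral>\<^sup>+ \<eta>. ennreal (?h \<eta>) \<partial>lborel) = ennreal (?K ^ CARD('l) * (\<Prod>i\<in>UNIV. b i powr (- (?n / 2))) * norm (1 + of_real \<beta> * of_real (u / 2 * W\<^sup>2) :: complex) powr (- (?n / 2)))"
    proof -
      have int: "integrable lborel ?h"
      proof (rule Bochner_Integration.integrable_bound)
        show "integrable lborel (\<lambda>\<eta>::real^'n^'l. exp (- (pi * (u / 2 / pi) * (norm \<eta>)\<^sup>2)))"
          using u by (intro integrable_real_gauss) simp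
        show "AE \<eta> in lborel. norm (?h \<eta>) \<le> norm (exp (- (pi * (u / 2 / pi) * (norm (\<eta>::real^'n^'l))\<^sup>2)))"
          using gform_lower(1)[OF adm[OF W]] u by (intro AE_I2) (simp add: mult_left_mono)
      qed measurable
      have "(\<integral>\<^sup>+ \<eta>. ennreal (?h \<eta>) \<partial>lborel) = ennreal (LINT \<eta>|lborel. ?h \<eta>)"
        using int by (intro nn_integral_eq_integral) auto
      also have "(LINT \<eta>|lborel. ?h \<eta>) = norm (LINT \<eta>|lborel. complex_of_real (?h \<eta>))"
        by (simp add: integral_nonneg_AE)
      also have "\<dots> = norm (LINT \<eta>|lborel. (\<Prod>i\<in>UNIV. gauss (of_real (b i)) (\<eta> $ i)) * gauss (of_real (u / 2 * W\<^sup>2)) (\<Sum>i\<in>UNIV. \<eta> $ i)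
           * cis (2 * pi * ((0::real^'n) \<bullet> (\<Sum>i\<in>UNIV. \<eta> $ i))))"
        unfolding eq by simp
      also have "\<dots> = ?K ^ CARD('l) * (\<Prod>i\<in>UNIV. b i powr (- (?n / 2))) * norm (1 + of_real \<beta> * of_real (u / 2 * W\<^sup>2) :: complex) powr (- (?n / 2))"
        unfolding gauss_form_integral[OF b v] \<beta>_def by simp
      finally show ?thesis .
    qed
    have P: "(\<Prod>i\<in>UNIV. b i powr (- (?n / 2))) = ((u / 2) powr (- (?n / 2))) ^ CARD('l) * W powr (- (?n * real (card I)))"
    proof -
      have "b i powr (- (?n / 2)) = (u / 2) powr (- (?n / 2)) * (if i \<in> I then W powr (- ?n) else 1)" for i
      proof -
        have "(W\<^sup>2) powr (- (?n / 2)) = (W powr 2) powr (- (?n / 2))" using W0 by simp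
        also have "\<dots> = W powr (- ?n)" by (simp only: powr_powr) simp
        finally have e: "(u / 2 * W\<^sup>2) powr (- (?n / 2)) = (u / 2) powr (- (?n / 2)) * W powr (- ?n)" by (simp only: powr_mult)
        show ?thesis unfolding b_def using e by (cases "i \<in> I") (simp_all only: if_True if_False mult_1_right)
      qed
      then show ?thesis using prod_if_powr[OF W0, of I "\<lambda>_. - ?n"] by (simp add: prod.distrib mult.commute)
    qed
    \<comment> \<open>An unconfined block bounds \<beta> below by its own reciprocal weight, and the
      coupling then supplies the additional \<open>W powr (- n)\<close>. If all blocks are confined,
      \<beta> is of order \<open>W powr (- 2)\<close> and the bound by 1 loses just a
      constant.\<close>
    have N: "norm (1 + of_real \<beta> * of_real (u / 2 * W\<^sup>2) :: complex) powr (- (?n / 2)) \<le> W powr (- (?n * (if I = UNIV then 0 else 1)))"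
    proof -
      have x: "norm (1 + of_real \<beta> * of_real (u / 2 * W\<^sup>2) :: complex) = 1 + \<beta> * (u / 2 * W\<^sup>2)"
      proof -
        have "(1 + of_real \<beta> * of_real (u / 2 * W\<^sup>2) :: complex) = of_real (1 + \<beta> * (u / 2 * W\<^sup>2))" by simp
        moreover have "1 + \<beta> * (u / 2 * W\<^sup>2) \<ge> 0" using \<beta> u by simp
        ultimately show ?thesis by (simp only: norm_of_real abs_of_nonneg)
      qed
      show ?thesis
      proof (cases "I = UNIV")
        case True
        have "(1 + \<beta> * (u / 2 * W\<^sup>2)) powr (- (?n / 2)) \<le> 1 powr (- (?n / 2))"
          using \<beta> u by (intro powr_mono2') auto
        then show ?thesis unfolding x using True W0 by simp
      next
        case False
        then obtain j where j: "j \<notin> I" by blast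
        have "1 / b j \<le> \<beta>" unfolding \<beta>_def using b by (intro member_le_sum) (auto simp: less_imp_le)
        then have "1 / (u / 2) * (u / 2 * W\<^sup>2) \<le> \<beta> * (u / 2 * W\<^sup>2)" using j u by (intro mult_right_mono) (auto simp: b_def)
        then have le: "W\<^sup>2 \<le> 1 + \<beta> * (u / 2 * W\<^sup>2)" using u by simp
        have "(1 + \<beta> * (u / 2 * W\<^sup>2)) powr (- (?n / 2)) \<le> (W\<^sup>2) powr (- (?n / 2))"
          using le W0 by (intro powr_mono2') auto
        also have "\<dots> = (W powr 2) powr (- (?n / 2))" using W0 by simp
        also have "\<dots> = W powr (- ?n)" by (simp only: powr_powr) simp
        finally show ?thesis unfolding x using False by simp
      qed
    qed
    have "(\<integral>\<^sup>+ \<xi>. ennreal (indicator ?U \<xi> * ?h (c *\<^sub>R \<xi> - a)) \<partial>lborel) \<le> (\<integral>\<^sup>+ \<xi>. ennreal (?h (c *\<^sub>R \<xi> - a)) \<partial>lborel)"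
      by (intro nn_integral_mono ennreal_leI) (simp add: indicator_def)
    also have "\<dots> = ennreal ((1 / c) ^ DIM(real^'n^'l)) * (\<integral>\<^sup>+ \<eta>. ennreal (?h \<eta>) \<partial>lborel)"
      using c0 by (intro nn_integral_lborel_affine) auto
    also have "\<dots> \<le> ennreal (4 ^ DIM(real^'n^'l)) * (\<integral>\<^sup>+ \<eta>. ennreal (?h \<eta>) \<partial>lborel)"
      using c c0 by (intro mult_right_mono ennreal_leI power_mono) (auto simp: field_simps)
    also have "\<dots> = ennreal (4 ^ DIM(real^'n^'l) * (?K ^ CARD('l) * (\<Prod>i\<in>UNIV. b i powr (- (?n / 2))) * norm (1 + of_real \<beta> * of_real (u / 2 * W\<^sup>2) :: complex) powr (- (?n / 2))))"
      unfolding G using K by (intro ennreal_mult[symmetric] mult_nonneg_nonneg prod_nonneg) auto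
    also have "\<dots> \<le> ennreal (4 ^ DIM(real^'n^'l) * (?K ^ CARD('l) * (((u / 2) powr (- (?n / 2))) ^ CARD('l) * W powr (- (?n * real (card I)))) * W powr (- (?n * (if I = UNIV then 0 else 1)))))"
      unfolding P using K by (intro ennreal_leI mult_left_mono N) auto
    also have "4 ^ DIM(real^'n^'l) * (?K ^ CARD('l) * (((u / 2) powr (- (?n / 2))) ^ CARD('l) * W powr (- (?n * real (card I)))) * W powr (- (?n * (if I = UNIV then 0 else 1))))
       = Ca * W powr (- (?n * \<mu>))"
    proof -
      have "W powr (- (?n * \<mu>)) = W powr (- (?n * real (card I))) * W powr (- (?n * (if I = UNIV then 0 else 1)))"
        unfolding powr_add[symmetric] \<mu>_def by (simp add: algebra_simps)
      then show ?thesis unfolding Ca_def by (simp only: mult.assoc)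
    qed
    finally show ?thesis .
  qed
  \<comment> \<open>Small dilations map the annulus near the origin:
    \<open>norm (c *\<^sub>R \<xi>)\<close> is below 1/2, so its blocks sum to at most half of
    \<open>CARD('l)\<close>, while the \<open>a $ i\<close> sum to a vector of length
    \<open>CARD('l)\<close>. The sum of the offsets therefore has length at least 1/2, and the
    square 1/4 turns \<open>u / 2\<close> into \<open>u / 8\<close>.\<close>
  have small: "shell_mass u (?w W) (?v W) a c
    \<le> ennreal (Cb * W powr (- (?n * \<mu>)))" if W: "W \<ge> 1" and c: "c > 0" "c < 1/4" for W c :: real
  proof -
    have W0: "W > 0" using W by simp
    have ptw: "indicator ?U \<xi> * exp (- (u / 2 * gform (?w W) (?v W) (c *\<^sub>R \<xi> - a))) \<le> exp (- (u / 8 * W\<^sup>2)) * indicator (cball 0 2) \<xi>" for \<xi>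
    proof (cases "\<xi> \<in> ?U")
      case True
      have "norm (\<Sum>i\<in>UNIV. \<xi> $ i) \<le> (\<Sum>i\<in>(UNIV::'l set). 2)"
        using True order_trans[OF Finite_Cartesian_Product.norm_nth_le[of \<xi>]] by (intro sum_norm_le) auto
      then have "c * norm (\<Sum>i\<in>UNIV. \<xi> $ i) \<le> 1/4 * (2 * ?l)"
        using c by (intro mult_mono) auto
      moreover have "(\<Sum>i\<in>UNIV. (c *\<^sub>R \<xi> - a) $ i) = c *\<^sub>R (\<Sum>i\<in>UNIV. \<xi> $ i) - ?l *\<^sub>R e"
        by (simp add: sum_subtractf scaleR_sum_right a sum_constant_scaleR del: sum_constant)
      moreover have "norm (?l *\<^sub>R e) - norm (c *\<^sub>R (\<Sum>i\<in>UNIV. \<xi> $ i)) \<le> norm (c *\<^sub>R (\<Sum>i\<in>UNIV. \<xi> $ i) - ?l *\<^sub>R e)"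
        by (metis norm_minus_commute norm_triangle_ineq2)
      ultimately have "1/2 \<le> norm (\<Sum>i\<in>UNIV. (c *\<^sub>R \<xi> - a) $ i)"
        using c l1 by (simp only: norm_scaleR a(2))
      then have "(1/2)\<^sup>2 \<le> (norm (\<Sum>i\<in>UNIV. (c *\<^sub>R \<xi> - a) $ i))\<^sup>2" by (intro power_mono) auto
      then have "W\<^sup>2 * (1/4) \<le> W\<^sup>2 * (norm (\<Sum>i\<in>UNIV. (c *\<^sub>R \<xi> - a) $ i))\<^sup>2" by (intro mult_left_mono) (auto simp: power2_eq_square)
      also have "\<dots> \<le> gform (?w W) (?v W) (c *\<^sub>R \<xi> - a)" using gform_lower(3)[OF adm[OF W], of "c *\<^sub>R \<xi> - a"] by simp
      finally have "u / 2 * (W\<^sup>2 * (1/4)) \<le> u / 2 * gform (?w W) (?v W) (c *\<^sub>R \<xi> - a)" using u by (intro mult_left_mono) auto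
      then show ?thesis using True by simp
    qed simp
    have "exp (- (u / 8 * W\<^sup>2)) \<le> exp (?\<nu> * ln (?\<nu> / (u / 8))) * (W\<^sup>2) powr (- ?\<nu>)"
      using u nu W0 by (intro exp_minus_le_powr) auto
    also have "(W\<^sup>2) powr (- ?\<nu>) = W powr (- (?n * \<mu>))"
    proof -
      have "(W\<^sup>2) powr (- ?\<nu>) = (W powr 2) powr (- ?\<nu>)" using W0 by simp
      then show ?thesis by (simp only: powr_powr) simp
    qed
    finally have ex: "exp (- (u / 8 * W\<^sup>2)) \<le> exp (?\<nu> * ln (?\<nu> / (u / 8))) * W powr (- (?n * \<mu>))" .
    have "shell_mass u (?w W) (?v W) a c
      \<le> (\<integral>\<^sup>+ \<xi>. ennreal (exp (- (u / 8 * W\<^sup>2))) * indicator (cball (0::real^'n^'l) 2) \<xi> \<partial>lborel)"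
    proof (rule nn_integral_mono)
      fix \<xi>
      show "ennreal (indicator ?U \<xi> * exp (- (u / 2 * gform (?w W) (?v W) (c *\<^sub>R \<xi> - a)))) \<le> ennreal (exp (- (u / 8 * W\<^sup>2))) * indicator (cball 0 2) \<xi>"
        using ennreal_leI[OF ptw[of \<xi>]] by (simp add: ennreal_mult ennreal_indicator)
    qed
    also have "\<dots> = ennreal (exp (- (u / 8 * W\<^sup>2))) * ennreal V"
    proof -
      have "emeasure lborel (cball (0 :: real^'n^'l) 2) \<noteq> top" using emeasure_lborel_cball_finite[of "0 :: real^'n^'l" 2] by simp
      from emeasure_eq_ennreal_measure[OF this] show ?thesis by (simp add: V_def nn_integral_cmult_indicator)
    qed
    also have "\<dots> = ennreal (exp (- (u / 8 * W\<^sup>2)) * V)" using V by (simp add: ennreal_mult)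
    also have "\<dots> \<le> ennreal (exp (?\<nu> * ln (?\<nu> / (u / 8))) * W powr (- (?n * \<mu>)) * V)"
      using V by (intro ennreal_leI mult_right_mono ex) auto
    also have "exp (?\<nu> * ln (?\<nu> / (u / 8))) * W powr (- (?n * \<mu>)) * V = Cb * W powr (- (?n * \<mu>))"
      unfolding Cb_def by (simp only: mult_ac)
    finally show ?thesis .
  qed
  show ?thesis
  proof (intro exI[of _ "max Ca Cb"] conjI allI impI)
    show "0 \<le> max Ca Cb" using Ca by simp
    fix W :: real and k :: int assume W: "W \<ge> 1"
    let ?c = "2 powr real_of_int k"
    have m: "ennreal (x * W powr (- (?n * \<mu>))) \<le> ennreal (max Ca Cb * W powr (- (?n * \<mu>)))" if "x \<le> max Ca Cb" for x
      using that by (intro ennreal_leI mult_right_mono) auto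
    show "shell_mass u (?w W) (?v W) a ?c
      \<le> ennreal (max Ca Cb * W powr (- (?n * \<mu>)))"
    proof (cases "?c \<ge> 1/4")
      case True
      show ?thesis by (rule order_trans[OF large[OF W True] m]) simp
    next
      case False
      show ?thesis by (rule order_trans[OF small[OF W] m]) (use False in auto)
    qed
  qed
qed


text \<open>The weights are real, so the blocks give no gain in the output; the gain is the factor
  \<open>W powr (- n * \<mu> / u)\<close> of the seminorm, set against its growth
  \<open>W powr s\<close>. The output has width at least of order \<open>W\<close>, which gives
  \<open>W powr (n / pp)\<close>, and the coupling costs \<open>W powr (- n * \<theta>)\<close>. An
  input with \<open>i \<in> I\<close> has norm of order \<open>W powr (n / p i)\<close>.\<close>

lemma bump_condition:
  fixes \<Theta> :: "real^'n^'l \<Rightarrow> complex" and p :: "'l \<Rightarrow> real" and pp u s C :: real and I :: "'l set"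
  assumes Theta_schwartz: "schwartz \<Theta>"
    and Theta_supp: "\<forall>\<xi>. FT \<Theta> \<xi> \<noteq> 0 \<longrightarrow> 1/2 \<le> norm \<xi> \<and> norm \<xi> \<le> 2"
    and p_range: "\<forall>i. 1 < p i" and pp: "pp > 0" and u_range: "1 < u" and s_pos: "0 < s"
    and bounded: "multiplier_bound \<Theta> u s p pp C"
  defines "\<theta> \<equiv> (if I = UNIV then 0 else 1)"
  shows "real CARD('n) * (1 / pp - \<theta> + (real (card I) + \<theta>) / u - (\<Sum>i\<in>I. 1 / p i)) \<le> s"
proof -
  let ?n = "real CARD('n)" and ?l = "real CARD('l)"
  let ?U = "annulus :: (real^'n^'l) set"
  define \<mu> where "\<mu> = real (card I) + \<theta>"
  \<comment> \<open>Repeating one unit vector in every block gives the sum of the centres length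
    \<open>CARD('l)\<close>, the separation from 0 exploited by \<open>bump_mass_le\<close>.\<close>
  define e :: "real^'n" where "e = (SOME b. b \<in> Basis)"
  have "e \<in> Basis" unfolding e_def by (rule someI_ex) (use nonempty_Basis in blast)
  then have e: "norm e = 1" by simp
  define a :: "real^'n^'l" where "a = (\<chi> i. e)"
  have a: "a $ i = e" for i by (simp add: a_def)
  let ?w = "\<lambda>W i. if i \<in> I then complex_of_real (W\<^sup>2) else 1" and ?v = "\<lambda>W. complex_of_real (W\<^sup>2)"
  obtain C0 where C0: "C0 \<ge> 0" "\<And>W w v Z. admissible W w v \<Longrightarrow> Z \<ge> 0 \<Longrightarrow>
    (\<And>k::int. shell_mass u w v a (2 powr real_of_int k)
       \<le> ennreal (Z powr u)) \<Longrightarrow>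
    (\<Prod>i\<in>UNIV. (norm (w i) / (2 * Re (w i))) powr (?n / 2))
       * norm (1 + of_real (\<Sum>i\<in>UNIV. 1 / (2 * Re (w i))) * v) powr (- (?n / 2))
       * Re (of_real (\<Sum>i\<in>UNIV. 1 / (2 * Re (w i))) / (1 + of_real (\<Sum>i\<in>UNIV. 1 / (2 * Re (w i))) * v)) powr (- (?n / (2 * pp)))
     \<le> C0 * W powr s * Z * (\<Prod>i\<in>UNIV. ((norm (w i))\<^sup>2 / Re (w i)) powr (?n / (2 * p i)))"
    using key_inequality[OF assms(1-7), of a] by blast
  have u0: "u > 0" using u_range by simp
  obtain C1 where C1: "C1 \<ge> 0" "\<And>W k::int. W \<ge> 1 \<Longrightarrow>
    shell_mass u (?w W) (?v W) a (2 powr real_of_int k)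
    \<le> ennreal (C1 * W powr (- (?n * \<mu>)))"
    using bump_mass_le[OF u0 a e, of I] unfolding \<mu>_def \<theta>_def by blast
  define c where "c = ((1/2) powr (?n / 2)) ^ CARD('l) * (1 + ?l) powr (- (?n / 2))"
  define D where "D = C0 * C1 powr (1 / u)"
  have c: "c > 0" by (simp add: c_def)
  have "c * W powr (- (?n * \<theta>) + ?n / pp) \<le> D * W powr (s - ?n * \<mu> / u + (\<Sum>i\<in>I. ?n / p i))" if W: "W \<ge> 1" for W
  proof -
    have W0: "W > 0" using W by simp
    have W1: "1 \<le> W\<^sup>2" using W by simp
    note adm = admissible_bump[OF W, of I]
    define Z where "Z = (C1 * W powr (- (?n * \<mu>))) powr (1 / u)"
    have Z: "Z \<ge> 0" "Z powr u = C1 * W powr (- (?n * \<mu>))" using C1(1) u0 by (auto simp: Z_def powr_powr)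
    define \<beta> where "\<beta> = (\<Sum>i\<in>UNIV. 1 / (2 * Re (?w W i)))"
    have \<beta>: "\<beta> > 0" unfolding \<beta>_def using W0 by (intro sum_pos) auto
    have main: "(\<Prod>i\<in>UNIV. (norm (?w W i) / (2 * Re (?w W i))) powr (?n / 2))
       * norm (1 + of_real \<beta> * ?v W) powr (- (?n / 2)) * Re (of_real \<beta> / (1 + of_real \<beta> * ?v W)) powr (- (?n / (2 * pp)))
     \<le> C0 * W powr s * Z * (\<Prod>i\<in>UNIV. ((norm (?w W i))\<^sup>2 / Re (?w W i)) powr (?n / (2 * p i)))"
      using C0(2)[OF adm Z(1)] C1(2)[OF W] unfolding Z(2) \<beta>_def by blast
    have 1: "(\<Prod>i\<in>UNIV. (norm (?w W i) / (2 * Re (?w W i))) powr (?n / 2)) = ((1/2) powr (?n / 2)) ^ CARD('l)"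
    proof -
      have "norm (?w W i) / (2 * Re (?w W i)) = 1/2" for i using W0 by (simp add: norm_power)
      then show ?thesis by (simp only: prod_constant)
    qed
    have x: "(1 + of_real \<beta> * ?v W) = complex_of_real (1 + \<beta> * W\<^sup>2)" by simp
    have pos: "1 + \<beta> * W\<^sup>2 > 0" using \<beta> by (simp add: add_pos_nonneg)
    have 2: "(1 + ?l) powr (- (?n / 2)) * W powr (- (?n * \<theta>)) \<le> norm (1 + of_real \<beta> * ?v W) powr (- (?n / 2))"
    proof -
      \<comment> \<open>\<beta> is of order \<open>W powr (- 2)\<close> when every weight is large
        and at most \<open>CARD('l)\<close> otherwise; the exponent \<theta> covers both cases in
        one formula.\<close>
      have "1 + \<beta> * W\<^sup>2 \<le> (1 + ?l) * (W powr 2) powr \<theta>"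
      proof (cases "I = UNIV")
        case True
        then have "\<beta> * W\<^sup>2 = ?l / 2" using W0 by (simp add: \<beta>_def)
        then show ?thesis using True W0 by (simp add: \<theta>_def)
      next
        case False
        have "\<beta> \<le> (\<Sum>i\<in>(UNIV::'l set). 1)"
        proof -
          have "1 / (2 * W\<^sup>2) \<le> 1" using W1 by (subst divide_le_eq_1_pos) linarith+
          then show ?thesis unfolding \<beta>_def by (intro sum_mono) auto
        qed
        then have "\<beta> * W\<^sup>2 \<le> ?l * W\<^sup>2" by (intro mult_right_mono) auto
        then have "1 + \<beta> * W\<^sup>2 \<le> (1 + ?l) * W\<^sup>2" using W1 by (simp add: distrib_right)
        then show ?thesis using False W0 by (simp add: \<theta>_def)
      qed
      then have "((1 + ?l) * (W powr 2) powr \<theta>) powr (- (?n / 2)) \<le> (1 + \<beta> * W\<^sup>2) powr (- (?n / 2))"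
        using pos by (intro powr_mono2') auto
      moreover have "((W powr 2) powr \<theta>) powr (- (?n / 2)) = W powr (- (?n * \<theta>))"
        by (simp only: powr_powr) (simp add: mult_ac)
      ultimately show ?thesis
        unfolding x norm_of_real abs_of_pos[OF pos] powr_mult by simp
    qed
    have 3: "W powr (?n / pp) \<le> Re (of_real \<beta> / (1 + of_real \<beta> * ?v W)) powr (- (?n / (2 * pp)))"
    proof -
      have r: "Re (of_real \<beta> / (1 + of_real \<beta> * ?v W)) = \<beta> / (1 + \<beta> * W\<^sup>2)"
        unfolding x of_real_divide[symmetric] by simp
      have "\<beta> / (1 + \<beta> * W\<^sup>2) \<le> W powr (- 2)"
        using pos W0 by (simp add: powr_minus field_simps)
      moreover have "\<beta> / (1 + \<beta> * W\<^sup>2) > 0" using \<beta> pos by simp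
      ultimately have "(W powr (- 2)) powr (- (?n / (2 * pp))) \<le> Re (of_real \<beta> / (1 + of_real \<beta> * ?v W)) powr (- (?n / (2 * pp)))"
        unfolding r using pp by (intro powr_mono2') auto
      moreover have "(W powr (- 2)) powr (- (?n / (2 * pp))) = W powr (?n / pp)" using pp by (simp add: powr_powr)
      ultimately show ?thesis by simp
    qed
    have 4: "(\<Prod>i\<in>UNIV. ((norm (?w W i))\<^sup>2 / Re (?w W i)) powr (?n / (2 * p i))) = W powr (\<Sum>i\<in>I. ?n / p i)"
    proof -
      have "((norm (?w W i))\<^sup>2 / Re (?w W i)) powr (?n / (2 * p i)) = (if i \<in> I then W powr (?n / p i) else 1)" for i
      proof (cases "i \<in> I")
        case True
        have "(norm (?w W i))\<^sup>2 / Re (?w W i) = W\<^sup>2"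
          using True W0 by (simp add: norm_power) (simp add: eval_nat_numeral)
        also have "\<dots> = W powr 2" using W0 by simp
        finally have "((norm (?w W i))\<^sup>2 / Re (?w W i)) powr (?n / (2 * p i)) = (W powr 2) powr (?n / (2 * p i))" by simp
        also have "\<dots> = W powr (?n / p i)" by (simp only: powr_powr) simp
        finally show ?thesis using True by simp
      qed simp
      then show ?thesis using prod_if_powr[OF W0, of I "\<lambda>i. ?n / p i"] by simp
    qed
    have Ze: "Z = C1 powr (1 / u) * W powr (- (?n * \<mu> / u))"
      unfolding Z_def powr_mult powr_powr by simp
    have "c * W powr (- (?n * \<theta>) + ?n / pp)
      = ((1/2) powr (?n / 2)) ^ CARD('l) * ((1 + ?l) powr (- (?n / 2)) * W powr (- (?n * \<theta>))) * W powr (?n / pp)"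
      unfolding c_def powr_add by (simp only: mult_ac)
    also have "\<dots> \<le> (\<Prod>i\<in>UNIV. (norm (?w W i) / (2 * Re (?w W i))) powr (?n / 2))
       * norm (1 + of_real \<beta> * ?v W) powr (- (?n / 2)) * Re (of_real \<beta> / (1 + of_real \<beta> * ?v W)) powr (- (?n / (2 * pp)))"
      unfolding 1 by (intro mult_mono 2 3 mult_nonneg_nonneg order_refl) auto
    also have "\<dots> \<le> C0 * W powr s * Z * W powr (\<Sum>i\<in>I. ?n / p i)" using main unfolding 4 .
    also have "\<dots> = D * W powr (s - ?n * \<mu> / u + (\<Sum>i\<in>I. ?n / p i))"
    proof -
      have "W powr (s - ?n * \<mu> / u + (\<Sum>i\<in>I. ?n / p i)) = W powr s * W powr (- (?n * \<mu> / u)) * W powr (\<Sum>i\<in>I. ?n / p i)"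
        unfolding powr_add[symmetric] by simp
      then show ?thesis unfolding D_def Ze by (simp only: mult_ac)
    qed
    finally show ?thesis .
  qed
  from exponent_le_of_powr_le[OF c this]
  have le: "- (?n * \<theta>) + ?n / pp \<le> s - ?n * \<mu> / u + (\<Sum>i\<in>I. ?n / p i)" .
  have "?n * (1 / pp - \<theta> + (real (card I) + \<theta>) / u - (\<Sum>i\<in>I. 1 / p i)) = ?n / pp - ?n * \<theta> + ?n * \<mu> / u - (\<Sum>i\<in>I. ?n / p i)"
    unfolding \<mu>_def[symmetric] by (simp add: right_diff_distrib distrib_left sum_distrib_left)
  then show ?thesis using le by linarith
qed

theorem theorem6p1:
  fixes \<Theta> :: "real^'n^'l \<Rightarrow> complex"
    and p :: "'l \<Rightarrow> real" and pp u u' s C :: real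
  assumes Theta_schwartz: "schwartz \<Theta>"
    and Theta_supp: "\<forall>\<xi>. FT \<Theta> \<xi> \<noteq> 0 \<longrightarrow> 1/2 \<le> norm \<xi> \<and> norm \<xi> \<le> 2"
    and p_range: "\<forall>i. 1 < p i"
    and pp_def: "1 / pp = (\<Sum>i\<in>UNIV. 1 / p i)"
    and u_range: "1 < u"
    and u'_def: "1 / u + 1 / u' = 1"
    and s_pos: "0 < s"
    and bounded: "\<forall>m :: real^'n^'l \<Rightarrow> complex.
         m \<in> borel_measurable lborel \<and> bounded (range m) \<and> A_norm \<Theta> u s m < top \<longrightarrow>
         (\<forall>f :: 'l \<Rightarrow> real^'n \<Rightarrow> complex. (\<forall>i. schwartz (f i)) \<longrightarrow>
            Lp_norm pp (T_mult m f) \<le> ennreal C * A_norm \<Theta> u s m * (\<Prod>i\<in>UNIV. Lp_norm (p i) (f i)))"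
  shows "s / real CARD('n) \<ge>
           max (real CARD('l) / u)
             (max (Max ((\<lambda>I. 1 / pp - 1/2 - (\<Sum>i\<in>I. 1 / p i - 1/2)) ` Pow UNIV))
                  (Max ((\<lambda>I. 1 / pp - 1 / u' - (\<Sum>i\<in>I. 1 / p i - 1 / u)) ` Pow UNIV)))"
proof -
  let ?n = "real CARD('n)"
  have n: "?n > 0" by simp
  have "1 / pp > 0"
    unfolding pp_def using p_range by (intro sum_pos) (auto intro: less_trans[OF zero_less_one])
  then have pp: "pp > 0" by simp
  note hyps = Theta_schwartz Theta_supp p_range pp u_range s_pos bounded
  have scale: "x \<le> s / ?n" if "?n * x \<le> s" for x
    using that n by (simp add: field_simps)
  \<comment> \<open>For the full index set there is no coupling cost, and \<open>1 / pp\<close>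
    cancels against the sum of all \<open>1 / p i\<close>.\<close>
  have l: "real CARD('l) / u \<le> s / ?n"
    using bump_condition[OF hyps, of UNIV] by (intro scale) (simp add: pp_def)
  have chirp: "1 / pp - 1/2 - (\<Sum>i\<in>I. 1 / p i - 1/2) \<le> s / ?n" for I
    by (intro scale chirp_condition[OF hyps])
  have bump: "1 / pp - 1 / u' - (\<Sum>i\<in>I. 1 / p i - 1 / u) \<le> s / ?n" for I :: "'l set"
  \<comment> \<open>For the full set the asserted bound is \<open>l / u - 1 / u'\<close>, which
    follows from the bound \<open>l / u\<close> since \<open>1 / u'\<close> is nonnegative.\<close>
  proof (cases "I = UNIV")
    case True
    have "1 / u < 1" using u_range by simp
    then have "1 / u' \<ge> 0" using u'_def by linarith
    moreover have "1 / pp - 1 / u' - (\<Sum>i\<in>I. 1 / p i - 1 / u) = real CARD('l) / u - 1 / u'"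
      unfolding True sum_subtractf pp_def by simp
    ultimately show ?thesis using l by linarith
  next
    case False
    \<comment> \<open>With \<open>1 / u' = 1 - 1 / u\<close>, the term \<open>- 1 / u'\<close>
      splits into the coupling cost \<open>- 1\<close> and the gain \<open>1 / u\<close> of the one
      additional confined block.\<close>
    have eq: "1 / pp - 1 / u' - (\<Sum>i\<in>I. 1 / p i - 1 / u) = 1 / pp - 1 + (real (card I) + 1) / u - (\<Sum>i\<in>I. 1 / p i)"
      using u'_def by (simp add: sum_subtractf add_divide_distrib)
    show ?thesis
      unfolding eq using bump_condition[OF hyps, of I] False by (intro scale) (simp only: if_False)
  qed
  show ?thesis
    using l chirp bump by (auto intro!: max.boundedI simp: Max_le_iff)
qed

end
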